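(* Let $n\ge 2$ be an integer. There is a nonzero constant $\alpha_{2n}$, depending only on $n$, such that the following holds. Let $f:\mathbb{R}^{2n}\to\mathbb{R}$ be continuous, of class $C^\infty$ on $\mathbb{R}^{2n}\setminus\{0\}$, rotationally symmetric about the axis $e_{2n}$, and homogeneous of degree $1$ in the sense that $f(\lambda x)=|\lambda|f(x)$ for all $\lambda\in\mathbb{R}$, $x\in\mathbb{R}^{2n}$. Put $$\varphi(t)=f(e_{2n-1}+te_{2n}),\qquad t\in\mathbb{R}.$$ Let $\mathcal{T}^{-1}f$ be the inverse cosine transform of the restriction of $f$ to $S^{2n-1}$; it is rotationally symmetric about $e_{2n}$, and for $0<x<1$ let $(\mathcal{T}^{-1}f)(x)$ denote its value at the points $u\in S^{2n-1}$ with $\langle u,e_{2n}\rangle=x$. Then for every $x\in(0,1)$, $$\alpha_{2n}^{-1}\,(\mathcal{T}^{-1}f)(x)=\frac{(-2)^{n-1}}{x^{2n+1}}\;\frac{d^{\,n-1}}{dt^{\,n-1}}\big(\varphi''(\sqrt{t})\big)\Big|_{t=\frac{1-x^2}{x^2}}.$$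
   Context: $e_1,\dots,e_{2n}$ is the standard basis of $\mathbb{R}^{2n}$. A function $f$ on $\mathbb{R}^{2n}$ (or on $S^{2n-1}$) is rotationally symmetric about $e_{2n}$ if $f\circ U=f$ for every orthogonal transformation $U$ of $\mathbb{R}^{2n}$ with $Ue_{2n}=e_{2n}$. Let $C_e^\infty(S^{2n-1})$ be the space of even infinitely differentiable functions on the sphere $S^{2n-1}$. The cosine transform of $g\in C_e^\infty(S^{2n-1})$ is $$(\mathcal{T}g)(u)=\int_{S^{2n-1}}|\langle u,v\rangle|\,g(v)\,d\lambda(v),\qquad u\in S^{2n-1},$$ where $\lambda$ is the spherical Lebesgue measure on $S^{2n-1}$. It is known that $\mathcal{T}$ is a bijection of $C_e^\infty(S^{2n-1})$ onto itself; $\mathcal{T}^{-1}$ denotes its inverse, and it maps rotationally symmetric functions to rotationally symmetric functions with the same axis. *)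

theory Defs
  imports "HOL-Analysis.Analysis"
begin

text \<open>\<open>smooth_on S f\<close> is used for open \<open>S\<close> only: \<open>f\<close> has continuous iterated directional
  derivatives of all orders on \<open>S\<close>.\<close>

primrec k_smooth_on :: "nat \<Rightarrow> 'a::euclidean_space set \<Rightarrow> ('a \<Rightarrow> real) \<Rightarrow> bool" where
  "k_smooth_on 0 S f \<longleftrightarrow> continuous_on S f"
| "k_smooth_on (Suc k) S f \<longleftrightarrow>
     (\<forall>x\<in>S. f differentiable (at x)) \<and>
     (\<forall>v. k_smooth_on k S (\<lambda>x. frechet_derivative f (at x) v))"

definition smooth_on :: "'a::euclidean_space set \<Rightarrow> ('a \<Rightarrow> real) \<Rightarrow> bool" where
  "smooth_on S f \<longleftrightarrow> (\<forall>k. k_smooth_on k S f)"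

definition rotationally_symmetric :: "'a::euclidean_space \<Rightarrow> ('a \<Rightarrow> real) \<Rightarrow> bool" where
  "rotationally_symmetric e f \<longleftrightarrow>
     (\<forall>U. orthogonal_transformation U \<and> U e = e \<longrightarrow> f \<circ> U = f)"

text \<open>Spherical Lebesgue measure: the measure of \<open>A\<close> is the dimension times the Lebesgue measure
  of the cone \<open>{r *\<^sub>R v | r v. 0 < r \<and> r \<le> 1 \<and> v \<in> A}\<close>, so that the total mass is the
  surface area of the unit sphere.\<close>

definition sphere_measure :: "'a::euclidean_space measure" where
  "sphere_measure =
     scale_measure (of_nat DIM('a))
       (distr (restrict_space lborel (cball 0 1 - {0})) (restrict_space borel (sphere 0 1))
          (\<lambda>x. x /\<^sub>R norm x))"

text \<open>Functions on the sphere are represented by extensional functions (undefined off the sphere),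
  so that each of them has exactly one representative and the inverse of the cosine transform is
  meaningful. Smoothness on the sphere as an embedded submanifold means having a smooth
  extension to some open neighbourhood.\<close>

definition even_smooth_sphere :: "('a::euclidean_space \<Rightarrow> real) set" where
  "even_smooth_sphere =
     {g \<in> extensional (sphere 0 1).
        (\<forall>v\<in>sphere 0 1. g (- v) = g v) \<and>
        (\<exists>W h. open W \<and> sphere 0 1 \<subseteq> W \<and> smooth_on W h \<and> (\<forall>v\<in>sphere 0 1. h v = g v))}"

definition cosine_transform :: "('a::euclidean_space \<Rightarrow> real) \<Rightarrow> 'a \<Rightarrow> real" where
  "cosine_transform g = (\<lambda>u\<in>sphere 0 1. LINT v|sphere_measure. \<bar>u \<bullet> v\<bar> * g v)"

definition inverse_cosine_transform :: "('a::euclidean_space \<Rightarrow> real) \<Rightarrow> 'a \<Rightarrow> real" where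
  "inverse_cosine_transform = inv_into even_smooth_sphere cosine_transform"

end

theory Submission
  imports Defs
begin

text \<open>Put \<open>k = n - 1\<close>, let \<open>\<psi> r = f (e\<^bsub>2n\<^esub> + r e\<^bsub>2n-1\<^esub>)\<close>, and write \<open>s = \<langle>v, e\<^bsub>2n\<^esub>\<rangle>\<close>. By Whitney's
  theorem \<open>\<phi>'' (sqrt t)\<close> is a smooth function of \<open>t \<ge> 0\<close>; let \<open>X\<close> be its \<open>k\<close>-th derivative.
  The candidate \<open>g v = c \<bar>s\<bar>^(-2n-1) X ((1 - s\<^sup>2) / s\<^sup>2)\<close> is smooth near the poles for this reason and
  near the equator because \<open>\<phi> t = t \<psi> (1 / t)\<close>. Extended homogeneously of degree \<open>-2n-1\<close>, it turns
  \<open>\<bar>\<langle>u, v\<rangle>\<bar> g v\<close> into a function of degree \<open>-2n\<close>, so the integral over the sphere may be taken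
  over the hyperplanes \<open>s = \<plusminus>1\<close> instead. There the directions orthogonal to \<open>e\<^bsub>2n-1\<^esub>\<close> span an
  even-dimensional space, and integrating them out is a \<open>k\<close>-fold repeated integral of \<open>X\<close>, which
  gives back \<open>\<phi>''\<close>; the remaining integral \<open>\<integral> \<bar>a + t\<bar> \<phi>''(a) da\<close> equals \<open>2 \<phi> t\<close>. Hence the cosine
  transform of \<open>g\<close> is \<open>f\<close>.

  Injectivity follows: the transform is self-adjoint and by the above its range contains the
  restrictions of \<open>\<langle>v, p\<rangle>^(2j)\<close> for every axis \<open>p\<close>, which concentrate at \<open>\<plusminus>p\<close> as \<open>j\<close> grows.\<close>


section \<open>Smooth functions\<close>

text \<open>\<open>inverse_cosine_transform\<close> is an \<open>inv_into\<close>, so evaluating it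
  takes an explicit preimage together with injectivity on all of \<open>even_smooth_sphere\<close>,
  not only among symmetric functions. The even dimension is decisive: the \<open>2 * k\<close>
  directions orthogonal to both axes contribute a density proportional to \<open>z ^ (k - 1)\<close>
  in their squared norm \<open>z\<close>, an integer power, so that \<open>k\<close> derivatives
  undo the integration exactly; an odd dimension would give half-integer powers. The constant
  collects 2 for the two hyperplanes, \<open>k\<close> times the volume of the unit ball of
  dimension \<open>2 * k\<close> for the density, \<open>(-1) ^ k * fact (k - 1)\<close> for the
  repeated integral, and 2 for the kernel \<open>\<bar>a + t\<bar>\<close>, whose second derivative
  is twice a point mass. Regularity is the delicate point: the variable of \<open>X\<close> reaches
  its endpoint 0 at the poles, which forces one-sided derivatives, and goes to infinity at the
  equator. The integral is computed only for directions on one affine line; rotations, homogeneity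
  and continuity at the pole supply the others.\<close>

lemma k_smooth_on_cong:
  assumes "open S" "\<And>x. x \<in> S \<Longrightarrow> f x = g x" "k_smooth_on k S f"
  shows "k_smooth_on k S g"
  using assms(2,3)
proof (induction k arbitrary: f g)
  case 0
  then show ?case by (simp cong: continuous_on_cong)
next
  case (Suc k)
  have D: "(g has_derivative frechet_derivative f (at x)) (at x)" if "x \<in> S" for x
  proof -
    have "(f has_derivative frechet_derivative f (at x)) (at x)"
      using Suc.prems that by (simp add: frechet_derivative_works)
    then show ?thesis
      using has_derivative_transform_within_open[OF _ \<open>open S\<close> that] Suc.prems(1) by blast
  qed
  then have E: "frechet_derivative f (at x) = frechet_derivative g (at x)" if "x \<in> S" for x
    using that frechet_derivative_at by blast
  show ?case
    using D E Suc.prems(2) Suc.IH[of "\<lambda>x. frechet_derivative f (at x) v" "\<lambda>x. frechet_derivative g (at x) v" for v]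
    by (auto simp: differentiable_def)
qed

text \<open>Lets an explicit derivative replace \<open>frechet_derivative\<close>; on an open set
  the two agree by uniqueness.\<close>

lemma k_smooth_on_SucI:
  assumes "open S" "\<And>x. x \<in> S \<Longrightarrow> (f has_derivative f' x) (at x)"
    and "\<And>v. k_smooth_on k S (\<lambda>x. f' x v)"
  shows "k_smooth_on (Suc k) S f"
proof -
  have "k_smooth_on k S (\<lambda>x. frechet_derivative f (at x) v)" for v
    using assms(3)[of v]
    by (rule k_smooth_on_cong[OF assms(1), rotated]) (metis assms(2) frechet_derivative_at)
  then show ?thesis
    using assms(2) by (auto simp: differentiable_def)
qed

lemma k_smooth_on_SucD:
  assumes "k_smooth_on (Suc k) S f"
  shows "k_smooth_on k S f"
  using assms
proof (induction k arbitrary: f)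
  case 0
  then show ?case
    by (auto intro!: continuous_at_imp_continuous_on differentiable_imp_continuous_within)
qed auto

lemma k_smooth_on_SucE:
  assumes "k_smooth_on (Suc k) S f"
  obtains f' where "\<And>x. x \<in> S \<Longrightarrow> (f has_derivative f' x) (at x)"
    and "\<And>v. k_smooth_on k S (\<lambda>x. f' x v)"
  using assms frechet_derivative_works by (metis k_smooth_on.simps(2))

lemma k_smooth_on_const: "open S \<Longrightarrow> k_smooth_on k S (\<lambda>_. c)"
proof (induction k arbitrary: c)
  case (Suc k)
  show ?case
    by (rule k_smooth_on_SucI[OF Suc.prems, where f' = "\<lambda>_ _. 0"]) (auto intro: Suc)
qed auto

lemma k_smooth_on_bounded_linear:
  assumes "open S" "bounded_linear L"
  shows "k_smooth_on k S L"
proof (cases k)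
  case 0
  then show ?thesis
    using assms by (simp add: linear_continuous_on)
next
  case (Suc j)
  show ?thesis
    unfolding Suc
    by (rule k_smooth_on_SucI[OF assms(1), where f' = "\<lambda>_. L"])
       (auto intro: k_smooth_on_const assms bounded_linear_imp_has_derivative)
qed

lemma k_smooth_on_add:
  assumes "open S" "k_smooth_on k S f" "k_smooth_on k S g"
  shows "k_smooth_on k S (\<lambda>x. f x + g x)"
  using assms(2,3)
proof (induction k arbitrary: f g)
  case 0
  then show ?case by (auto intro: continuous_intros)
next
  case (Suc k)
  obtain f' where f': "\<And>x. x \<in> S \<Longrightarrow> (f has_derivative f' x) (at x)"
    "\<And>v. k_smooth_on k S (\<lambda>x. f' x v)" using k_smooth_on_SucE[OF Suc.prems(1)] by metis
  obtain g' where g': "\<And>x. x \<in> S \<Longrightarrow> (g has_derivative g' x) (at x)"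
    "\<And>v. k_smooth_on k S (\<lambda>x. g' x v)" using k_smooth_on_SucE[OF Suc.prems(2)] by metis
  show ?case
    by (rule k_smooth_on_SucI[OF assms(1), where f' = "\<lambda>x v. f' x v + g' x v"])
       (auto intro: has_derivative_add f' g' Suc.IH)
qed

text \<open>The product rule leaves one factor undifferentiated, hence the appeal to
  \<open>k_smooth_on_SucD\<close> in the induction.\<close>

lemma k_smooth_on_mult:
  assumes "open S" "k_smooth_on k S f" "k_smooth_on k S g"
  shows "k_smooth_on k S (\<lambda>x. f x * g x)"
  using assms(2,3)
proof (induction k arbitrary: f g)
  case 0
  then show ?case by (auto intro: continuous_intros)
next
  case (Suc k)
  obtain f' where f': "\<And>x. x \<in> S \<Longrightarrow> (f has_derivative f' x) (at x)"
    "\<And>v. k_smooth_on k S (\<lambda>x. f' x v)" using k_smooth_on_SucE[OF Suc.prems(1)] by metis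
  obtain g' where g': "\<And>x. x \<in> S \<Longrightarrow> (g has_derivative g' x) (at x)"
    "\<And>v. k_smooth_on k S (\<lambda>x. g' x v)" using k_smooth_on_SucE[OF Suc.prems(2)] by metis
  show ?case
    by (rule k_smooth_on_SucI[OF assms(1), where f' = "\<lambda>x v. f x * g' x v + f' x v * g x"])
       (simp_all add: has_derivative_mult f' g' Suc.IH k_smooth_on_add assms(1)
          k_smooth_on_SucD[OF Suc.prems(1)] k_smooth_on_SucD[OF Suc.prems(2)])
qed

text \<open>Smoothness is local. This glues the two formulas for the candidate, one valid off the
  equator and one off the axis.\<close>

lemma k_smooth_on_Un:
  assumes "open S" "open T" "k_smooth_on k S f" "k_smooth_on k T f"
  shows "k_smooth_on k (S \<union> T) f"
  using assms(3,4)
proof (induction k arbitrary: f)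
  case 0
  then show ?case by (simp add: continuous_on_open_Un assms(1,2))
next
  case (Suc k)
  then show ?case by simp blast
qed

lemma k_smooth_on_inner_self:
  assumes "open S"
  shows "k_smooth_on k S (\<lambda>x. x \<bullet> x)"
proof (cases k)
  case 0
  then show ?thesis by (auto intro: continuous_intros)
next
  case (Suc j)
  have "k_smooth_on j S (\<lambda>x. x \<bullet> v + v \<bullet> x)" for v
    by (intro k_smooth_on_add k_smooth_on_bounded_linear assms bounded_linear_inner_left
        bounded_linear_inner_right)
  then show ?thesis
    unfolding Suc
    by (intro k_smooth_on_SucI[OF assms, where f' = "\<lambda>x v. x \<bullet> v + v \<bullet> x"])
       (auto intro!: derivative_eq_intros)
qed

text \<open>The set \<open>T\<close> need not be open: squared norms range over \<open>{0..}\<close>, and functions of a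
  squared norm are composed with towers of one-sided derivatives.\<close>

definition derivative_tower :: "real set \<Rightarrow> (nat \<Rightarrow> real \<Rightarrow> real) \<Rightarrow> bool" where
  "derivative_tower T F \<longleftrightarrow>
     (\<forall>k. \<forall>t\<in>T. (F k has_real_derivative F (Suc k) t) (at t within T))"

lemma derivative_towerD:
  "derivative_tower T F \<Longrightarrow> t \<in> T \<Longrightarrow> (F k has_real_derivative F (Suc k) t) (at t within T)"
  by (simp add: derivative_tower_def)

lemma derivative_tower_continuous_on: "derivative_tower T F \<Longrightarrow> continuous_on T (F k)"
  by (meson DERIV_continuous_on derivative_towerD)

text \<open>Chain rule with derivatives taken within \<open>T\<close>: since \<open>w\<close> maps
  \<open>S\<close> into \<open>T\<close>, no other points of the line matter. The index
  \<open>j\<close> is general because each differentiation turns \<open>F j\<close> into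
  \<open>F (Suc j)\<close>.\<close>

lemma k_smooth_on_compose_tower:
  assumes "open S" "k_smooth_on k S w" "\<And>x. x \<in> S \<Longrightarrow> w x \<in> T" "derivative_tower T F"
  shows "k_smooth_on k S (\<lambda>x. F j (w x))"
  using assms(2)
proof (induction k arbitrary: j)
  case 0
  then show ?case
    using assms(3) continuous_on_compose2[OF derivative_tower_continuous_on[OF assms(4)]]
    by (simp add: image_subset_iff) blast
next
  case (Suc k)
  obtain w' where w': "\<And>x. x \<in> S \<Longrightarrow> (w has_derivative w' x) (at x)"
    "\<And>v. k_smooth_on k S (\<lambda>x. w' x v)" using k_smooth_on_SucE[OF Suc.prems] by metis
  show ?case
  proof (rule k_smooth_on_SucI[OF assms(1), where f' = "\<lambda>x v. F (Suc j) (w x) * w' x v"])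
    fix x assume x: "x \<in> S"
    have "(w has_derivative w' x) (at x within S)"
      using w'(1)[OF x] by (rule has_derivative_at_withinI)
    moreover have "(F j has_derivative (*) (F (Suc j) y)) (at y within T)" if "y \<in> T" for y
      using derivative_towerD[OF assms(4) that] by (simp add: has_field_derivative_def)
    moreover have "w ` S \<subseteq> T"
      using assms(3) by blast
    ultimately have "((\<lambda>x. F j (w x)) has_derivative (\<lambda>v. F (Suc j) (w x) * w' x v)) (at x within S)"
      using has_derivative_in_compose2[where t = T and g = "F j" and g' = "\<lambda>y. (*) (F (Suc j) y)"
          and f = w and f' = "w' x" and s = S and x = x] x by blast
    then show "((\<lambda>x. F j (w x)) has_derivative (\<lambda>v. F (Suc j) (w x) * w' x v)) (at x)"
      by (simp add: at_within_open[OF x assms(1)])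
  next
    show "k_smooth_on k S (\<lambda>x. F (Suc j) (w x) * w' x v)" for v
      by (rule k_smooth_on_mult[OF assms(1) Suc.IH[OF k_smooth_on_SucD[OF Suc.prems]] w'(2)])
  qed
qed

lemma smooth_on_const: "open S \<Longrightarrow> smooth_on S (\<lambda>_. c)"
  by (simp add: smooth_on_def k_smooth_on_const)

lemma smooth_on_bounded_linear: "open S \<Longrightarrow> bounded_linear L \<Longrightarrow> smooth_on S L"
  by (simp add: smooth_on_def k_smooth_on_bounded_linear)

lemma smooth_on_add:
  "open S \<Longrightarrow> smooth_on S f \<Longrightarrow> smooth_on S g \<Longrightarrow> smooth_on S (\<lambda>x. f x + g x)"
  by (simp add: smooth_on_def k_smooth_on_add)

lemma smooth_on_mult:
  "open S \<Longrightarrow> smooth_on S f \<Longrightarrow> smooth_on S g \<Longrightarrow> smooth_on S (\<lambda>x. f x * g x)"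
  by (simp add: smooth_on_def k_smooth_on_mult)

lemma smooth_on_Un:
  "open S \<Longrightarrow> open T \<Longrightarrow> smooth_on S f \<Longrightarrow> smooth_on T f \<Longrightarrow> smooth_on (S \<union> T) f"
  by (simp add: smooth_on_def k_smooth_on_Un)

lemma smooth_on_inner_self: "open S \<Longrightarrow> smooth_on S (\<lambda>x. x \<bullet> x)"
  by (simp add: smooth_on_def k_smooth_on_inner_self)

lemma smooth_on_cong:
  "open S \<Longrightarrow> (\<And>x. x \<in> S \<Longrightarrow> f x = g x) \<Longrightarrow> smooth_on S f \<Longrightarrow> smooth_on S g"
  unfolding smooth_on_def by (meson k_smooth_on_cong)

lemma smooth_on_compose_tower:
  assumes "open S" "smooth_on S w" "\<And>x. x \<in> S \<Longrightarrow> w x \<in> T" "derivative_tower T F"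
  shows "smooth_on S (\<lambda>x. F j (w x))"
  using k_smooth_on_compose_tower[where w = w and T = T and F = F and S = S] assms
  unfolding smooth_on_def by blast

lemma smooth_on_imp_continuous_on: "smooth_on S f \<Longrightarrow> continuous_on S f"
  using k_smooth_on.simps(1) unfolding smooth_on_def by blast

lemma smooth_on_frechet:
  assumes "smooth_on S f"
  shows "smooth_on S (\<lambda>x. frechet_derivative f (at x) v)"
    and "x \<in> S \<Longrightarrow> (f has_derivative frechet_derivative f (at x)) (at x)"
proof -
  have "k_smooth_on (Suc k) S f" for k
    using assms by (simp add: smooth_on_def del: k_smooth_on.simps)
  then have "k_smooth_on k S (\<lambda>x. frechet_derivative f (at x) v)"
    "x \<in> S \<Longrightarrow> f differentiable (at x)" for k
    by simp_all
  then show "smooth_on S (\<lambda>x. frechet_derivative f (at x) v)"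
    "x \<in> S \<Longrightarrow> (f has_derivative frechet_derivative f (at x)) (at x)"
    by (simp_all add: smooth_on_def frechet_derivative_works)
qed

text \<open>The directional derivative along \<open>q\<close> is iterated on \<open>f\<close>
  itself. This is the passage from functions on space to functions of one variable, applied to lines
  that avoid the origin.\<close>

lemma smooth_on_imp_derivative_tower_line:
  fixes f :: "'a::euclidean_space \<Rightarrow> real"
  assumes "smooth_on S f" "\<And>t. t \<in> T \<Longrightarrow> p + t *\<^sub>R q \<in> S"
  obtains F where "derivative_tower T F" "F 0 = (\<lambda>t. f (p + t *\<^sub>R q))"
proof -
  define D where "D k = ((\<lambda>h x. frechet_derivative h (at x) q) ^^ k) f" for k
  have sm: "smooth_on S (D k)" for k
    by (induction k) (auto simp: D_def assms smooth_on_frechet)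
  have "((\<lambda>t. D k (p + t *\<^sub>R q)) has_real_derivative D (Suc k) (p + t *\<^sub>R q)) (at t within T)"
    if "t \<in> T" for k t
  proof -
    have L: "((\<lambda>t. p + t *\<^sub>R q) has_derivative (\<lambda>h. h *\<^sub>R q)) (at t within T)"
      by (auto intro!: derivative_eq_intros)
    have DD: "(D k has_derivative frechet_derivative (D k) (at (p + t *\<^sub>R q))) (at (p + t *\<^sub>R q))"
      using smooth_on_frechet(2)[OF sm] assms(2) that by blast
    have "((\<lambda>t. D k (p + t *\<^sub>R q)) has_derivative
        (\<lambda>h. frechet_derivative (D k) (at (p + t *\<^sub>R q)) (h *\<^sub>R q))) (at t within T)"
      using has_derivative_compose[OF L DD] .
    moreover have "frechet_derivative (D k) (at (p + t *\<^sub>R q)) (h *\<^sub>R q) =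
        D (Suc k) (p + t *\<^sub>R q) * h" for h
      using has_derivative_linear[OF DD] by (simp add: linear_cmul D_def)
    ultimately show ?thesis
      by (simp add: has_field_derivative_def)
  qed
  then show thesis
    using that[of "\<lambda>k t. D k (p + t *\<^sub>R q)"] by (simp add: derivative_tower_def D_def)
qed

text \<open>The coefficients are falling factorials. Real exponents are wanted because odd powers of
  a length appear as half-integer powers of a smooth square.\<close>

lemma derivative_tower_powr:
  obtains F where "derivative_tower {0<..} F" "F 0 = (\<lambda>x. x powr p)"
proof -
  define F where "F k x = (\<Prod>i<k. p - real i) * x powr (p - real k)" for k x
  have "(F k has_real_derivative F (Suc k) x) (at x within {0<..})" if "x > 0" for k x
  proof -
    have "((\<lambda>x. x powr (p - real k)) has_real_derivative (p - real k) * x powr (p - real k - 1))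
        (at x within {0<..})"
      using that by (auto intro!: has_real_derivative_powr[THEN DERIV_subset])
    then have "((\<lambda>x. (\<Prod>i<k. p - real i) * x powr (p - real k)) has_real_derivative
       (\<Prod>i<k. p - real i) * ((p - real k) * x powr (p - real k - 1))) (at x within {0<..})"
      by (rule DERIV_cmult)
    then show ?thesis by (simp add: F_def[abs_def] algebra_simps)
  qed
  then show thesis
    by (intro that[of F]) (auto simp: derivative_tower_def F_def[of 0])
qed

lemma smooth_on_powr:
  assumes "open S" "smooth_on S w" "\<And>x. x \<in> S \<Longrightarrow> w x > 0"
  shows "smooth_on S (\<lambda>x. w x powr p)"
proof -
  obtain F where F: "derivative_tower {0<..} F" "F 0 = (\<lambda>x. x powr p)"
    by (rule derivative_tower_powr)
  show ?thesis
    using smooth_on_compose_tower[OF assms(1,2) _ F(1), of 0] assms(3) F(2) by auto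
qed

section \<open>Even functions and their behaviour at infinity\<close>

lemma derivative_tower_imp_smooth_on:
  assumes "derivative_tower UNIV F"
  shows "smooth_on UNIV (F j)"
  using smooth_on_compose_tower[where w = "\<lambda>x. x" and T = UNIV and F = F and S = UNIV] assms
    smooth_on_bounded_linear[OF open_UNIV bounded_linear_ident] by simp

lemma even_derivative_odd:
  fixes h :: "real \<Rightarrow> real"
  assumes "\<And>t. h (- t) = h t" "\<And>t. (h has_real_derivative h' t) (at t)"
  shows "h' (- t) = - h' t"
proof -
  have "((\<lambda>t. h (- t)) has_real_derivative (- h' (- t))) (at t)"
    by (rule DERIV_mirror[THEN iffD1]) (simp add: assms(2))
  then have "(h has_real_derivative (- h' (- t))) (at t)"
    using assms(1) by simp
  then show ?thesis
    using DERIV_unique[OF assms(2)] by fastforce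
qed

lemma odd_derivative_even:
  fixes h :: "real \<Rightarrow> real"
  assumes "\<And>t. h (- t) = - h t" "\<And>t. (h has_real_derivative h' t) (at t)"
  shows "h' (- t) = h' t"
proof -
  have "((\<lambda>t. - h (- t)) has_real_derivative (- (- h' (- t)))) (at t)"
    by (intro DERIV_minus DERIV_mirror[THEN iffD1]) (simp add: assms(2))
  then have "(h has_real_derivative h' (- t)) (at t)"
    using assms(1) by simp
  then show ?thesis
    using DERIV_unique[OF assms(2)] by fastforce
qed

lemma derivative_tower_even:
  assumes "derivative_tower UNIV H" "\<And>t. H 0 (- t) = H 0 t"
  shows "H 1 (- t) = - H 1 t" "H 2 (- t) = H 2 t"
proof -
  have D: "(H k has_real_derivative H (Suc k) t) (at t)" for k t
    using derivative_towerD[OF assms(1)] by simp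
  show o: "H 1 (- t) = - H 1 t" for t
    using even_derivative_odd[of "H 0" "H 1"] assms(2) D[of 0] by simp
  show "H 2 (- t) = H 2 t"
    using odd_derivative_even[of "H 1" "H 2"] o D[of 1] by (simp add: numeral_2_eq_2)
qed

section \<open>Even smooth functions as smooth functions of the square\<close>

text \<open>By the mean value theorem, difference quotients at the endpoint are values of
  \<open>g\<close> at nearby points. It settles 0, where \<open>sqrt\<close> has no
  derivative.\<close>

lemma DERIV_within_atLeast_limit:
  fixes f g :: "real \<Rightarrow> real"
  assumes "continuous_on {0..} f" "continuous_on {0..} g"
    and "\<And>x. x > 0 \<Longrightarrow> (f has_real_derivative g x) (at x)"
  shows "(f has_real_derivative g 0) (at 0 within {0..})"
  unfolding has_field_derivative_iff Lim_within
proof (intro allI impI)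
  fix e :: real assume "e > 0"
  moreover have "(g \<longlongrightarrow> g 0) (at 0 within {0..})"
    using assms(2) by (simp add: continuous_on_def)
  ultimately obtain d where d: "d > 0"
    "\<And>x. x \<in> {0..} \<Longrightarrow> 0 < dist x 0 \<Longrightarrow> dist x 0 < d \<Longrightarrow> dist (g x) (g 0) < e"
    unfolding Lim_within by metis
  have "dist ((f y - f 0) / (y - 0)) (g 0) < e" if y: "y \<in> {0..}" "0 < dist y 0" "dist y 0 < d" for y
  proof -
    have y0: "0 < y" "y < d" using y by auto
    have "\<exists>l z. 0 < z \<and> z < y \<and> (f has_real_derivative l) (at z) \<and> f y - f 0 = (y - 0) * l"
      by (rule MVT) (use y0 assms in \<open>auto intro: continuous_on_subset simp: real_differentiable_def\<close>)
    then obtain l z where z: "0 < z" "z < y" "(f has_real_derivative l) (at z)" "f y - f 0 = y * l"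
      by auto
    then have "l = g z" using assms(3) DERIV_unique by blast
    then show ?thesis using z y0 d(2)[of z] by (simp add: dist_real_def)
  qed
  then show "\<exists>d>0. \<forall>x\<in>{0..}. 0 < dist x 0 \<and> dist x 0 < d \<longrightarrow> dist ((f x - f 0) / (x - 0)) (g 0) < e"
    using d(1) by blast
qed

text \<open>Differentiation under the integral sign; every derivative brings out one more factor
  \<open>s\<close>.\<close>

lemma derivative_tower_average:
  assumes H: "derivative_tower UNIV H"
  obtains I where "derivative_tower UNIV I" "\<And>t. I 0 t = integral {0..1} (\<lambda>s. H m (s * t))"
proof -
  define I where "I k t = integral {0..1} (\<lambda>s. s ^ k * H (m + k) (s * t))" for k t
  have c: "continuous_on UNIV (H k)" for k
    using derivative_tower_continuous_on[OF H] .
  have "(I k has_real_derivative I (Suc k) t) (at t within UNIV)" for k t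
    unfolding I_def[abs_def] box_real[symmetric]
  proof (rule leibniz_rule_field_derivative)
    show "((\<lambda>t. s ^ k * H (m + k) (s * t)) has_real_derivative s ^ Suc k * H (m + Suc k) (s * t))
        (at t within UNIV)" for s t
    proof -
      have "(H (m + k) has_real_derivative H (m + Suc k) (s * t)) (at (s * t))"
        using derivative_towerD[OF H, of "s * t" "m + k"] by simp
      then have "((\<lambda>t. H (m + k) (s * t)) has_real_derivative H (m + Suc k) (s * t) * s) (at t)"
        by (rule DERIV_chain2) (auto intro!: derivative_eq_intros)
      then show ?thesis
        by (auto intro!: derivative_eq_intros)
    qed
    show "(\<lambda>s. s ^ k * H (m + k) (s * t)) integrable_on cbox 0 1" for t
      by (intro integrable_continuous continuous_intros continuous_on_compose2[OF c]) auto
    show "continuous_on (UNIV \<times> cbox 0 1) (\<lambda>(t, s). s ^ Suc k * H (m + Suc k) (s * t))"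
      unfolding split_beta
      by (intro continuous_intros continuous_on_compose2[OF c]) auto
  qed auto
  then show thesis
    by (intro that[of I]) (auto simp: derivative_tower_def I_def[of 0])
qed

text \<open>With \<open>t = sqrt x\<close> the derivative is \<open>H 1 t / (2 * t)\<close>. As
  \<open>H 1\<close> is odd it vanishes at 0, so \<open>H 1 t / t\<close> is the average of
  \<open>H 2\<close> over the segment from 0 to \<open>t\<close>, which is again smooth and even;
  \<open>G\<close> is half of it.\<close>

lemma even_function_of_square_step:
  assumes H: "derivative_tower UNIV H" "\<And>t. H 0 (- t) = H 0 t"
  obtains G where "derivative_tower UNIV G" "\<And>t. G 0 (- t) = G 0 t"
    and "\<And>x. x \<ge> 0 \<Longrightarrow> ((\<lambda>x. H 0 (sqrt x)) has_real_derivative G 0 (sqrt x)) (at x within {0..})"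
proof -
  obtain I where I: "derivative_tower UNIV I" "\<And>t. I 0 t = integral {0..1} (\<lambda>s. H 2 (s * t))"
    using derivative_tower_average[OF H(1)] by metis
  define G where "G k t = I k t / 2" for k t
  have G: "derivative_tower UNIV G"
    using I(1) by (auto simp: derivative_tower_def G_def[abs_def] intro: DERIV_cdivide)
  have even: "G 0 (- t) = G 0 t" for t
    using derivative_tower_even[OF H] by (simp add: G_def I(2))
  have HD: "(H k has_real_derivative H (Suc k) t) (at t)" for k t
    using derivative_towerD[OF H(1)] by simp
  have H1: "H 1 t = t * I 0 t" for t
  proof -
    have "((\<lambda>s. H 2 (s * t) * t) has_integral H 1 (1 * t) - H 1 (0 * t)) {0..1}"
    proof (rule fundamental_theorem_of_calculus)
      fix s assume "s \<in> {0..1::real}"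
      have "((\<lambda>s. H 1 (s * t)) has_real_derivative H 2 (s * t) * t) (at s)"
        using HD[of 1] by (intro DERIV_chain2[where f = "H 1"])
          (auto intro!: derivative_eq_intros simp: numeral_2_eq_2)
      then show "((\<lambda>s. H 1 (s * t)) has_vector_derivative H 2 (s * t) * t) (at s within {0..1})"
        by (meson has_real_derivative_iff_has_vector_derivative has_vector_derivative_at_within)
    qed simp
    moreover have "H 1 0 = 0"
      using derivative_tower_even(1)[OF H, of 0] by simp
    ultimately have "((\<lambda>s. H 2 (s * t) * t) has_integral H 1 t) {0..1}"
      by simp
    then have "integral {0..1} (\<lambda>s. H 2 (s * t) * t) = H 1 t"
      by (rule integral_unique)
    then show ?thesis by (simp add: I(2) mult.commute)
  qed
  have pos: "((\<lambda>x. H 0 (sqrt x)) has_real_derivative G 0 (sqrt x)) (at x)" if "x > 0" for x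
  proof -
    have "((\<lambda>x. H 0 (sqrt x)) has_real_derivative H (Suc 0) (sqrt x) * (inverse (sqrt x) / 2)) (at x)"
      by (rule DERIV_chain2[OF HD DERIV_real_sqrt[OF that]])
    moreover have "H (Suc 0) (sqrt x) * (inverse (sqrt x) / 2) = G 0 (sqrt x)"
      using H1[of "sqrt x"] that by (simp add: G_def field_simps)
    ultimately show ?thesis by simp
  qed
  have "((\<lambda>x. H 0 (sqrt x)) has_real_derivative G 0 (sqrt x)) (at x within {0..})" if "x \<ge> 0" for x
  proof (cases "x = 0")
    case True
    have "continuous_on {0..} (\<lambda>x. H 0 (sqrt x))" "continuous_on {0..} (\<lambda>x. G 0 (sqrt x))"
      by (intro continuous_on_compose2[OF derivative_tower_continuous_on[OF H(1)]]
          continuous_on_compose2[OF derivative_tower_continuous_on[OF G]] continuous_intros;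
          simp)+
    then show ?thesis
      using DERIV_within_atLeast_limit[of "\<lambda>x. H 0 (sqrt x)" "\<lambda>x. G 0 (sqrt x)"] pos True by simp
  next
    case False
    then show ?thesis using that pos by (simp add: has_field_derivative_at_within)
  qed
  then show thesis using that G even by blast
qed

lemma even_function_of_square:
  assumes H: "derivative_tower UNIV H" "\<And>t. H 0 (- t) = H 0 t"
  obtains X where "derivative_tower {0..} X" "\<And>x. X 0 x = H 0 (sqrt x)"
proof -
  \<comment> \<open>The step is iterated by dependent choice: \<open>P\<close> keeps every member an
    even tower and fixes the first one as \<open>H\<close>, while \<open>Q\<close> makes each
    member, after composition with \<open>sqrt\<close>, the derivative of its predecessor.\<close>
  define P where "P (k::nat) G \<longleftrightarrow> derivative_tower UNIV G \<and> (\<forall>t. G 0 (- t) = G 0 t) \<and>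
    (k = 0 \<longrightarrow> G = H)" for k G
  define Q where "Q (k::nat) F G \<longleftrightarrow> (\<forall>x\<ge>0. ((\<lambda>x. F 0 (sqrt x)) has_real_derivative G 0 (sqrt x))
     (at x within {0..}))" for k and F G :: "nat \<Rightarrow> real \<Rightarrow> real"
  have "\<exists>f. \<forall>k. P k (f k) \<and> Q k (f k) (f (Suc k))"
  proof (rule dependent_nat_choice)
    show "\<exists>G. P 0 G" using H by (auto simp: P_def)
    fix F k assume "P k F"
    then obtain G where "derivative_tower UNIV G" "\<And>t. G 0 (- t) = G 0 t"
       "\<And>x. x \<ge> 0 \<Longrightarrow> ((\<lambda>x. F 0 (sqrt x)) has_real_derivative G 0 (sqrt x)) (at x within {0..})"
      using even_function_of_square_step[of F] unfolding P_def by blast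
    then show "\<exists>G. P (Suc k) G \<and> Q k F G"
      unfolding P_def Q_def by blast
  qed
  then obtain f where f: "\<And>k. P k (f k)" "\<And>k. Q k (f k) (f (Suc k))" by blast
  show thesis
  proof (rule that)
    show "derivative_tower {0..} (\<lambda>k x. f k 0 (sqrt x))"
      using f(2) by (simp add: derivative_tower_def Q_def)
    show "f 0 0 (sqrt x) = H 0 (sqrt x)" for x
      using f(1)[of 0] by (simp add: P_def)
  qed
qed

text \<open>If \<open>X x = r ^ 3 * p r\<close> with \<open>r = 1 / sqrt x\<close>, then \<open>d/dx = - (r ^ 3 / 2) d/dr\<close> shows that
  the derivatives of \<open>X\<close> have the same shape, with \<open>p\<close> transformed as follows.\<close>

primrec profile_at_infinity :: "(real \<Rightarrow> real) \<Rightarrow> nat \<Rightarrow> real \<Rightarrow> real" where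
  "profile_at_infinity p 0 = p"
| "profile_at_infinity p (Suc j) =
     (\<lambda>r. - (1/2) * ((3 + 2 * real j) * profile_at_infinity p j r + r * deriv (profile_at_infinity p j) r))"

lemma smooth_on_deriv:
  fixes h :: "real \<Rightarrow> real"
  assumes "smooth_on UNIV h"
  shows "(h has_real_derivative deriv h r) (at r)" "smooth_on UNIV (deriv h)"
proof -
  have D: "(h has_real_derivative frechet_derivative h (at r) 1) (at r)" for r
  proof -
    have *: "(h has_derivative frechet_derivative h (at r)) (at r)"
      using smooth_on_frechet(2)[OF assms] by simp
    have "frechet_derivative h (at r) x = frechet_derivative h (at r) 1 * x" for x
      using linear_cmul[OF has_derivative_linear[OF *], of x 1] by (metis mult.commute mult_1_right real_scaleR_def)
    then have "frechet_derivative h (at r) = (*) (frechet_derivative h (at r) 1)" ..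
    then show ?thesis using * unfolding has_field_derivative_def by metis
  qed
  then have eq: "deriv h = (\<lambda>r. frechet_derivative h (at r) 1)"
    by (auto simp: fun_eq_iff intro: DERIV_imp_deriv)
  show "(h has_real_derivative deriv h r) (at r)" using D eq by simp
  show "smooth_on UNIV (deriv h)" using smooth_on_frechet(1)[OF assms] eq by simp
qed

lemma profile_at_infinity_smooth:
  assumes "smooth_on UNIV p"
  shows "smooth_on UNIV (profile_at_infinity p j)"
proof (induction j)
  case (Suc j)
  then show ?case
    using smooth_on_deriv(2)[OF Suc] unfolding profile_at_infinity.simps
    by (intro smooth_on_add smooth_on_mult smooth_on_const open_UNIV
        smooth_on_bounded_linear[OF open_UNIV bounded_linear_ident])
qed (use assms in simp)

text \<open>The derivative of an even function is odd and the factor \<open>r\<close> makes it even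
  again. Evenness later allows the absolute value of a coordinate to be replaced by the coordinate,
  which is smooth across the equator.\<close>

lemma profile_at_infinity_even:
  assumes "smooth_on UNIV p" "\<And>r. p (- r) = p r"
  shows "profile_at_infinity p j (- r) = profile_at_infinity p j r"
proof (induction j arbitrary: r)
  case (Suc j)
  have "deriv (profile_at_infinity p j) (- r) = - deriv (profile_at_infinity p j) r"
    using even_derivative_odd[of "profile_at_infinity p j", OF Suc] smooth_on_deriv(1)[OF profile_at_infinity_smooth[OF assms(1)]]
    by blast
  then show ?case using Suc by simp
qed (use assms in simp)

lemma derivative_tower_profile:
  assumes "smooth_on UNIV p" "derivative_tower {0..} X"
    and "\<And>x. x > 0 \<Longrightarrow> X 0 x = (1 / sqrt x) ^ 3 * p (1 / sqrt x)"
    and "x > 0"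
  shows "X j x = (1 / sqrt x) ^ (3 + 2 * j) * profile_at_infinity p j (1 / sqrt x)"
  using assms(4)
proof (induction j arbitrary: x)
  case (Suc j)
  define K where "K = profile_at_infinity p j"
  define r where "r = 1 / sqrt x"
  have r: "r > 0" using Suc.prems by (simp add: r_def)
  have "((\<lambda>x. 1 / sqrt x) has_real_derivative (- (r ^ 3 / 2))) (at x)"
    using Suc.prems unfolding r_def
    by (auto intro!: derivative_eq_intros simp: field_simps power3_eq_cube)
  moreover have "((\<lambda>r. r ^ (3 + 2 * j) * K r) has_real_derivative
      real (3 + 2 * j) * r ^ (2 + 2 * j) * K r + r ^ (3 + 2 * j) * deriv K r) (at r)"
    using smooth_on_deriv(1)[OF profile_at_infinity_smooth[OF assms(1)]]
    by (auto intro!: derivative_eq_intros simp: K_def algebra_simps)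
  ultimately have "((\<lambda>x. (1 / sqrt x) ^ (3 + 2 * j) * K (1 / sqrt x)) has_real_derivative
     (real (3 + 2 * j) * r ^ (2 + 2 * j) * K r + r ^ (3 + 2 * j) * deriv K r) * (- (r ^ 3 / 2))) (at x)"
    unfolding r_def by (intro DERIV_chain2[where f = "\<lambda>r. r ^ (3 + 2 * j) * K r"])
  moreover have "(real (3 + 2 * j) * r ^ (2 + 2 * j) * K r + r ^ (3 + 2 * j) * deriv K r) * (- (r ^ 3 / 2))
     = r ^ (3 + 2 * Suc j) * profile_at_infinity p (Suc j) r"
    by (simp add: K_def algebra_simps power_add eval_nat_numeral add_divide_distrib)
  ultimately have "((\<lambda>x. (1 / sqrt x) ^ (3 + 2 * j) * K (1 / sqrt x)) has_real_derivative
      r ^ (3 + 2 * Suc j) * profile_at_infinity p (Suc j) r) (at x)" by simp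
  then have "(X j has_real_derivative r ^ (3 + 2 * Suc j) * profile_at_infinity p (Suc j) r) (at x)"
    by (rule has_field_derivative_transform_within_open[where S = "{0<..}"])
      (use Suc.IH Suc.prems in \<open>auto simp: K_def\<close>)
  moreover have "(X j has_real_derivative X (Suc j) x) (at x)"
    using derivative_towerD[OF assms(2), of x j] Suc.prems
      at_within_interior[of x "{0..}"] by (simp add: interior_Ici[of "-1"])
  ultimately show ?case using DERIV_unique r_def by blast
qed (use assms in simp)

section \<open>One-dimensional integrals\<close>

lemma interval_integral_FTC_Ioi:
  fixes f F :: "real \<Rightarrow> real"
  assumes "\<And>x. x > a \<Longrightarrow> (F has_real_derivative f x) (at x)"
    and "continuous_on {a<..} f" "set_integrable lborel {a<..} f"
    and "(F \<longlongrightarrow> A) (at_right a)" "(F \<longlongrightarrow> B) at_top"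
  shows "(LINT x:{a<..}|lborel. f x) = B - A"
proof -
  have "(LBINT x=ereal a..\<infinity>. f x) = B - A"
  proof (rule interval_integral_FTC_integrable)
    show "isCont f x" if "ereal a < ereal x" for x
      using assms(2) that by (simp add: continuous_on_eq_continuous_at)
  qed (use assms in \<open>auto simp: has_real_derivative_iff_has_vector_derivative
      ereal_tendsto_simps einterval_eq_Ici\<close>)
  then show ?thesis
    by (simp add: interval_lebesgue_integral_def einterval_eq_Ici)
qed

lemma interval_integral_FTC_Iio:
  fixes f F :: "real \<Rightarrow> real"
  assumes "\<And>x. x < a \<Longrightarrow> (F has_real_derivative f x) (at x)"
    and "continuous_on {..<a} f" "set_integrable lborel {..<a} f"
    and "(F \<longlongrightarrow> A) at_bot" "(F \<longlongrightarrow> B) (at_left a)"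
  shows "(LINT x:{..<a}|lborel. f x) = B - A"
proof -
  have "(LBINT x=-\<infinity>..ereal a. f x) = B - A"
  proof (rule interval_integral_FTC_integrable)
    show "isCont f x" if "ereal x < ereal a" for x
      using assms(2) that by (simp add: continuous_on_eq_continuous_at)
  qed (use assms in \<open>auto simp: has_real_derivative_iff_has_vector_derivative
      ereal_tendsto_simps einterval_eq_Iic\<close>)
  then show ?thesis
    by (simp add: interval_lebesgue_integral_def einterval_eq_Iic)
qed

text \<open>The recursion is integration by parts.\<close>

primrec taylor_antiderivative :: "(nat \<Rightarrow> real \<Rightarrow> real) \<Rightarrow> real \<Rightarrow> nat \<Rightarrow> real \<Rightarrow> real" where
  "taylor_antiderivative X a 0 z = X 0 (a + z)"
| "taylor_antiderivative X a (Suc m) z =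
     z ^ Suc m * X (Suc m) (a + z) - real (Suc m) * taylor_antiderivative X a m z"

lemma taylor_antiderivative_DERIV:
  assumes "\<And>k. (X k has_real_derivative X (Suc k) (a + z)) (at (a + z))"
  shows "(taylor_antiderivative X a m has_real_derivative z ^ m * X (Suc m) (a + z)) (at z)"
proof -
  have D: "((\<lambda>z. X k (a + z)) has_real_derivative X (Suc k) (a + z)) (at z)" for k
    using assms[of k] DERIV_shift[of "X k" _ z a] by (simp add: add.commute)
  show ?thesis
  proof (induction m)
    case 0
    then show ?case using D[of 0] by simp
  next
    case (Suc m)
    have "((\<lambda>z. z ^ Suc m * X (Suc m) (a + z) - real (Suc m) * taylor_antiderivative X a m z)
        has_real_derivative (real (Suc m) * z ^ m * X (Suc m) (a + z) + z ^ Suc m * X (Suc (Suc m)) (a + z))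
          - real (Suc m) * (z ^ m * X (Suc m) (a + z))) (at z)"
      using DERIV_mult'[OF DERIV_pow[of "Suc m"] D[of "Suc m"]]
      by (intro DERIV_diff DERIV_cmult Suc) (simp add: algebra_simps)
    then show ?case by simp
  qed
qed

lemma taylor_antiderivative_0:
  "taylor_antiderivative X a m 0 = (-1) ^ m * fact m * X 0 a"
  by (induction m) (auto simp: algebra_simps)

lemma taylor_antiderivative_at_top:
  assumes "a \<ge> 0" "\<And>j. ((\<lambda>x. x ^ j * X j x) \<longlongrightarrow> 0) at_top"
  shows "(taylor_antiderivative X a m \<longlongrightarrow> 0) at_top"
proof -
  \<comment> \<open>Since \<open>a\<close> is nonnegative, \<open>z ^ j\<close> is at most
    \<open>(a + z) ^ j\<close>, so the decay carries over to the shifted argument.\<close>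
  have L: "((\<lambda>z. z ^ j * X j (a + z)) \<longlongrightarrow> 0) at_top" for j
  proof (rule Lim_null_comparison)
    have "filterlim (\<lambda>z. a + z) at_top at_top"
      by (rule filterlim_tendsto_add_at_top[OF tendsto_const filterlim_ident])
    then have "((\<lambda>z. (a + z) ^ j * X j (a + z)) \<longlongrightarrow> 0) at_top"
      using filterlim_compose[OF assms(2)] by blast
    then show "((\<lambda>z. \<bar>(a + z) ^ j * X j (a + z)\<bar>) \<longlongrightarrow> 0) at_top"
      by (rule tendsto_rabs_zero)
    show "eventually (\<lambda>z. norm (z ^ j * X j (a + z)) \<le> \<bar>(a + z) ^ j * X j (a + z)\<bar>) at_top"
      using eventually_ge_at_top[of 0]
    proof eventually_elim
      case (elim z)
      then have "z ^ j \<le> (a + z) ^ j" using assms(1) by (intro power_mono) auto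
      then show ?case using elim assms(1)
        by (simp add: abs_mult mult_right_mono)
    qed
  qed
  show ?thesis
  proof (induction m)
    case 0
    then show ?case using L[of 0] by (simp add: fun_eq_iff[of "taylor_antiderivative X a 0", symmetric])
  next
    case (Suc m)
    have "((\<lambda>z. z ^ Suc m * X (Suc m) (a + z) - real (Suc m) * taylor_antiderivative X a m z)
       \<longlongrightarrow> 0 - real (Suc m) * 0) at_top"
      by (intro tendsto_intros L Suc)
    then show ?case by simp
  qed
qed

text \<open>Cauchy's formula for repeated integration with base point at infinity; the decay
  hypothesis removes the boundary terms there.\<close>

lemma taylor_remainder_at_infinity:
  assumes X: "derivative_tower {0..} X" and "a \<ge> 0"
    and "\<And>j. ((\<lambda>x. x ^ j * X j x) \<longlongrightarrow> 0) at_top"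
    and "set_integrable lborel {0<..} (\<lambda>z. z ^ m * X (Suc m) (a + z))"
  shows "(LINT z:{0<..}|lborel. z ^ m * X (Suc m) (a + z)) = (-1) ^ Suc m * fact m * X 0 a"
proof -
  have c: "continuous_on {0..} (X k)" for k
    using derivative_tower_continuous_on[OF X] .
  have ca: "continuous_on {0..} (\<lambda>z. X k (a + z))" for k
    by (rule continuous_on_compose2[OF c]) (use assms(2) in \<open>auto intro!: continuous_intros\<close>)
  have cQ: "continuous_on {0..} (taylor_antiderivative X a m)"
    by (induction m) (use ca[of 0] in \<open>auto intro!: continuous_intros ca simp del: power_Suc\<close>)
  have "(LINT z:{0<..}|lborel. z ^ m * X (Suc m) (a + z)) = 0 - taylor_antiderivative X a m 0"
  proof (rule interval_integral_FTC_Ioi)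
    fix z :: real assume "z > 0"
    then have "(X k has_real_derivative X (Suc k) (a + z)) (at (a + z))" for k
      using derivative_towerD[OF X, of "a + z" k] assms(2)
        at_within_interior[of "a + z" "{0..}"] by (simp add: interior_Ici[of "-1"])
    then show "(taylor_antiderivative X a m has_real_derivative z ^ m * X (Suc m) (a + z)) (at z)"
      by (rule taylor_antiderivative_DERIV)
  next
    show "continuous_on {0<..} (\<lambda>z. z ^ m * X (Suc m) (a + z))"
      by (intro continuous_intros continuous_on_subset[OF ca]) auto
    have "(taylor_antiderivative X a m \<longlongrightarrow> taylor_antiderivative X a m 0) (at 0 within {0..})"
      using cQ by (simp add: continuous_on_def)
    then show "(taylor_antiderivative X a m \<longlongrightarrow> taylor_antiderivative X a m 0) (at_right 0)"
      by (rule tendsto_within_subset) auto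
  qed (use assms taylor_antiderivative_at_top in auto)
  then show ?thesis by (simp add: taylor_antiderivative_0)
qed

section \<open>The inversion of the slope and the kernel \<open>\<bar>a + t\<bar>\<close>\<close>

text \<open>In the second derivative of \<open>a * Q 0 (1 / a)\<close> all terms with
  \<open>Q 1\<close> cancel. The remaining cube is the 3 in the exponents of the profiles at
  infinity.\<close>

lemma derivative_inversion:
  assumes P: "derivative_tower UNIV P" and Q: "derivative_tower UNIV Q"
    and PQ: "\<And>a. a > 0 \<Longrightarrow> P 0 a = a * Q 0 (1 / a)" and "a > 0"
  shows "P 1 a = Q 0 (1 / a) - Q 1 (1 / a) / a" "P 2 a = (1 / a) ^ 3 * Q 2 (1 / a)"
proof -
  have PD: "(P k has_real_derivative P (Suc k) a) (at a)" for k a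
    using derivative_towerD[OF P] by simp
  have QI: "((\<lambda>a. Q k (1 / a)) has_real_derivative Q (Suc k) (1 / a) * (- (1 / a\<^sup>2))) (at a)"
    if "a > 0" for k a
  proof (rule DERIV_chain2[where f = "Q k" and g = "\<lambda>a. 1 / a"])
    show "(Q k has_real_derivative Q (Suc k) (1 / a)) (at (1 / a))"
      using derivative_towerD[OF Q] by simp
    show "((\<lambda>a. 1 / a) has_real_derivative (- (1 / a\<^sup>2))) (at a)"
      using that by (auto intro!: derivative_eq_intros simp: power2_eq_square)
  qed
  have P1: "P 1 a = Q 0 (1 / a) - Q 1 (1 / a) / a" if "a > 0" for a
  proof -
    have "((\<lambda>a. a * Q 0 (1 / a)) has_real_derivative
        1 * Q 0 (1 / a) + Q (Suc 0) (1 / a) * (- (1 / a\<^sup>2)) * a) (at a)"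
      using that by (intro DERIV_mult QI DERIV_ident)
    then have "(P 0 has_real_derivative
        1 * Q 0 (1 / a) + Q (Suc 0) (1 / a) * (- (1 / a\<^sup>2)) * a) (at a)"
      by (rule has_field_derivative_transform_within_open[where S = "{0<..}"]) (use PQ that in auto)
    then have "P (Suc 0) a = 1 * Q 0 (1 / a) + Q (Suc 0) (1 / a) * (- (1 / a\<^sup>2)) * a"
      using DERIV_unique[OF PD] by blast
    then show ?thesis using that by (simp add: field_simps power2_eq_square)
  qed
  then show "P 1 a = Q 0 (1 / a) - Q 1 (1 / a) / a" using assms(4) .
  have "((\<lambda>a. Q 0 (1 / a) - Q 1 (1 / a) / a) has_real_derivative
      Q 1 (1 / a) * (- (1 / a\<^sup>2)) -
        (Q 2 (1 / a) * (- (1 / a\<^sup>2)) * a - Q 1 (1 / a) * 1) / (a * a)) (at a)"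
    using QI[OF assms(4), of 0] QI[OF assms(4), of 1] assms(4)
    by (intro DERIV_diff DERIV_divide DERIV_ident) (simp_all add: numeral_2_eq_2)
  then have "(P 1 has_real_derivative
      Q 1 (1 / a) * (- (1 / a\<^sup>2)) -
        (Q 2 (1 / a) * (- (1 / a\<^sup>2)) * a - Q 1 (1 / a) * 1) / (a * a)) (at a)"
    by (rule has_field_derivative_transform_within_open[where S = "{0<..}"])
      (use P1 assms(4) in \<open>auto simp del: One_nat_def\<close>)
  then have "P 2 a = Q 1 (1 / a) * (- (1 / a\<^sup>2)) -
        (Q 2 (1 / a) * (- (1 / a\<^sup>2)) * a - Q 1 (1 / a) * 1) / (a * a)"
    using DERIV_unique[OF PD[of 1 a]] by (simp add: numeral_2_eq_2)
  then show "P 2 a = (1 / a) ^ 3 * Q 2 (1 / a)"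
    using assms(4) by (simp add: field_simps power2_eq_square power3_eq_cube)
qed

text \<open>The boundary terms at \<open>\<plusminus>\<infinity>\<close> cancel because \<open>P 0\<close> is even and \<open>P 0 a = a * Q 0 (1 / a)\<close> with
  \<open>Q 1 0 = 0\<close>.\<close>

lemma integral_abs_times_second_derivative:
  assumes P: "derivative_tower UNIV P" "\<And>a. P 0 (- a) = P 0 a"
    and Q: "derivative_tower UNIV Q" "\<And>a. Q 0 (- a) = Q 0 a"
    and PQ: "\<And>a. a > 0 \<Longrightarrow> P 0 a = a * Q 0 (1 / a)"
    and int: "integrable lborel (\<lambda>a. \<bar>a + t\<bar> * P 2 a)"
  shows "(LINT a|lborel. \<bar>a + t\<bar> * P 2 a) = 2 * P 0 t"
proof -
  \<comment> \<open>An antiderivative of \<open>(a + t) * P 2 a\<close>, found by parts.\<close>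
  define R where "R a = (a + t) * P 1 a - P 0 a" for a
  have PD: "(P k has_real_derivative P (Suc k) a) (at a)" for k a
    using derivative_towerD[OF P(1)] by simp
  have QD: "(Q k has_real_derivative Q (Suc k) a) (at a)" for k a
    using derivative_towerD[OF Q(1)] by simp
  have RD: "(R has_real_derivative (a + t) * P 2 a) (at a)" for a
    unfolding R_def[abs_def]
    by (auto intro!: derivative_eq_intros PD simp: numeral_2_eq_2)
  have cont: "continuous_on A (P k)" for A k
    using derivative_tower_continuous_on[OF P(1)] continuous_on_subset by blast
  note P1 = derivative_inversion(1)[OF P(1) Q(1) PQ]
  have Q1: "Q 1 0 = 0"
    using derivative_tower_even(1)[OF Q, of 0] by simp
  have inv: "((\<lambda>a::real. 1 / a) \<longlongrightarrow> 0) at_top"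
    using tendsto_inverse_0_at_top[OF filterlim_ident] by (simp add: inverse_eq_divide)
  have Qlim: "((\<lambda>a. Q k (1 / a)) \<longlongrightarrow> Q k 0) at_top" for k
    using isCont_tendsto_compose[OF DERIV_isCont[OF QD] inv] .
  have limP1: "((\<lambda>a. P 1 a) \<longlongrightarrow> Q 0 0) at_top"
  proof -
    have "((\<lambda>a. Q 0 (1 / a) - Q 1 (1 / a) * (1 / a)) \<longlongrightarrow> Q 0 0 - Q 1 0 * 0) at_top"
      by (intro tendsto_intros Qlim inv)
    then have "((\<lambda>a. Q 0 (1 / a) - Q 1 (1 / a) * (1 / a)) \<longlongrightarrow> Q 0 0) at_top"
      by simp
    then show ?thesis
      by (rule Lim_transform_eventually) (rule eventually_mono[OF eventually_gt_at_top[of 0]], simp add: P1 del: One_nat_def)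
  qed
  have limP2: "((\<lambda>a. a * P 1 a - P 0 a) \<longlongrightarrow> 0) at_top"
  proof -
    have "((\<lambda>a. - Q 1 (1 / a)) \<longlongrightarrow> 0) at_top"
      using tendsto_minus[OF Qlim[of 1]] Q1 by simp
    then show ?thesis
      by (rule Lim_transform_eventually)
        (rule eventually_mono[OF eventually_gt_at_top[of 0]], simp add: P1 PQ field_simps del: One_nat_def)
  qed
  have top: "(R \<longlongrightarrow> t * Q 0 0) at_top"
  proof -
    have "((\<lambda>a. (a * P 1 a - P 0 a) + t * P 1 a) \<longlongrightarrow> 0 + t * Q 0 0) at_top"
      by (intro tendsto_intros limP1 limP2)
    then show ?thesis by (simp add: R_def[abs_def] algebra_simps)
  qed
  have bot: "(R \<longlongrightarrow> - t * Q 0 0) at_bot"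
  proof -
    have "((\<lambda>a. (a * P 1 a - P 0 a) - t * P 1 a) \<longlongrightarrow> 0 - t * Q 0 0) at_top"
      by (intro tendsto_intros limP1 limP2)
    then have "((\<lambda>a. R (- a)) \<longlongrightarrow> - t * Q 0 0) at_top"
      using derivative_tower_even(1)[OF P] P(2) by (simp add: R_def[abs_def] algebra_simps)
    then show ?thesis by (simp add: filterlim_at_bot_mirror)
  qed
  have RC: "isCont R a" for a using RD DERIV_isCont by blast
  \<comment> \<open>At the kink \<open>a = -t\<close> of the kernel the term with \<open>P 1\<close>
    drops out; both half-lines contribute \<open>P 0 t\<close> there.\<close>
  have Rt: "R (- t) = - P 0 t" using P(2) by (simp add: R_def)
  have "(LINT a:{-t<..}|lborel. (a + t) * P 2 a) = t * Q 0 0 - (- P 0 t)"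
  proof (rule interval_integral_FTC_Ioi[OF RD])
    have "set_integrable lborel {-t<..} (\<lambda>a. \<bar>a + t\<bar> * P 2 a)"
      unfolding set_integrable_def by (rule integrable_mult_indicator[OF _ int]) simp
    then show "set_integrable lborel {-t<..} (\<lambda>a. (a + t) * P 2 a)"
      by (rule set_integrable_cong[THEN iffD1, rotated 3]) (auto simp: algebra_simps)
    show "(R \<longlongrightarrow> - P 0 t) (at_right (- t))"
      using RC[of "-t"] Rt by (metis isCont_def filterlim_at_split)
  qed (use top in \<open>auto intro!: continuous_intros cont\<close>)
  moreover have "(LINT a:{..<-t}|lborel. (a + t) * P 2 a) = - P 0 t - (- t * Q 0 0)"
  proof (rule interval_integral_FTC_Iio[OF RD])
    have "set_integrable lborel {..<-t} (\<lambda>a. - (\<bar>a + t\<bar> * P 2 a))"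
      unfolding set_integrable_def by (rule integrable_mult_indicator[OF _ integrable_minus[OF int]]) simp
    then show "set_integrable lborel {..<-t} (\<lambda>a. (a + t) * P 2 a)"
      by (rule set_integrable_cong[THEN iffD1, rotated 3]) (auto simp: algebra_simps)
    show "(R \<longlongrightarrow> - P 0 t) (at_left (- t))"
      using RC[of "-t"] Rt by (metis isCont_def filterlim_at_split)
  qed (use bot in \<open>auto intro!: continuous_intros cont\<close>)
  moreover have "(LINT a|lborel. \<bar>a + t\<bar> * P 2 a) =
      (LINT a:{-t<..}|lborel. (a + t) * P 2 a) - (LINT a:{..<-t}|lborel. (a + t) * P 2 a)"
  proof -
    have eq: "indicator {-t<..} a *\<^sub>R ((a + t) * P 2 a) = indicator {-t<..} a *\<^sub>R (\<bar>a + t\<bar> * P 2 a)"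
      "indicator {..<-t} a *\<^sub>R ((a + t) * P 2 a) = - (indicator {..<-t} a *\<^sub>R (\<bar>a + t\<bar> * P 2 a))" for a
      by (auto simp: indicator_def algebra_simps)
    have "(LINT a|lborel. \<bar>a + t\<bar> * P 2 a) = (LINT a|lborel.
        indicator {-t<..} a *\<^sub>R (\<bar>a + t\<bar> * P 2 a) + indicator {..<-t} a *\<^sub>R (\<bar>a + t\<bar> * P 2 a))"
      by (intro Bochner_Integration.integral_cong) (auto simp: indicator_def)
    also have "\<dots> = (LINT a|lborel. indicator {-t<..} a *\<^sub>R (\<bar>a + t\<bar> * P 2 a)) +
        (LINT a|lborel. indicator {..<-t} a *\<^sub>R (\<bar>a + t\<bar> * P 2 a))"
      by (intro Bochner_Integration.integral_add integrable_mult_indicator int) auto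
    finally show ?thesis
      unfolding set_lebesgue_integral_def eq by simp
  qed
  ultimately show ?thesis by simp
qed

section \<open>Lebesgue measure\<close>

text \<open>The uniqueness argument for Haar measure: for a translation-invariant \<open>\<nu>\<close>, Fubini's theorem
  gives \<open>\<lambda>(A) \<nu>(B) = \<lambda>(B) \<nu>(-A)\<close>; take \<open>A\<close> to be the unit ball.\<close>

lemma distr_lborel_orthogonal:
  fixes U :: "'a::euclidean_space \<Rightarrow> 'a"
  assumes U: "orthogonal_transformation U"
  shows "distr lborel borel U = lborel"
proof (rule measure_eqI)
  have [measurable]: "U \<in> borel_measurable borel"
    using U orthogonal_transformation_linear linear_continuous_on linear_conv_bounded_linear
    by (blast intro: borel_measurable_continuous_onI)
  have lin: "linear U" and norm: "\<And>x. norm (U x) = norm x"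
    using U by (auto simp: orthogonal_transformation)
  have surj: "U (inv U x) = x" for x
    using orthogonal_transformation_surj[OF U] by (simp add: surj_f_inv_f)
  have shift: "(\<integral>\<^sup>+y. F (y + c) \<partial>lborel) = (\<integral>\<^sup>+y. F y \<partial>lborel)"
    if [measurable]: "F \<in> borel_measurable borel" for F :: "'a \<Rightarrow> ennreal" and c
    by (subst (2) lborel_distr_plus[of c, symmetric]) (simp add: nn_integral_distr add.commute)
  fix B assume "B \<in> sets (distr lborel borel U)"
  then have [measurable]: "B \<in> sets borel" by simp
  define A where "A = ball (0::'a) 1"
  have [measurable]: "A \<in> sets borel" by (simp add: A_def)
  have "emeasure lborel A * emeasure (distr lborel borel U) B =
      (\<integral>\<^sup>+x. indicator A x * (\<integral>\<^sup>+y. indicator B (U y) \<partial>lborel) \<partial>lborel)"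
    by (simp add: nn_integral_multc nn_integral_distr flip: nn_integral_indicator)
  also have "\<dots> = (\<integral>\<^sup>+x. indicator A x * (\<integral>\<^sup>+y. indicator B (x + U y) \<partial>lborel) \<partial>lborel)"
  proof (rule nn_integral_cong)
    fix x :: 'a
    have "(\<integral>\<^sup>+y. indicator B (x + U y) \<partial>lborel) = (\<integral>\<^sup>+y. indicator B (U (y + inv U x)) \<partial>lborel)"
      using lin surj by (simp add: linear_add add.commute)
    also have "\<dots> = (\<integral>\<^sup>+y. indicator B (U y) \<partial>lborel)"
      by (rule shift) measurable
    finally show "indicator A x * (\<integral>\<^sup>+y. indicator B (U y) \<partial>lborel) =
        indicator A x * (\<integral>\<^sup>+y. indicator B (x + U y) \<partial>lborel)" by simp
  qed
  also have "\<dots> = (\<integral>\<^sup>+x. \<integral>\<^sup>+y. indicator A x * indicator B (x + U y) \<partial>lborel \<partial>lborel)"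
    by (simp add: nn_integral_cmult)
  also have "\<dots> = (\<integral>\<^sup>+y. \<integral>\<^sup>+x. indicator A x * indicator B (x + U y) \<partial>lborel \<partial>lborel)"
    by (rule lborel_pair.Fubini') (simp add: split_beta)
  also have "\<dots> = (\<integral>\<^sup>+y. \<integral>\<^sup>+x. indicator A (x - U y) * indicator B x \<partial>lborel \<partial>lborel)"
  proof (rule nn_integral_cong)
    fix y :: 'a
    show "(\<integral>\<^sup>+x. indicator A x * indicator B (x + U y) \<partial>lborel) =
        (\<integral>\<^sup>+x. indicator A (x - U y) * indicator B x \<partial>lborel)"
      using shift[of "\<lambda>x. indicator A (x - U y) * indicator B x" "U y"] by simp
  qed
  also have "\<dots> = (\<integral>\<^sup>+x. \<integral>\<^sup>+y. indicator A (x - U y) * indicator B x \<partial>lborel \<partial>lborel)"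
    by (rule lborel_pair.Fubini'[symmetric]) (simp add: split_beta)
  also have "\<dots> = (\<integral>\<^sup>+x. emeasure lborel A * indicator B x \<partial>lborel)"
  proof (rule nn_integral_cong)
    fix x :: 'a
    \<comment> \<open>The ball is symmetric and \<open>U\<close> preserves norms, so the points
      \<open>y\<close> in question form a translate of \<open>A\<close>.\<close>
    have "x - U y \<in> A \<longleftrightarrow> y - inv U x \<in> A" for y
    proof -
      have "x - U y = U (inv U x - y)" using lin surj by (simp add: linear_diff)
      then show ?thesis using norm[of "inv U x - y"] by (simp add: A_def norm_minus_commute)
    qed
    then have "(\<integral>\<^sup>+y. indicator A (x - U y) \<partial>lborel) = (\<integral>\<^sup>+y. indicator A (y + (- inv U x)) \<partial>lborel)"
      by (intro nn_integral_cong) (simp add: indicator_def)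
    also have "\<dots> = emeasure lborel A"
      by (subst shift) auto
    finally show "(\<integral>\<^sup>+y. indicator A (x - U y) * indicator B x \<partial>lborel) =
        emeasure lborel A * indicator B x"
      by (simp add: nn_integral_multc)
  qed
  also have "\<dots> = emeasure lborel A * emeasure lborel B"
    by (simp add: nn_integral_cmult)
  finally have "emeasure lborel A * emeasure (distr lborel borel U) B = emeasure lborel A * emeasure lborel B" .
  moreover have "emeasure lborel A \<noteq> 0" "emeasure lborel A \<noteq> \<infinity>"
    using unit_ball_vol_pos[of "real DIM('a)"] by (simp_all add: A_def emeasure_ball del: unit_ball_vol_pos)
  ultimately show "emeasure (distr lborel borel U) B = emeasure lborel B"
    by (simp add: ennreal_mult_cancel_left)
qed simp

text \<open>Half-lines generate the Borel sets and are stable under intersection. Finiteness is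
  asked on half-lines only, because the image of Lebesgue measure under a squared norm has infinite
  total mass.\<close>

lemma borel_measure_eqI_atMost:
  fixes M N :: "real measure"
  assumes "sets M = sets borel" "sets N = sets borel"
    and "\<And>x. emeasure M {..x} = emeasure N {..x}" "\<And>x. emeasure M {..x} \<noteq> \<infinity>"
  shows "M = N"
proof (rule measure_eqI_generator_eq[where \<Omega> = UNIV and E = "range atMost" and A = "\<lambda>i::nat. {..real i}"])
  show "Int_stable (range atMost :: real set set)"
    by (auto simp: Int_stable_def)
  show "(\<Union>i. {..real i}) = UNIV"
    by (auto intro: real_arch_simple)
qed (use assms in \<open>auto simp: borel_eq_atMost\<close>)

text \<open>The set where the squared norm is at most \<open>z\<close> is a ball of radius
  \<open>sqrt z\<close>, of volume proportional to \<open>z ^ k\<close>; the weight is the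
  derivative of that volume.\<close>

lemma nn_integral_sum_squares:
  fixes A :: "'i set" and F :: "real \<Rightarrow> ennreal"
  assumes A: "finite A" "card A = 2 * k" "k \<ge> 1" and [measurable]: "F \<in> borel_measurable borel"
  shows "(\<integral>\<^sup>+f. F (\<Sum>i\<in>A. (f i)\<^sup>2) \<partial>Pi\<^sub>M A (\<lambda>_. lborel)) =
    (\<integral>\<^sup>+z. F z * ennreal (indicator {0<..} z * (unit_ball_vol (2 * real k) * real k * z ^ (k - 1))) \<partial>lborel)"
proof -
  define V where "V = unit_ball_vol (2 * real k)"
  have V: "V \<ge> 0" by (simp add: V_def)
  define w where "w z = indicator {0<..} z * (V * real k * z ^ (k - 1))" for z :: real
  have [measurable]: "w \<in> borel_measurable borel" unfolding w_def[abs_def] by measurable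
  let ?P = "Pi\<^sub>M A (\<lambda>_. lborel :: real measure)"
  have [measurable]: "(\<lambda>f. \<Sum>i\<in>A. (f i)\<^sup>2) \<in> borel_measurable ?P" by measurable
  have cball: "emeasure ?P ({f. (\<Sum>i\<in>A. (f i)\<^sup>2) \<le> r\<^sup>2} \<inter> space ?P) = ennreal (V * r ^ (2 * k))"
    if "r > 0" for r
  proof -
    have "{f. (\<Sum>i\<in>A. (f i)\<^sup>2) \<le> r\<^sup>2} = {f. sqrt (\<Sum>i\<in>A. (f i)\<^sup>2) \<le> r}"
      using that by (auto simp: sum_nonneg real_sqrt_le_iff')
    then show ?thesis
      using emeasure_cball_aux[OF A(1) that] A(2) by (simp add: V_def)
  qed
  have "distr ?P borel (\<lambda>f. \<Sum>i\<in>A. (f i)\<^sup>2) = density lborel w"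
  proof (rule borel_measure_eqI_atMost)
    fix x :: real
    let ?L = "emeasure ?P ({f. (\<Sum>i\<in>A. (f i)\<^sup>2) \<le> x} \<inter> space ?P)"
    have L: "emeasure (distr ?P borel (\<lambda>f. \<Sum>i\<in>A. (f i)\<^sup>2)) {..x} = ?L"
      by (subst emeasure_distr) (auto simp: vimage_def)
    have R: "emeasure (density lborel w) {..x} = (\<integral>\<^sup>+z. ennreal (w z) * indicator {..x} z \<partial>lborel)"
      by (simp add: emeasure_density)
    have LR: "?L = ennreal (V * max 0 x ^ k) \<and> emeasure (density lborel w) {..x} = ennreal (V * max 0 x ^ k)"
    proof (cases "x \<ge> 0")
      case True
      have "(\<integral>\<^sup>+z. ennreal (w z) * indicator {..x} z \<partial>lborel) =
          (\<integral>\<^sup>+z. ennreal (V * real k * z ^ (k - 1)) * indicator {0..x} z \<partial>lborel)"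
      proof (rule nn_integral_cong_AE)
        have "AE z in lborel. z \<noteq> (0::real)" by (rule AE_lborel_singleton)
        then show "AE z in lborel. ennreal (w z) * indicator {..x} z =
            ennreal (V * real k * z ^ (k - 1)) * indicator {0..x} z"
          by eventually_elim (auto simp: w_def indicator_def)
      qed
      also have "\<dots> = ennreal (V * x ^ k - V * 0 ^ k)"
      proof (rule nn_integral_FTC_Icc)
        show "((\<lambda>z. V * z ^ k) has_real_derivative V * real k * z ^ (k - 1)) (at z)" for z
          by (auto intro!: derivative_eq_intros)
      qed (use V True in auto)
      finally have R': "emeasure (density lborel w) {..x} = ennreal (V * x ^ k)"
        using A(3) R by (simp add: power_0_left)
      have "?L = ennreal (V * x ^ k)"
      proof (cases "x = 0")
        case False
        then have "x = (sqrt x)\<^sup>2" "sqrt x > 0" using True by auto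
        then show ?thesis using cball[of "sqrt x"] by (simp add: power_mult)
      next
        case x0: True
        \<comment> \<open>The ball volume formula asks for a positive radius, so the origin is
          squeezed into shrinking balls.\<close>
        have "?L \<le> ennreal (V * (1 / real (Suc i)) ^ (2 * k))" for i
        proof -
          have "?L \<le> emeasure ?P ({f. (\<Sum>i\<in>A. (f i)\<^sup>2) \<le> (1 / real (Suc i))\<^sup>2} \<inter> space ?P)"
            using x0 by (intro emeasure_mono) (auto intro: order_trans)
          then show ?thesis using cball[of "1 / real (Suc i)"] by simp
        qed
        moreover have "(\<lambda>i. ennreal (V * (1 / real (Suc i)) ^ (2 * k))) \<longlonglongrightarrow> ennreal (V * 0 ^ (2 * k))"
          by (intro tendsto_intros tendsto_ennrealI LIMSEQ_Suc lim_1_over_n)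
        ultimately have "?L \<le> ennreal (V * 0 ^ (2 * k))"
          by (intro LIMSEQ_le_const) auto
        then show ?thesis using A(3) x0 by (simp add: power_0_left)
      qed
      then show ?thesis using True R' by (simp add: max_def)
    next
      case False
      have "{f. (\<Sum>i\<in>A. (f i)\<^sup>2) \<le> x} = {}"
        using False sum_nonneg[of A "\<lambda>i. (f i)\<^sup>2" for f :: "'i \<Rightarrow> real"]
        by (metis (mono_tags, lifting) Collect_empty_eq order_trans zero_le_power2)
      moreover have "(\<integral>\<^sup>+z. ennreal (w z) * indicator {..x} z \<partial>lborel) = (\<integral>\<^sup>+(z::real). 0 \<partial>lborel)"
        using False by (intro nn_integral_cong) (auto simp: w_def indicator_def)
      ultimately show ?thesis using R False A(3) by (simp add: max_def power_0_left)
    qed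
    then show "emeasure (distr ?P borel (\<lambda>f. \<Sum>i\<in>A. (f i)\<^sup>2)) {..x} = emeasure (density lborel w) {..x}"
      "emeasure (distr ?P borel (\<lambda>f. \<Sum>i\<in>A. (f i)\<^sup>2)) {..x} \<noteq> \<infinity>"
      unfolding L by auto
  qed auto
  then have "(\<integral>\<^sup>+z. F z \<partial>distr ?P borel (\<lambda>f. \<Sum>i\<in>A. (f i)\<^sup>2)) = (\<integral>\<^sup>+z. F z \<partial>density lborel w)"
    by simp
  then show ?thesis
    by (simp add: nn_integral_distr nn_integral_density w_def V_def mult.commute)
qed

text \<open>Density of the image of Lebesgue measure on a space of dimension \<open>2 * k\<close>
  under the squared norm.\<close>

definition radial_weight :: "nat \<Rightarrow> real \<Rightarrow> real" where
  "radial_weight k z = indicator {0<..} z * (unit_ball_vol (2 * real k) * real k * z ^ (k - 1))"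

lemma radial_weight_nonneg: "radial_weight k z \<ge> 0"
  by (auto simp: radial_weight_def indicator_def)

lemma borel_measurable_radial_weight [measurable]: "radial_weight k \<in> borel_measurable borel"
  unfolding radial_weight_def[abs_def] by measurable

lemma radial_weight_scale: "s \<noteq> 0 \<Longrightarrow> radial_weight k (s\<^sup>2 * z) = s ^ (2 * (k - 1)) * radial_weight k z"
  by (auto simp: radial_weight_def indicator_def power_mult_distrib power_mult zero_less_mult_iff)

text \<open>Fubini splits off the coordinates along \<open>e\<close> and \<open>e'\<close>; the
  other \<open>2 * k\<close> enter through their squared norm alone.\<close>

lemma nn_integral_lborel_two_axes:
  fixes e e' :: "'a::euclidean_space" and F :: "real \<times> real \<times> real \<Rightarrow> ennreal"
  assumes e: "e \<in> Basis" "e' \<in> Basis" "e \<noteq> e'" and d: "DIM('a) = 2 * Suc k" "k \<ge> 1"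
    and [measurable]: "F \<in> borel_measurable borel"
  shows "(\<integral>\<^sup>+x. F (x \<bullet> e, x \<bullet> e', x \<bullet> x - (x \<bullet> e)\<^sup>2 - (x \<bullet> e')\<^sup>2) \<partial>lborel) =
     (\<integral>\<^sup>+s. \<integral>\<^sup>+a. \<integral>\<^sup>+z. F (s, a, z) * ennreal (radial_weight k z) \<partial>lborel \<partial>lborel \<partial>lborel)"
proof -
  interpret product_sigma_finite "\<lambda>_. lborel :: real measure" by standard
  define A where "A = Basis - {e, e'}"
  have A: "finite A" "Basis = insert e (insert e' A)" "e \<notin> insert e' A" "e' \<notin> A"
    using e by (auto simp: A_def)
  have "card A = 2 * k"
  proof -
    have "card (Basis :: 'a set) = Suc (Suc (card A))"
      using A(1,3,4) by (subst A(2)) simp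
    then show ?thesis using d(1) by simp
  qed
  have F[measurable]: "F \<in> borel_measurable (borel \<Otimes>\<^sub>M borel \<Otimes>\<^sub>M borel)"
    unfolding borel_prod by measurable
  have fe: "(\<Sum>b\<in>Basis. f b *\<^sub>R b) \<bullet> c = f c" if "c \<in> Basis" for f and c :: 'a
    using that by (simp add: inner_sum_left_Basis)
  have "(\<integral>\<^sup>+x. F (x \<bullet> e, x \<bullet> e', x \<bullet> x - (x \<bullet> e)\<^sup>2 - (x \<bullet> e')\<^sup>2) \<partial>lborel) =
    (\<integral>\<^sup>+f. F (f e, f e', (\<Sum>b\<in>A. (f b)\<^sup>2)) \<partial>Pi\<^sub>M Basis (\<lambda>_. lborel))"
  proof (subst lborel_eq, subst nn_integral_distr)
    show "(\<integral>\<^sup>+f. F ((\<Sum>b\<in>Basis. f b *\<^sub>R b) \<bullet> e, (\<Sum>b\<in>Basis. f b *\<^sub>R b) \<bullet> e',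
        (\<Sum>b\<in>Basis. f b *\<^sub>R b) \<bullet> (\<Sum>b\<in>Basis. f b *\<^sub>R b) - ((\<Sum>b\<in>Basis. f b *\<^sub>R b) \<bullet> e)\<^sup>2
        - ((\<Sum>b\<in>Basis. f b *\<^sub>R b) \<bullet> e')\<^sup>2) \<partial>Pi\<^sub>M Basis (\<lambda>_. lborel)) =
      (\<integral>\<^sup>+f. F (f e, f e', (\<Sum>b\<in>A. (f b)\<^sup>2)) \<partial>Pi\<^sub>M Basis (\<lambda>_. lborel))"
    proof (rule nn_integral_cong)
      fix f :: "'a \<Rightarrow> real"
      let ?x = "\<Sum>b\<in>Basis. f b *\<^sub>R b"
      have "?x \<bullet> ?x = (\<Sum>b\<in>Basis. (?x \<bullet> b) * (?x \<bullet> b))"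
        by (rule euclidean_inner)
      also have "\<dots> = (\<Sum>b\<in>Basis. (f b)\<^sup>2)"
        by (intro sum.cong) (auto simp: fe power2_eq_square)
      also have "\<dots> = (f e)\<^sup>2 + ((f e')\<^sup>2 + (\<Sum>b\<in>A. (f b)\<^sup>2))"
        using A(1,3,4) by (subst A(2)) simp
      finally show "F (?x \<bullet> e, ?x \<bullet> e', ?x \<bullet> ?x - (?x \<bullet> e)\<^sup>2 - (?x \<bullet> e')\<^sup>2) = F (f e, f e', (\<Sum>b\<in>A. (f b)\<^sup>2))"
        using e by (simp add: fe)
    qed
  qed measurable
  also have "\<dots> = (\<integral>\<^sup>+s. \<integral>\<^sup>+f. F (s, f e', (\<Sum>b\<in>A. (f b)\<^sup>2)) \<partial>Pi\<^sub>M (insert e' A) (\<lambda>_. lborel) \<partial>lborel)"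
  proof -
    have "(\<Sum>b\<in>A. ((x(e := y)) b)\<^sup>2) = (\<Sum>b\<in>A. (x b)\<^sup>2)" for x :: "'a \<Rightarrow> real" and y
      using A by (intro sum.cong) auto
    moreover have "(\<lambda>f. F (f e, f e', (\<Sum>b\<in>A. (f b)\<^sup>2))) \<in> borel_measurable (Pi\<^sub>M (insert e (insert e' A)) (\<lambda>_. lborel))"
      using F by measurable
    ultimately show ?thesis
      unfolding A(2) using A e(3) by (subst product_nn_integral_insert_rev) auto
  qed
  also have "\<dots> = (\<integral>\<^sup>+s. \<integral>\<^sup>+a. \<integral>\<^sup>+f. F (s, a, (\<Sum>b\<in>A. (f b)\<^sup>2)) \<partial>Pi\<^sub>M A (\<lambda>_. lborel) \<partial>lborel \<partial>lborel)"
  proof (rule nn_integral_cong)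
    fix s :: real
    have "(\<Sum>b\<in>A. ((x(e' := y)) b)\<^sup>2) = (\<Sum>b\<in>A. (x b)\<^sup>2)" for x :: "'a \<Rightarrow> real" and y
      using A by (intro sum.cong) auto
    moreover have "(\<lambda>f. F (s, f e', (\<Sum>b\<in>A. (f b)\<^sup>2))) \<in> borel_measurable (Pi\<^sub>M (insert e' A) (\<lambda>_. lborel))"
      using F by measurable
    ultimately show "(\<integral>\<^sup>+f. F (s, f e', (\<Sum>b\<in>A. (f b)\<^sup>2)) \<partial>Pi\<^sub>M (insert e' A) (\<lambda>_. lborel)) =
        (\<integral>\<^sup>+a. \<integral>\<^sup>+f. F (s, a, (\<Sum>b\<in>A. (f b)\<^sup>2)) \<partial>Pi\<^sub>M A (\<lambda>_. lborel) \<partial>lborel)"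
      using A by (subst product_nn_integral_insert_rev) auto
  qed
  also have "\<dots> = (\<integral>\<^sup>+s. \<integral>\<^sup>+a. \<integral>\<^sup>+z. F (s, a, z) * ennreal (radial_weight k z) \<partial>lborel \<partial>lborel \<partial>lborel)"
    unfolding radial_weight_def
    using \<open>card A = 2 * k\<close> A(1) d(2)
    by (intro nn_integral_cong nn_integral_sum_squares[where F = "\<lambda>z. F (s, a, z)" for s a]) auto
  finally show ?thesis .
qed

section \<open>The spherical measure\<close>

lemma measurable_radial_projection [measurable]:
  "(\<lambda>x::'a::euclidean_space. x /\<^sub>R norm x) \<in>
     restrict_space lborel (cball 0 1 - {0}) \<rightarrow>\<^sub>M restrict_space borel (sphere 0 1)"
  by (rule measurable_restrict_space2) (auto simp: space_restrict_space intro!: measurable_restrict_space1)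

lemma space_sphere_measure: "space (sphere_measure :: 'a::euclidean_space measure) = sphere 0 1"
  by (simp add: sphere_measure_def space_scale_measure space_restrict_space)

lemma sets_sphere_measure [measurable_cong]:
  "sets (sphere_measure :: 'a::euclidean_space measure) = sets (restrict_space borel (sphere 0 1))"
  by (simp add: sphere_measure_def)

lemma nn_integral_sphere_measure:
  fixes F :: "'a::euclidean_space \<Rightarrow> ennreal"
  assumes [measurable]: "F \<in> borel_measurable sphere_measure"
  shows "(\<integral>\<^sup>+v. F v \<partial>sphere_measure) =
    of_nat DIM('a) * (\<integral>\<^sup>+x. F (x /\<^sub>R norm x) * indicator (cball 0 1 - {0}) x \<partial>lborel)"
proof -
  have [measurable]: "F \<in> borel_measurable (restrict_space borel (sphere 0 1))"
    using assms by (simp cong: measurable_cong_sets add: sets_sphere_measure)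
  show ?thesis
    unfolding sphere_measure_def
    by (simp add: nn_integral_scale_measure nn_integral_distr nn_integral_restrict_space)
qed

lemma finite_measure_sphere: "finite_measure (sphere_measure :: 'a::euclidean_space measure)"
proof
  have "emeasure (sphere_measure :: 'a measure) (space sphere_measure) =
      (\<integral>\<^sup>+v. 1 \<partial>(sphere_measure :: 'a measure))"
    by simp
  also have "\<dots> = of_nat DIM('a) * emeasure lborel (cball (0::'a) 1 - {0})"
    by (subst nn_integral_sphere_measure) auto
  also have "\<dots> \<le> of_nat DIM('a) * emeasure lborel (cball (0::'a) 1)"
    by (intro mult_left_mono emeasure_mono) auto
  also have "\<dots> < \<infinity>"
    by (simp add: emeasure_cball ennreal_mult_less_top of_nat_less_top)
  finally show "emeasure (sphere_measure :: 'a measure) (space sphere_measure) \<noteq> \<infinity>"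
    by simp
qed

lemma borel_measurable_sphere_continuous:
  "continuous_on (sphere 0 1) F \<Longrightarrow> F \<in> borel_measurable (sphere_measure :: 'a::euclidean_space measure)"
  by (simp add: borel_measurable_continuous_on_restrict sets_sphere_measure cong: measurable_cong_sets)

lemma borel_measurable_sphere:
  "F \<in> borel_measurable borel \<Longrightarrow> F \<in> borel_measurable (sphere_measure :: 'a::euclidean_space measure)"
  by (simp add: measurable_restrict_space1 sets_sphere_measure cong: measurable_cong_sets)

lemma integrable_sphere_continuous:
  fixes F :: "'a::euclidean_space \<Rightarrow> real"
  assumes "continuous_on (sphere 0 1) F"
  shows "integrable sphere_measure F"
proof -
  interpret finite_measure "sphere_measure :: 'a measure" by (rule finite_measure_sphere)
  have "bounded (F ` sphere 0 1)"
    by (intro compact_imp_bounded compact_continuous_image assms compact_sphere)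
  then obtain B where "\<And>v. v \<in> sphere 0 1 \<Longrightarrow> norm (F v) \<le> B"
    unfolding bounded_iff by blast
  then show ?thesis
    by (intro integrable_const_bound[of _ B] borel_measurable_sphere_continuous assms AE_I2)
      (simp add: space_sphere_measure)
qed

section \<open>Invariance of the spherical measure under orthogonal maps\<close>

lemma orthogonal_transformation_continuous_on:
  "orthogonal_transformation (U :: 'a::euclidean_space \<Rightarrow> 'a) \<Longrightarrow> continuous_on S U"
  using orthogonal_transformation_linear linear_continuous_on linear_conv_bounded_linear by blast

lemma measurable_sphere_orthogonal:
  assumes "orthogonal_transformation (U :: 'a::euclidean_space \<Rightarrow> 'a)"
  shows "U \<in> sphere_measure \<rightarrow>\<^sub>M sphere_measure"
proof -
  have "U \<in> restrict_space borel (sphere 0 1) \<rightarrow>\<^sub>M restrict_space borel (sphere 0 1)"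
    using assms orthogonal_transformation_continuous_on[OF assms, of UNIV]
    by (intro measurable_restrict_space2 measurable_restrict_space1 borel_measurable_continuous_onI)
      (auto simp: space_restrict_space orthogonal_transformation)
  then show ?thesis by (simp add: sets_sphere_measure cong: measurable_cong_sets)
qed

text \<open>\<open>U\<close> preserves norms, so it commutes with the radial projection and keeps
  the punctured ball; invariance descends from Lebesgue measure.\<close>

lemma distr_sphere_measure_orthogonal:
  assumes U: "orthogonal_transformation (U :: 'a::euclidean_space \<Rightarrow> 'a)"
  shows "distr sphere_measure sphere_measure U = sphere_measure"
proof (rule measure_eqI)
  note mU = measurable_sphere_orthogonal[OF U]
  have [measurable]: "U \<in> borel_measurable borel"
    using orthogonal_transformation_continuous_on[OF U] by (rule borel_measurable_continuous_onI)
  have nU: "norm (U x) = norm x" for x using U by (simp add: orthogonal_transformation)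
  fix A assume "A \<in> sets (distr sphere_measure sphere_measure U)"
  then have A: "A \<in> sets sphere_measure" by simp
  then have [measurable]: "A \<in> sets borel"
    by (simp add: sets_sphere_measure sets_restrict_space_iff)
  have mA: "indicator A \<in> borel_measurable sphere_measure"
    using A by simp
  define G :: "'a \<Rightarrow> ennreal" where "G x = indicator A (x /\<^sub>R norm x) * indicator (cball 0 1 - {0}) x" for x
  have [measurable]: "G \<in> borel_measurable borel"
    unfolding G_def[abs_def]
    by (intro borel_measurable_times_ennreal borel_measurable_indicator borel_measurable_indicator') auto
  have "emeasure (distr sphere_measure sphere_measure U) A = (\<integral>\<^sup>+v. indicator A (U v) \<partial>sphere_measure)"
    using A mU mA by (simp add: nn_integral_distr flip: nn_integral_indicator)
  also have "\<dots> = of_nat DIM('a) * (\<integral>\<^sup>+x. indicator A (U (x /\<^sub>R norm x)) * indicator (cball 0 1 - {0}) x \<partial>lborel)"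
    by (rule nn_integral_sphere_measure[OF measurable_compose[OF mU mA]])
  also have "(\<lambda>x. indicator A (U (x /\<^sub>R norm x)) * indicator (cball 0 1 - {0}) x) = (\<lambda>x. G (U x))"
  proof
    fix x :: 'a
    have "U x = 0 \<longleftrightarrow> x = 0" by (metis nU norm_eq_zero)
    then show "indicator A (U (x /\<^sub>R norm x)) * indicator (cball 0 1 - {0}) x = G (U x)"
      unfolding G_def orthogonal_transformation_scaleR[OF U] nU by (simp add: indicator_def nU)
  qed
  also have "(\<integral>\<^sup>+x. G (U x) \<partial>lborel) = (\<integral>\<^sup>+x. G x \<partial>distr lborel borel U)"
    by (simp add: nn_integral_distr)
  also have "of_nat DIM('a) * \<dots> = (\<integral>\<^sup>+v. indicator A v \<partial>sphere_measure)"
    unfolding distr_lborel_orthogonal[OF U] by (simp add: nn_integral_sphere_measure[OF mA] G_def)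
  finally show "emeasure (distr sphere_measure sphere_measure U) A = emeasure sphere_measure A"
    using A by simp
qed simp

lemma integral_sphere_orthogonal:
  fixes F :: "'a::euclidean_space \<Rightarrow> real" and U :: "'a \<Rightarrow> 'a"
  assumes "orthogonal_transformation U" "continuous_on (sphere 0 1) F"
  shows "(LINT v|sphere_measure. F (U v)) = (LINT v|sphere_measure. F v)"
  using integral_distr[OF measurable_sphere_orthogonal[OF assms(1)] borel_measurable_sphere_continuous[OF assms(2)]]
  unfolding distr_sphere_measure_orthogonal[OF assms(1)] by simp

section \<open>Central projection of the sphere onto hyperplanes\<close>

text \<open>The integral along one line through the origin: with \<open>B\<close> the squared norm
  of its point at height 1, the set is the part in the unit ball, and the exponent is the dimension
  \<open>2 * k + 2\<close> minus one. Both signs of \<open>s\<close> are counted.\<close>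

lemma nn_integral_odd_power_interval:
  assumes "B > 0"
  shows "(\<integral>\<^sup>+s. ennreal (\<bar>s\<bar> ^ (2 * k + 1)) * indicator {s. s\<^sup>2 * B \<le> 1} s \<partial>lborel) =
    ennreal (1 / (real (Suc k) * B ^ Suc k))"
proof -
  define c where "c = 1 / sqrt B"
  have c: "c > 0" using assms by (simp add: c_def)
  have c2: "c ^ (2 * k + 2) = 1 / B ^ Suc k"
    using assms by (simp add: c_def power_divide power_mult[of _ 2 "Suc k", simplified])
  have set: "{s. s\<^sup>2 * B \<le> 1} = {-c..c}"
  proof -
    have "s\<^sup>2 * B \<le> 1 \<longleftrightarrow> \<bar>s\<bar> \<le> c" for s
    proof -
      have "s\<^sup>2 * B \<le> 1 \<longleftrightarrow> s\<^sup>2 \<le> c\<^sup>2"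
        using assms by (simp add: c_def power_divide pos_le_divide_eq)
      also have "\<dots> \<longleftrightarrow> \<bar>s\<bar> \<le> \<bar>c\<bar>" by (rule abs_le_square_iff[symmetric])
      finally show ?thesis using c by simp
    qed
    moreover have "\<bar>s\<bar> \<le> c \<longleftrightarrow> s \<in> {-c..c}" for s by auto
    ultimately show ?thesis by blast
  qed
  have D: "((\<lambda>s. s ^ (2 * k + 2) / real (2 * k + 2)) has_real_derivative s ^ (2 * k + 1)) (at s)" for s
    using DERIV_cdivide[OF DERIV_pow[of "2 * k + 2" s], of "real (2 * k + 2)"] by simp
  have "(\<integral>\<^sup>+s. ennreal (\<bar>s\<bar> ^ (2 * k + 1)) * indicator {s. s\<^sup>2 * B \<le> 1} s \<partial>lborel) =
    (\<integral>\<^sup>+s. ennreal (- (s ^ (2 * k + 1))) * indicator {-c..0} s +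
        ennreal (s ^ (2 * k + 1)) * indicator {0..c} s \<partial>lborel)"
  proof (rule nn_integral_cong_AE)
    have "AE s in lborel. s \<noteq> (0::real)" by (rule AE_lborel_singleton)
    then show "AE s in lborel. ennreal (\<bar>s\<bar> ^ (2 * k + 1)) * indicator {s. s\<^sup>2 * B \<le> 1} s =
      ennreal (- (s ^ (2 * k + 1))) * indicator {-c..0} s + ennreal (s ^ (2 * k + 1)) * indicator {0..c} s"
      unfolding set
      by eventually_elim (use c in \<open>auto simp: indicator_def abs_if power_minus_odd\<close>)
  qed
  also have "\<dots> = (\<integral>\<^sup>+s. ennreal (- (s ^ (2 * k + 1))) * indicator {-c..0} s \<partial>lborel) +
      (\<integral>\<^sup>+s. ennreal (s ^ (2 * k + 1)) * indicator {0..c} s \<partial>lborel)"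
    by (rule nn_integral_add) auto
  also have "(\<integral>\<^sup>+s. ennreal (- (s ^ (2 * k + 1))) * indicator {-c..0} s \<partial>lborel) =
      ennreal (- (0 ^ (2 * k + 2) / real (2 * k + 2)) - - ((-c) ^ (2 * k + 2) / real (2 * k + 2)))"
  proof (rule nn_integral_FTC_Icc)
    fix s :: real
    show "((\<lambda>s. - (s ^ (2 * k + 2) / real (2 * k + 2))) has_real_derivative - (s ^ (2 * k + 1))) (at s)"
      using DERIV_minus[OF D] by simp
    assume "s \<in> {-c..0}"
    then show "0 \<le> - (s ^ (2 * k + 1))"
      by (simp add: mult_nonpos_nonneg)
  qed (use c in auto)
  also have "(\<integral>\<^sup>+s. ennreal (s ^ (2 * k + 1)) * indicator {0..c} s \<partial>lborel) =
      ennreal (c ^ (2 * k + 2) / real (2 * k + 2) - 0 ^ (2 * k + 2) / real (2 * k + 2))"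
  proof (rule nn_integral_FTC_Icc)
    fix s :: real
    show "((\<lambda>s. s ^ (2 * k + 2) / real (2 * k + 2)) has_real_derivative s ^ (2 * k + 1)) (at s)"
      by (rule D)
    assume "s \<in> {0..c}"
    then show "0 \<le> s ^ (2 * k + 1)" by simp
  qed (use c in auto)
  also have "ennreal (- (0 ^ (2 * k + 2) / real (2 * k + 2)) - - ((-c) ^ (2 * k + 2) / real (2 * k + 2))) +
      ennreal (c ^ (2 * k + 2) / real (2 * k + 2) - 0 ^ (2 * k + 2) / real (2 * k + 2)) =
      ennreal (2 * (c ^ (2 * k + 2) / real (2 * k + 2)))"
    using c by (subst ennreal_plus[symmetric]) auto
  also have "2 * (c ^ (2 * k + 2) / real (2 * k + 2)) = 1 / (real (Suc k) * B ^ Suc k)"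
  proof -
    have "real (2 * k + 2) = 2 * real (Suc k)" by simp
    moreover have "2 * (1 / C / (2 * K)) = 1 / (K * C)" for C K :: real by simp
    ultimately show ?thesis unfolding c2 by metis
  qed
  finally show ?thesis .
qed

text \<open>The spherical integral is \<open>2 * Suc k\<close> times an integral over the ball,
  written in coordinates (height \<open>s\<close>, slope \<open>a\<close>, squared transverse slope
  \<open>z\<close>). The weight is chosen so that the integral over \<open>s\<close> leaves
  \<open>1 / Suc k\<close>, whatever \<open>a\<close> and \<open>z\<close> are; the product with the
  dimension is the factor 2, one for each hyperplane.\<close>

lemma nn_integral_sphere_gnomonic:
  fixes e e' :: "'a::euclidean_space" and H :: "real \<times> real \<Rightarrow> ennreal"
  assumes e: "e \<in> Basis" "e' \<in> Basis" "e \<noteq> e'" and d: "DIM('a) = 2 * Suc k" "k \<ge> 1"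
    and H[measurable]: "H \<in> borel_measurable borel"
  shows "(\<integral>\<^sup>+v. ennreal ((1 / (v \<bullet> e)) ^ (2 * Suc k)) *
        H (v \<bullet> e' / (v \<bullet> e), (1 - (v \<bullet> e)\<^sup>2 - (v \<bullet> e')\<^sup>2) / (v \<bullet> e)\<^sup>2) \<partial>sphere_measure) =
    2 * (\<integral>\<^sup>+a. \<integral>\<^sup>+z. H (a, z) * ennreal (radial_weight k z) \<partial>lborel \<partial>lborel)"
proof -
  define n where "n = Suc k"
  \<comment> \<open>\<open>s\<close>, \<open>a\<close> and \<open>z\<close> are still unscaled here:
    \<open>s\<^sup>2 + a\<^sup>2 + z\<close> is the squared norm of the point in the ball, and
    division by powers of \<open>s\<close> yields the slopes.\<close>
  define F where "F = (\<lambda>(s, a, z). ennreal (((s\<^sup>2 + a\<^sup>2 + z) / s\<^sup>2) ^ n) * H (a / s, z / s\<^sup>2) *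
      indicator {0<..1} (s\<^sup>2 + a\<^sup>2 + z))"
  have HP: "H \<in> borel_measurable (borel \<Otimes>\<^sub>M borel)" unfolding borel_prod by (rule H)
  have [measurable]: "F \<in> borel_measurable borel"
    unfolding borel_prod[symmetric] F_def split_beta using HP by measurable
  have "(\<integral>\<^sup>+v. ennreal ((1 / (v \<bullet> e)) ^ (2 * n)) *
        H (v \<bullet> e' / (v \<bullet> e), (1 - (v \<bullet> e)\<^sup>2 - (v \<bullet> e')\<^sup>2) / (v \<bullet> e)\<^sup>2) \<partial>sphere_measure) =
    of_nat DIM('a) * (\<integral>\<^sup>+x. F (x \<bullet> e, x \<bullet> e', x \<bullet> x - (x \<bullet> e)\<^sup>2 - (x \<bullet> e')\<^sup>2) \<partial>lborel)"
  proof (subst nn_integral_sphere_measure)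
    have "(\<lambda>v::'a. ennreal ((1 / (v \<bullet> e)) ^ (2 * n)) *
        H (v \<bullet> e' / (v \<bullet> e), (1 - (v \<bullet> e)\<^sup>2 - (v \<bullet> e')\<^sup>2) / (v \<bullet> e)\<^sup>2)) \<in> borel_measurable borel"
      using HP by measurable
    then show "(\<lambda>v::'a. ennreal ((1 / (v \<bullet> e)) ^ (2 * n)) *
        H (v \<bullet> e' / (v \<bullet> e), (1 - (v \<bullet> e)\<^sup>2 - (v \<bullet> e')\<^sup>2) / (v \<bullet> e)\<^sup>2)) \<in> borel_measurable sphere_measure"
      by (rule borel_measurable_sphere)
    have "ennreal ((1 / ((x /\<^sub>R norm x) \<bullet> e)) ^ (2 * n)) *
        H ((x /\<^sub>R norm x) \<bullet> e' / ((x /\<^sub>R norm x) \<bullet> e),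
          (1 - ((x /\<^sub>R norm x) \<bullet> e)\<^sup>2 - ((x /\<^sub>R norm x) \<bullet> e')\<^sup>2) / ((x /\<^sub>R norm x) \<bullet> e)\<^sup>2) *
        indicator (cball 0 1 - {0}) x = F (x \<bullet> e, x \<bullet> e', x \<bullet> x - (x \<bullet> e)\<^sup>2 - (x \<bullet> e')\<^sup>2)" for x :: 'a
    proof (cases "x = 0")
      case False
      then have nx: "norm x > 0" by simp
      have 1: "(1 / ((x /\<^sub>R norm x) \<bullet> e)) ^ (2 * n) = ((x \<bullet> x) / (x \<bullet> e)\<^sup>2) ^ n"
      proof -
        have "(1 / ((x /\<^sub>R norm x) \<bullet> e))\<^sup>2 = (x \<bullet> x) / (x \<bullet> e)\<^sup>2"
          by (simp add: power_divide power_mult_distrib power2_norm_eq_inner[symmetric] field_simps)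
        then show ?thesis by (simp only: power_mult)
      qed
      have 2: "(x /\<^sub>R norm x) \<bullet> e' / ((x /\<^sub>R norm x) \<bullet> e) = x \<bullet> e' / (x \<bullet> e)"
        using nx by simp
      have "(1 - (a / N)\<^sup>2 - (b / N)\<^sup>2) / (a / N)\<^sup>2 = (N\<^sup>2 - a\<^sup>2 - b\<^sup>2) / a\<^sup>2" if "N > 0" for a b N :: real
        using that by (cases "a = 0") (simp_all add: power_divide field_simps)
      from this[OF nx, of "x \<bullet> e" "x \<bullet> e'"]
      have 3: "(1 - ((x /\<^sub>R norm x) \<bullet> e)\<^sup>2 - ((x /\<^sub>R norm x) \<bullet> e')\<^sup>2) / ((x /\<^sub>R norm x) \<bullet> e)\<^sup>2 =
         (x \<bullet> x - (x \<bullet> e)\<^sup>2 - (x \<bullet> e')\<^sup>2) / (x \<bullet> e)\<^sup>2"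
        by (simp add: power2_norm_eq_inner divide_inverse mult.commute)
      have 4: "indicator (cball 0 1 - {0}) x = indicator {0<..1} (x \<bullet> x)"
        using False by (simp add: indicator_def norm_le_square inner_gt_zero_iff)
      show ?thesis
        unfolding 1 2 3 4 F_def by simp
    qed (simp add: F_def)
    then show "of_nat DIM('a) * (\<integral>\<^sup>+x. ennreal ((1 / ((x /\<^sub>R norm x) \<bullet> e)) ^ (2 * n)) *
        H ((x /\<^sub>R norm x) \<bullet> e' / ((x /\<^sub>R norm x) \<bullet> e),
          (1 - ((x /\<^sub>R norm x) \<bullet> e)\<^sup>2 - ((x /\<^sub>R norm x) \<bullet> e')\<^sup>2) / ((x /\<^sub>R norm x) \<bullet> e)\<^sup>2) *
        indicator (cball 0 1 - {0}) x \<partial>lborel) =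
        of_nat DIM('a) * (\<integral>\<^sup>+x. F (x \<bullet> e, x \<bullet> e', x \<bullet> x - (x \<bullet> e)\<^sup>2 - (x \<bullet> e')\<^sup>2) \<partial>lborel)"
      by simp
  qed
  also have "(\<integral>\<^sup>+x. F (x \<bullet> e, x \<bullet> e', x \<bullet> x - (x \<bullet> e)\<^sup>2 - (x \<bullet> e')\<^sup>2) \<partial>lborel) =
     (\<integral>\<^sup>+s. \<integral>\<^sup>+a. \<integral>\<^sup>+z. F (s, a, z) * ennreal (radial_weight k z) \<partial>lborel \<partial>lborel \<partial>lborel)"
    by (rule nn_integral_lborel_two_axes[OF e d]) measurable
  also have "\<dots> = (\<integral>\<^sup>+s. \<integral>\<^sup>+a. \<integral>\<^sup>+z. (ennreal (\<bar>s\<bar> ^ (2 * k + 1)) * indicator {s. s\<^sup>2 * (1 + a\<^sup>2 + z) \<le> 1} s) *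
       (ennreal ((1 + a\<^sup>2 + z) ^ n) * H (a, z) * ennreal (radial_weight k z)) \<partial>lborel \<partial>lborel \<partial>lborel)"
  \<comment> \<open>For nonzero \<open>s\<close>, replace \<open>a\<close> by \<open>s * a\<close>
    and \<open>z\<close> by \<open>s\<^sup>2 * z\<close>. The Jacobians and the scaling of
    \<open>radial_weight\<close> multiply to the power \<open>2 * k + 1\<close> of
    \<open>\<bar>s\<bar>\<close>.\<close>
  proof (rule nn_integral_cong_AE)
    have "AE s in lborel. s \<noteq> (0::real)" by (rule AE_lborel_singleton)
    then show "AE s in lborel. (\<integral>\<^sup>+a. \<integral>\<^sup>+z. F (s, a, z) * ennreal (radial_weight k z) \<partial>lborel \<partial>lborel) =
       (\<integral>\<^sup>+a. \<integral>\<^sup>+z. (ennreal (\<bar>s\<bar> ^ (2 * k + 1)) * indicator {s. s\<^sup>2 * (1 + a\<^sup>2 + z) \<le> 1} s) *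
       (ennreal ((1 + a\<^sup>2 + z) ^ n) * H (a, z) * ennreal (radial_weight k z)) \<partial>lborel \<partial>lborel)"
    proof eventually_elim
      case (elim s)
      have FP: "F \<in> borel_measurable (borel \<Otimes>\<^sub>M borel \<Otimes>\<^sub>M borel)" unfolding borel_prod by measurable
      have "(\<integral>\<^sup>+a. \<integral>\<^sup>+z. F (s, a, z) * ennreal (radial_weight k z) \<partial>lborel \<partial>lborel) =
         ennreal \<bar>s\<bar> * (\<integral>\<^sup>+a. \<integral>\<^sup>+z. F (s, 0 + s * a, z) * ennreal (radial_weight k z) \<partial>lborel \<partial>lborel)"
        by (rule nn_integral_real_affine) (use elim FP in measurable)
      also have "\<dots> = (\<integral>\<^sup>+a. ennreal \<bar>s\<bar> * (\<integral>\<^sup>+z. F (s, s * a, z) * ennreal (radial_weight k z) \<partial>lborel) \<partial>lborel)"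
        by (subst nn_integral_cmult) (use FP in simp_all)
      also have "\<dots> = (\<integral>\<^sup>+a. \<integral>\<^sup>+z. (ennreal (\<bar>s\<bar> ^ (2 * k + 1)) * indicator {s. s\<^sup>2 * (1 + a\<^sup>2 + z) \<le> 1} s) *
       (ennreal ((1 + a\<^sup>2 + z) ^ n) * H (a, z) * ennreal (radial_weight k z)) \<partial>lborel \<partial>lborel)"
      proof (rule nn_integral_cong)
        fix a :: real
        have "(\<integral>\<^sup>+z. F (s, s * a, z) * ennreal (radial_weight k z) \<partial>lborel) =
           ennreal \<bar>s\<^sup>2\<bar> * (\<integral>\<^sup>+z. F (s, s * a, 0 + s\<^sup>2 * z) * ennreal (radial_weight k (0 + s\<^sup>2 * z)) \<partial>lborel)"
        proof (rule nn_integral_real_affine)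
          show "(\<lambda>z. F (s, s * a, z) * ennreal (radial_weight k z)) \<in> borel_measurable borel"
            using FP by measurable
          show "s\<^sup>2 \<noteq> 0" using elim by simp
        qed
        then have "ennreal \<bar>s\<bar> * (\<integral>\<^sup>+z. F (s, s * a, z) * ennreal (radial_weight k z) \<partial>lborel) =
          (\<integral>\<^sup>+z. ennreal \<bar>s\<bar> * (ennreal (s\<^sup>2) * (F (s, s * a, s\<^sup>2 * z) * ennreal (radial_weight k (s\<^sup>2 * z)))) \<partial>lborel)"
          using FP by (simp add: nn_integral_cmult)
        also have "\<dots> = (\<integral>\<^sup>+z. (ennreal (\<bar>s\<bar> ^ (2 * k + 1)) * indicator {s. s\<^sup>2 * (1 + a\<^sup>2 + z) \<le> 1} s) *
           (ennreal ((1 + a\<^sup>2 + z) ^ n) * H (a, z) * ennreal (radial_weight k z)) \<partial>lborel)"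
        proof (rule nn_integral_cong)
          fix z :: real
          show "ennreal \<bar>s\<bar> * (ennreal (s\<^sup>2) * (F (s, s * a, s\<^sup>2 * z) * ennreal (radial_weight k (s\<^sup>2 * z)))) =
            (ennreal (\<bar>s\<bar> ^ (2 * k + 1)) * indicator {s. s\<^sup>2 * (1 + a\<^sup>2 + z) \<le> 1} s) *
           (ennreal ((1 + a\<^sup>2 + z) ^ n) * H (a, z) * ennreal (radial_weight k z))"
          proof (cases "z > 0")
            case False
            then have "radial_weight k z = 0" by (simp add: radial_weight_def)
            then show ?thesis by (simp add: radial_weight_scale[OF elim])
          next
            case True
            have s2: "s\<^sup>2 > 0" using elim by simp
            have B: "1 + a\<^sup>2 + z > 0" using True by (smt (verit) zero_le_power2)
            have eq: "s\<^sup>2 + (s * a)\<^sup>2 + s\<^sup>2 * z = s\<^sup>2 * (1 + a\<^sup>2 + z)"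
              by (simp add: algebra_simps power_mult_distrib)
            have p: "\<bar>s\<bar> * (s\<^sup>2 * s ^ (2 * (k - 1))) = \<bar>s\<bar> ^ (2 * k + 1)"
            proof -
              have "s\<^sup>2 * s ^ (2 * (k - 1)) = s ^ (2 * k)"
                using d(2) by (cases k) (simp_all add: power2_eq_square)
              then show ?thesis by (simp add: power_even_abs)
            qed
            have FF: "F (s, s * a, s\<^sup>2 * z) = ennreal ((1 + a\<^sup>2 + z) ^ n) * H (a, z) *
                indicator {s. s\<^sup>2 * (1 + a\<^sup>2 + z) \<le> 1} s"
              using elim s2 B unfolding F_def by (simp add: eq indicator_def)
            have main: "ennreal \<bar>s\<bar> * (ennreal (s\<^sup>2) * ennreal (radial_weight k (s\<^sup>2 * z))) =
                ennreal (\<bar>s\<bar> ^ (2 * k + 1)) * ennreal (radial_weight k z)"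
              unfolding radial_weight_scale[OF elim] p[symmetric]
              using radial_weight_nonneg[of k z]
              by (simp add: mult.assoc flip: ennreal_mult)
            have "x * (y * ((b * h * i) * r)) = (p * i) * (b * h * q)"
              if "x * (y * r) = p * q" for x y r b h i p q :: ennreal
            proof -
              have "x * (y * ((b * h * i) * r)) = (b * h * i) * (x * (y * r))"
                by (simp only: mult_ac)
              then show ?thesis unfolding that by (simp only: mult_ac)
            qed
            from this[OF main] show ?thesis unfolding FF .
          qed
        qed
        finally show "ennreal \<bar>s\<bar> * (\<integral>\<^sup>+z. F (s, s * a, z) * ennreal (radial_weight k z) \<partial>lborel) =
          (\<integral>\<^sup>+z. (ennreal (\<bar>s\<bar> ^ (2 * k + 1)) * indicator {s. s\<^sup>2 * (1 + a\<^sup>2 + z) \<le> 1} s) *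
           (ennreal ((1 + a\<^sup>2 + z) ^ n) * H (a, z) * ennreal (radial_weight k z)) \<partial>lborel)" .
      qed
      finally show ?case .
    qed
  qed
  also have "\<dots> = (\<integral>\<^sup>+a. \<integral>\<^sup>+s. \<integral>\<^sup>+z. (ennreal (\<bar>s\<bar> ^ (2 * k + 1)) * indicator {s. s\<^sup>2 * (1 + a\<^sup>2 + z) \<le> 1} s) *
       (ennreal ((1 + a\<^sup>2 + z) ^ n) * H (a, z) * ennreal (radial_weight k z)) \<partial>lborel \<partial>lborel \<partial>lborel)"
    by (rule lborel_pair.Fubini') (use HP in \<open>simp add: split_beta\<close>)
  also have "\<dots> = (\<integral>\<^sup>+a. \<integral>\<^sup>+z. \<integral>\<^sup>+s. (ennreal (\<bar>s\<bar> ^ (2 * k + 1)) * indicator {s. s\<^sup>2 * (1 + a\<^sup>2 + z) \<le> 1} s) *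
       (ennreal ((1 + a\<^sup>2 + z) ^ n) * H (a, z) * ennreal (radial_weight k z)) \<partial>lborel \<partial>lborel \<partial>lborel)"
    by (intro nn_integral_cong lborel_pair.Fubini') (use HP in \<open>simp add: split_beta\<close>)
  also have "\<dots> = (\<integral>\<^sup>+a. \<integral>\<^sup>+z. ennreal (1 / real n) * (H (a, z) * ennreal (radial_weight k z)) \<partial>lborel \<partial>lborel)"
  proof (intro nn_integral_cong)
    fix a z :: real
    show "(\<integral>\<^sup>+s. (ennreal (\<bar>s\<bar> ^ (2 * k + 1)) * indicator {s. s\<^sup>2 * (1 + a\<^sup>2 + z) \<le> 1} s) *
       (ennreal ((1 + a\<^sup>2 + z) ^ n) * H (a, z) * ennreal (radial_weight k z)) \<partial>lborel) =
       ennreal (1 / real n) * (H (a, z) * ennreal (radial_weight k z))"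
    proof (cases "z > 0")
      case False
      then have "radial_weight k z = 0" by (simp add: radial_weight_def)
      then show ?thesis by simp
    next
      case True
      have B: "1 + a\<^sup>2 + z > 0" using True by (smt (verit) zero_le_power2)
      have "(\<integral>\<^sup>+s. (ennreal (\<bar>s\<bar> ^ (2 * k + 1)) * indicator {s. s\<^sup>2 * (1 + a\<^sup>2 + z) \<le> 1} s) *
       (ennreal ((1 + a\<^sup>2 + z) ^ n) * H (a, z) * ennreal (radial_weight k z)) \<partial>lborel) =
       ennreal (1 / (real n * (1 + a\<^sup>2 + z) ^ n)) * (ennreal ((1 + a\<^sup>2 + z) ^ n) * H (a, z) * ennreal (radial_weight k z))"
        using nn_integral_odd_power_interval[OF B, of k] by (simp add: nn_integral_multc n_def)
      also have "ennreal (1 / (real n * (1 + a\<^sup>2 + z) ^ n)) * ennreal ((1 + a\<^sup>2 + z) ^ n) = ennreal (1 / real n)"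
        using B by (simp add: n_def flip: ennreal_mult)
      then have "ennreal (1 / (real n * (1 + a\<^sup>2 + z) ^ n)) * (ennreal ((1 + a\<^sup>2 + z) ^ n) * H (a, z) * ennreal (radial_weight k z))
          = ennreal (1 / real n) * (H (a, z) * ennreal (radial_weight k z))"
        by (metis (no_types, lifting) mult.assoc)
      finally show ?thesis .
    qed
  qed
  also have "\<dots> = ennreal (1 / real n) * (\<integral>\<^sup>+a. \<integral>\<^sup>+z. H (a, z) * ennreal (radial_weight k z) \<partial>lborel \<partial>lborel)"
    using HP by (simp add: nn_integral_cmult)
  also have "of_nat DIM('a) * (ennreal (1 / real n) * (\<integral>\<^sup>+a. \<integral>\<^sup>+z. H (a, z) * ennreal (radial_weight k z) \<partial>lborel \<partial>lborel)) =
     2 * (\<integral>\<^sup>+a. \<integral>\<^sup>+z. H (a, z) * ennreal (radial_weight k z) \<partial>lborel \<partial>lborel)"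
  proof -
    have "of_nat DIM('a) * ennreal (1 / real n) = ennreal (real (2 * n) * (1 / real n))"
      unfolding d(1) n_def ennreal_of_nat_eq_real_of_nat by (rule ennreal_mult[symmetric]) simp_all
    also have "real (2 * n) * (1 / real n) = 2"
      by (simp add: n_def field_simps)
    finally show ?thesis by (simp add: mult.assoc[symmetric])
  qed
  finally show ?thesis by (simp add: n_def)
qed

section \<open>The cosine transform in the gnomonic chart\<close>

text \<open>The cone over the equator lies in a hyperplane. The chart by slopes is undefined exactly
  there.\<close>

lemma AE_sphere_inner_nonzero:
  fixes e :: "'a::euclidean_space"
  assumes "e \<in> Basis"
  shows "AE v in sphere_measure. v \<bullet> e \<noteq> 0"
proof -
  let ?N = "{v \<in> sphere 0 1. v \<bullet> e = 0}"
  have N: "?N \<in> sets borel"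
  proof -
    have "?N = sphere 0 1 \<inter> {v. v \<bullet> e = 0}" by auto
    then show ?thesis
      by (simp only:) (intro borel_closed closed_Int closed_sphere closed_Collect_eq continuous_intros)
  qed
  then have NS: "?N \<in> sets sphere_measure"
    by (auto simp: sets_sphere_measure sets_restrict_space_iff)
  have "{x. x \<bullet> e = 0} \<in> null_sets lebesgue"
    using negligible_standard_hyperplane[OF assms, of 0] by (simp add: negligible_iff_null_sets)
  moreover have "{x. x \<bullet> e = 0} \<in> sets borel"
    by (intro borel_closed closed_Collect_eq continuous_intros)
  ultimately have "{x. x \<bullet> e = 0} \<in> null_sets lborel"
    by (auto simp: null_sets_def)
  then have AE: "AE x in lborel. x \<bullet> e \<noteq> 0"
    using AE_not_in by fastforce
  have "emeasure sphere_measure ?N = (\<integral>\<^sup>+v. indicator ?N v \<partial>sphere_measure)"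
    using NS by simp
  also have "\<dots> = of_nat DIM('a) * (\<integral>\<^sup>+x. indicator ?N (x /\<^sub>R norm x) * indicator (cball 0 1 - {0}) x \<partial>lborel)"
    by (rule nn_integral_sphere_measure) (use NS in simp)
  also have "(\<integral>\<^sup>+x. indicator ?N (x /\<^sub>R norm x) * indicator (cball 0 1 - {0}) x \<partial>lborel) = (\<integral>\<^sup>+(x::'a). 0 \<partial>lborel)"
    by (rule nn_integral_cong_AE) (use AE in eventually_elim, auto simp: indicator_def)
  finally have "emeasure sphere_measure ?N = 0" by simp
  then show ?thesis
    using AE_iff_measurable[OF NS, of "\<lambda>v. v \<bullet> e \<noteq> 0"] by (simp add: space_sphere_measure)
qed

text \<open>Applied to indicators, the formula for nonnegative functions identifies the image of the
  weighted spherical measure under the chart with a weighted Lebesgue measure. Signed integrals and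
  integrability then transfer together.\<close>

lemma integral_sphere_gnomonic:
  fixes e e' :: "'a::euclidean_space" and H :: "real \<times> real \<Rightarrow> real"
  assumes e: "e \<in> Basis" "e' \<in> Basis" "e \<noteq> e'" and d: "DIM('a) = 2 * Suc k" "k \<ge> 1"
    and H[measurable]: "H \<in> borel_measurable borel"
  defines "W \<equiv> \<lambda>v. (1 / (v \<bullet> e)) ^ (2 * Suc k) *
        H (v \<bullet> e' / (v \<bullet> e), (1 - (v \<bullet> e)\<^sup>2 - (v \<bullet> e')\<^sup>2) / (v \<bullet> e)\<^sup>2)"
  shows "(LINT v|sphere_measure. W v) = (LINT p|lborel. 2 * radial_weight k (snd p) * H p)"
    and "integrable sphere_measure W \<longleftrightarrow> integrable lborel (\<lambda>p. 2 * radial_weight k (snd p) * H p)"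
proof -
  define K where "K v = (v \<bullet> e' / (v \<bullet> e), (1 - (v \<bullet> e)\<^sup>2 - (v \<bullet> e')\<^sup>2) / (v \<bullet> e)\<^sup>2)" for v :: 'a
  define w where "w v = (1 / (v \<bullet> e)) ^ (2 * Suc k)" for v :: 'a
  define \<rho> where "\<rho> p = 2 * radial_weight k (snd p)" for p :: "real \<times> real"
  have w0: "w v \<ge> 0" for v by (simp add: w_def power_mult)
  have \<rho>0: "\<rho> p \<ge> 0" for p by (simp add: \<rho>_def radial_weight_nonneg)
  have K[measurable]: "K \<in> sphere_measure \<rightarrow>\<^sub>M borel"
    unfolding borel_prod[symmetric] K_def[abs_def]
    by (intro measurable_Pair borel_measurable_sphere) measurable
  have w[measurable]: "w \<in> borel_measurable sphere_measure"
    unfolding w_def[abs_def] by (intro borel_measurable_sphere) measurable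
  have \<rho>[measurable]: "\<rho> \<in> borel_measurable borel"
    unfolding borel_prod[symmetric] \<rho>_def[abs_def] by measurable
  have eq: "distr (density sphere_measure w) borel K = density lborel \<rho>"
  proof (rule measure_eqI)
    fix A assume "A \<in> sets (distr (density sphere_measure w) borel K)"
    then have A[measurable]: "A \<in> sets borel" by simp
    have "emeasure (distr (density sphere_measure w) borel K) A =
        (\<integral>\<^sup>+v. ennreal (w v) * indicator A (K v) \<partial>sphere_measure)"
      by (simp add: nn_integral_distr nn_integral_density flip: nn_integral_indicator)
    also have "\<dots> = 2 * (\<integral>\<^sup>+a. \<integral>\<^sup>+z. indicator A (a, z) * ennreal (radial_weight k z) \<partial>lborel \<partial>lborel)"
      using nn_integral_sphere_gnomonic[OF e d, of "indicator A"] by (simp add: w_def K_def)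
    also have "\<dots> = (\<integral>\<^sup>+a. \<integral>\<^sup>+z. ennreal (\<rho> (a, z)) * indicator A (a, z) \<partial>lborel \<partial>lborel)"
    proof -
      have "(\<lambda>p. indicator A p * ennreal (radial_weight k (snd p))) \<in> borel_measurable (borel \<Otimes>\<^sub>M borel)"
        using A unfolding borel_prod[symmetric] by measurable
      then have m: "(\<lambda>z. indicator A (a, z) * ennreal (radial_weight k z)) \<in> borel_measurable lborel"
        "(\<lambda>a. \<integral>\<^sup>+z. indicator A (a, z) * ennreal (radial_weight k z) \<partial>lborel) \<in> borel_measurable lborel" for a
        using A unfolding borel_prod[symmetric] by measurable
      have "ennreal (\<rho> (a, z)) * indicator A (a, z) = 2 * (indicator A (a, z) * ennreal (radial_weight k z))" for a z
        by (simp add: \<rho>_def ennreal_mult radial_weight_nonneg mult_ac)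
      then show ?thesis by (simp add: nn_integral_cmult m)
    qed
    also have "\<dots> = (\<integral>\<^sup>+p. ennreal (\<rho> p) * indicator A p \<partial>(lborel \<Otimes>\<^sub>M lborel))"
      by (rule lborel.nn_integral_fst) (simp add: lborel_prod)
    also have "\<dots> = emeasure (density lborel \<rho>) A"
      by (simp add: lborel_prod emeasure_density)
    finally show "emeasure (distr (density sphere_measure w) borel K) A = emeasure (density lborel \<rho>) A" .
  qed simp
  have KD: "K \<in> density sphere_measure w \<rightarrow>\<^sub>M borel" by simp
  have HK: "(\<lambda>v. H (K v)) \<in> borel_measurable sphere_measure"
    by measurable
  have W: "W = (\<lambda>v. w v *\<^sub>R H (K v))" by (simp add: W_def w_def K_def)
  have "(LINT v|sphere_measure. W v) = (LINT v|density sphere_measure w. H (K v))"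
    unfolding W by (rule integral_density[symmetric]) (use w0 w HK in auto)
  also have "\<dots> = (LINT p|distr (density sphere_measure w) borel K. H p)"
    by (rule integral_distr[symmetric]) (use KD in auto)
  also have "\<dots> = (LINT p|lborel. \<rho> p *\<^sub>R H p)"
    unfolding eq by (rule integral_density) (use \<rho>0 in auto)
  finally show "(LINT v|sphere_measure. W v) = (LINT p|lborel. 2 * radial_weight k (snd p) * H p)"
    by (simp add: \<rho>_def)
  have "integrable sphere_measure W \<longleftrightarrow> integrable (density sphere_measure w) (\<lambda>v. H (K v))"
    unfolding W by (rule integrable_density[symmetric]) (use w0 w HK in auto)
  also have "\<dots> \<longleftrightarrow> integrable (distr (density sphere_measure w) borel K) H"
    by (rule integrable_distr_eq[symmetric]) (use KD in auto)
  also have "\<dots> \<longleftrightarrow> integrable lborel (\<lambda>p. \<rho> p *\<^sub>R H p)"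
    unfolding eq by (rule integrable_density) (use \<rho>0 in auto)
  finally show "integrable sphere_measure W \<longleftrightarrow> integrable lborel (\<lambda>p. 2 * radial_weight k (snd p) * H p)"
    by (simp add: \<rho>_def)
qed

text \<open>\<open>k = n - 1\<close> throughout, in dimension \<open>2 * n\<close>.\<close>

definition inversion_constant :: "nat \<Rightarrow> real" where
  "inversion_constant k = (-1) ^ k / (4 * unit_ball_vol (2 * real k) * fact k)"

text \<open>The direction \<open>e' + t *\<^sub>R e\<close> has no component outside the plane of
  the two axes, so in the chart the kernel depends on the slope \<open>a\<close> only. The integral
  over \<open>z\<close> then turns \<open>X k\<close> into \<open>P 2 a\<close>, and the integral
  over \<open>a\<close> recovers \<open>P 0 t\<close>.\<close>

lemma cosine_transform_of_tower:
  fixes e e' :: "'a::euclidean_space"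
  assumes e: "e \<in> Basis" "e' \<in> Basis" "e \<noteq> e'" and d: "DIM('a) = 2 * Suc k" "k \<ge> 1"
    and g: "continuous_on (sphere 0 1) g"
    and gX: "\<And>v. v \<in> sphere 0 1 \<Longrightarrow> v \<bullet> e \<noteq> 0 \<Longrightarrow>
        g v = inversion_constant k * (1 / \<bar>v \<bullet> e\<bar>) ^ (2 * k + 3) * X k ((1 - (v \<bullet> e)\<^sup>2) / (v \<bullet> e)\<^sup>2)"
    and X: "derivative_tower {0..} X" "\<And>x. X 0 x = P 2 (sqrt x)"
    and lim: "\<And>j. ((\<lambda>x. x ^ j * X j x) \<longlongrightarrow> 0) at_top"
    and P: "derivative_tower UNIV P" "\<And>a. P 0 (- a) = P 0 a"
    and Q: "derivative_tower UNIV Q" "\<And>a. Q 0 (- a) = Q 0 a"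
    and PQ: "\<And>a. a > 0 \<Longrightarrow> P 0 a = a * Q 0 (1 / a)"
  shows "(LINT v|sphere_measure. \<bar>(e' + t *\<^sub>R e) \<bullet> v\<bar> * g v) = P 0 t"
proof -
  define c where "c = inversion_constant k"
  define V where "V = unit_ball_vol (2 * real k)"
  have V: "V > 0" by (simp add: V_def)
  obtain m where m: "k = Suc m" using d(2) by (cases k) auto
  \<comment> \<open>\<open>X\<close> is controlled on nonnegative arguments only. Cutting off at
    negative \<open>snd p\<close> makes \<open>H\<close> measurable and changes no integral, as
    \<open>radial_weight\<close> vanishes there.\<close>
  define H where "H p = c * \<bar>fst p + t\<bar> * (if snd p \<ge> 0 then X k ((fst p)\<^sup>2 + snd p) else 0)" for p :: "real \<times> real"
  have cX: "continuous_on {0..} (X k)" using derivative_tower_continuous_on[OF X(1)] .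
  have Hm[measurable]: "H \<in> borel_measurable borel"
  proof -
    have "continuous_on UNIV (\<lambda>x. X k (max 0 x))"
      by (rule continuous_on_compose2[OF cX]) (auto intro!: continuous_intros)
    then have [measurable]: "(\<lambda>x. X k (max 0 x)) \<in> borel_measurable borel"
      by (rule borel_measurable_continuous_onI)
    have "H = (\<lambda>p. c * \<bar>fst p + t\<bar> * (if snd p \<ge> 0 then X k (max 0 ((fst p)\<^sup>2 + snd p)) else 0))"
      by (auto simp: H_def fun_eq_iff max_def)
    also have "\<dots> \<in> borel_measurable borel"
      unfolding borel_prod[symmetric] by measurable
    finally show ?thesis .
  qed
  define W where "W v = (1 / (v \<bullet> e)) ^ (2 * Suc k) *
        H (v \<bullet> e' / (v \<bullet> e), (1 - (v \<bullet> e)\<^sup>2 - (v \<bullet> e')\<^sup>2) / (v \<bullet> e)\<^sup>2)" for v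
  have ee: "e \<bullet> e = 1" "e' \<bullet> e' = 1" "e \<bullet> e' = 0" "e' \<bullet> e = 0"
    using e by (auto simp: inner_Basis)
  have AE_eq: "AE v in sphere_measure. \<bar>(e' + t *\<^sub>R e) \<bullet> v\<bar> * g v = W v"
  proof -
    have eqW: "\<bar>(e' + t *\<^sub>R e) \<bullet> v\<bar> * g v = W v" if v: "v \<in> sphere 0 1" "v \<bullet> e \<noteq> 0" for v
    proof -
      define s a where "s = v \<bullet> e" and "a = v \<bullet> e'"
      have s: "s \<noteq> 0" using v by (simp add: s_def)
      have "(\<Sum>b\<in>{e, e'}. (v \<bullet> b)\<^sup>2) \<le> (\<Sum>b\<in>Basis. (v \<bullet> b)\<^sup>2)"
        using e by (intro sum_mono2) auto
      also have "\<dots> = v \<bullet> v"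
        using euclidean_inner[of v v] by (simp add: power2_eq_square)
      also have "\<dots> = 1" using v by (simp add: norm_eq_1)
      finally have sa: "s\<^sup>2 + a\<^sup>2 \<le> 1" using e(3) by (simp add: s_def a_def)
      have lhs: "(e' + t *\<^sub>R e) \<bullet> v = a + t * s"
        by (simp add: s_def a_def inner_add_left inner_commute[of v])
      have eq: "(a / s)\<^sup>2 + (1 - s\<^sup>2 - a\<^sup>2) / s\<^sup>2 = (1 - s\<^sup>2) / s\<^sup>2"
        using s by (simp add: power_divide field_simps)
      have "W v = (1 / s) ^ (2 * Suc k) * (c * \<bar>a / s + t\<bar> * X k ((1 - s\<^sup>2) / s\<^sup>2))"
        using sa unfolding W_def H_def s_def[symmetric] a_def[symmetric] by (simp add: eq)
      also have "\<dots> = \<bar>a + t * s\<bar> * (c * (1 / \<bar>s\<bar>) ^ (2 * k + 3) * X k ((1 - s\<^sup>2) / s\<^sup>2))"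
      proof -
        have "(1 / s) ^ (2 * Suc k) = (1 / \<bar>s\<bar>) ^ (2 * Suc k)"
          by (simp add: power_mult power_divide)
        moreover have "\<bar>a / s + t\<bar> = \<bar>a + t * s\<bar> * (1 / \<bar>s\<bar>)"
          using s by (simp add: field_simps flip: abs_mult)
        moreover have "(1 / \<bar>s\<bar>) ^ (2 * k + 3) = (1 / \<bar>s\<bar>) ^ (2 * Suc k) * (1 / \<bar>s\<bar>)"
          by (simp add: numeral_3_eq_3)
        ultimately show ?thesis by (simp only: mult_ac)
      qed
      finally show ?thesis
        using gX[OF v] unfolding lhs by (simp add: s_def c_def)
    qed
    show ?thesis
      using AE_sphere_inner_nonzero[OF e(1)] AE_space
      by eventually_elim (simp add: space_sphere_measure eqW)
  qed
  have int0: "integrable sphere_measure (\<lambda>v. \<bar>(e' + t *\<^sub>R e) \<bullet> v\<bar> * g v)"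
    by (intro integrable_sphere_continuous continuous_intros g)
  have mW: "W \<in> borel_measurable sphere_measure"
  proof (rule borel_measurable_sphere)
    have "H \<in> borel_measurable (borel \<Otimes>\<^sub>M borel)" unfolding borel_prod by (rule Hm)
    then show "W \<in> borel_measurable borel"
      unfolding W_def[abs_def] by measurable
  qed
  have "integrable sphere_measure W"
    using integrable_cong_AE[OF borel_measurable_integrable[OF int0] mW AE_eq] int0 by simp
  then have intp: "integrable (lborel \<Otimes>\<^sub>M lborel) (\<lambda>p. 2 * radial_weight k (snd p) * H p)"
    using integral_sphere_gnomonic(2)[OF e d Hm] unfolding W_def[abs_def] by (simp add: lborel_prod)
  have inner: "(LINT z|lborel. 2 * radial_weight k z * H (a, z)) = 1 / 2 * (\<bar>a + t\<bar> * P 2 a)"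
    if int: "integrable lborel (\<lambda>z. 2 * radial_weight k z * H (a, z))" for a
  \<comment> \<open>Both sides vanish at the kink. It is separated because integrability of the
    factor with \<open>X\<close> follows from \<open>int\<close> only when the constant
    \<open>C\<close> below is nonzero.\<close>
  proof (cases "a + t = 0")
    case True
    then show ?thesis by (simp add: H_def)
  next
    case False
    define C where "C = 2 * V * real k * c * \<bar>a + t\<bar>"
    have c: "c \<noteq> 0" using V by (simp add: c_def inversion_constant_def flip: V_def)
    then have C: "C \<noteq> 0" using False V d(2) by (simp add: C_def)
    have eq: "(\<lambda>z. 2 * radial_weight k z * H (a, z)) =
        (\<lambda>z. C * (indicator {0<..} z *\<^sub>R (z ^ m * X (Suc m) (a\<^sup>2 + z))))"
      by (auto simp: fun_eq_iff C_def radial_weight_def H_def V_def m indicator_def)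
    have "set_integrable lborel {0<..} (\<lambda>z. z ^ m * X (Suc m) (a\<^sup>2 + z))"
      using int C unfolding eq set_integrable_def by (subst (asm) integrable_mult_left_iff) auto
    then have "(LINT z:{0<..}|lborel. z ^ m * X (Suc m) (a\<^sup>2 + z)) = (-1) ^ Suc m * fact m * X 0 (a\<^sup>2)"
      by (intro taylor_remainder_at_infinity X lim) auto
    \<comment> \<open>The square root of \<open>a\<^sup>2\<close> is \<open>\<bar>a\<bar>\<close>;
      evenness of \<open>P 2\<close> removes the absolute value.\<close>
    moreover have "X 0 (a\<^sup>2) = P 2 a"
      using derivative_tower_even(2)[OF P, of a] X(2)[of "a\<^sup>2"] by (auto simp: abs_if)
    ultimately have "(LINT z|lborel. 2 * radial_weight k z * H (a, z)) = C * ((-1) ^ k * fact m * P 2 a)"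
      unfolding eq by (simp add: set_lebesgue_integral_def m)
    also have "\<dots> = 1 / 2 * (\<bar>a + t\<bar> * P 2 a)"
    proof -
      have "(-1::real) ^ k * (-1) ^ k = 1" by (simp flip: power_mult_distrib)
      moreover have "4 * V * fact k \<noteq> 0" using V by simp
      \<comment> \<open>This equation dictates \<open>inversion_constant\<close>. Of its factor 4,
        one 2 comes from the two hyperplanes; the other leaves the \<open>1 / 2\<close> that cancels
        the 2 of \<open>integral_abs_times_second_derivative\<close>.\<close>
      ultimately have "c * (-1) ^ k * (4 * V * fact k) = 1"
        unfolding c_def inversion_constant_def V_def[symmetric] by simp
      moreover have "fact k = real k * fact m" by (simp add: m)
      ultimately have one: "c * (-1) ^ k * (4 * V * (real k * fact m)) = 1" by simp
      have "C * ((-1) ^ k * fact m * P 2 a) =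
          (c * (-1) ^ k * (4 * V * (real k * fact m))) * (1 / 2 * (\<bar>a + t\<bar> * P 2 a))"
        by (simp add: C_def)
      then show ?thesis unfolding one by simp
    qed
    finally show ?thesis .
  qed
  have AEi: "AE a in lborel. (LINT z|lborel. 2 * radial_weight k z * H (a, z)) = 1 / 2 * (\<bar>a + t\<bar> * P 2 a)"
    using lborel_pair.AE_integrable_fst'[OF intp] by eventually_elim (use inner in simp)
  have mP: "(\<lambda>a. 1 / 2 * (\<bar>a + t\<bar> * P 2 a)) \<in> borel_measurable lborel"
    using derivative_tower_continuous_on[OF P(1), of 2]
    by (auto intro!: borel_measurable_continuous_onI continuous_intros)
  \<comment> \<open>No decay estimate for \<open>P 2\<close> is made: integrability is inherited
    through Fubini from a continuous integrand on the compact sphere.\<close>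
  have "integrable lborel (\<lambda>a. LINT z|lborel. 2 * radial_weight k z * H (a, z))"
    using lborel_pair.integrable_fst'[OF intp] by simp
  then have "integrable lborel (\<lambda>a. 1 / 2 * (\<bar>a + t\<bar> * P 2 a))"
    using integrable_cong_AE[OF _ mP AEi] by blast
  then have intP: "integrable lborel (\<lambda>a. \<bar>a + t\<bar> * P 2 a)"
    by (subst (asm) integrable_mult_left_iff) auto
  have "(LINT v|sphere_measure. \<bar>(e' + t *\<^sub>R e) \<bullet> v\<bar> * g v) = (LINT v|sphere_measure. W v)"
    by (rule integral_cong_AE[OF borel_measurable_integrable[OF int0] mW AE_eq])
  also have "\<dots> = (LINT p|(lborel \<Otimes>\<^sub>M lborel). 2 * radial_weight k (snd p) * H p)"
    using integral_sphere_gnomonic(1)[OF e d Hm] unfolding W_def[abs_def] by (simp add: lborel_prod)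
  also have "\<dots> = (LINT a|lborel. LINT z|lborel. 2 * radial_weight k z * H (a, z))"
    using lborel_pair.integral_fst'[OF intp] by simp
  also have "\<dots> = (LINT a|lborel. 1 / 2 * (\<bar>a + t\<bar> * P 2 a))"
    by (rule integral_cong_AE[OF _ mP AEi]) (use lborel_pair.integrable_fst'[OF intp] in simp)
  also have "\<dots> = 1 / 2 * (2 * P 0 t)"
    using integral_abs_times_second_derivative[OF P Q PQ intP] by simp
  finally show ?thesis by simp
qed

section \<open>Surjectivity on rotationally symmetric functions\<close>

text \<open>Householder reflection in the hyperplane orthogonal to \<open>a\<close>. For
  \<open>a = 0\<close> it is the identity, so \<open>reflection (u - w)\<close> may be used without
  separating \<open>u = w\<close>.\<close>

definition reflection :: "'a::euclidean_space \<Rightarrow> 'a \<Rightarrow> 'a" where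
  "reflection a x = x - (2 * (x \<bullet> a) / (a \<bullet> a)) *\<^sub>R a"

lemma orthogonal_transformation_reflection: "orthogonal_transformation (reflection a)"
proof (cases "a = 0")
  case True
  then have "reflection a = (\<lambda>x. x)" by (simp add: reflection_def fun_eq_iff)
  then show ?thesis by simp
next
  case False
  then have "a \<bullet> a \<noteq> 0" by simp
  have "linear (reflection a)"
    unfolding reflection_def
    by (rule linearI) (simp_all add: inner_add_left algebra_simps add_divide_distrib)
  moreover have "reflection a v \<bullet> reflection a w = v \<bullet> w" for v w
  proof -
    have "reflection a v \<bullet> reflection a w = v \<bullet> w - (2 * (v \<bullet> a) / (a \<bullet> a)) * (a \<bullet> w)
        - (2 * (w \<bullet> a) / (a \<bullet> a)) * (v \<bullet> a) + (2 * (v \<bullet> a) / (a \<bullet> a)) * (2 * (w \<bullet> a) / (a \<bullet> a)) * (a \<bullet> a)"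
      by (simp add: reflection_def inner_diff_left inner_diff_right algebra_simps)
    also have "\<dots> = v \<bullet> w"
      using \<open>a \<bullet> a \<noteq> 0\<close> by (simp add: inner_commute[of a w] field_simps)
    finally show ?thesis .
  qed
  ultimately show ?thesis by (simp add: orthogonal_transformation_def)
qed

lemma reflection_fixes: "x \<bullet> a = 0 \<Longrightarrow> reflection a x = x"
  by (simp add: reflection_def)

lemma reflection_swaps:
  assumes "norm u = norm w"
  shows "reflection (u - w) u = w"
proof (cases "u = w")
  case True
  then show ?thesis by (simp add: reflection_def)
next
  case False
  have "(u - w) \<bullet> (u - w) = 2 * (u \<bullet> (u - w))"
    using assms by (simp add: inner_diff_left inner_diff_right norm_eq inner_commute)
  then have "2 * (u \<bullet> (u - w)) / ((u - w) \<bullet> (u - w)) = (u - w) \<bullet> (u - w) / ((u - w) \<bullet> (u - w))"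
    by (simp only:)
  also have "\<dots> = 1" using False by (subst divide_self) auto
  finally have one: "2 * (u \<bullet> (u - w)) / ((u - w) \<bullet> (u - w)) = 1" .
  show ?thesis unfolding reflection_def one by simp
qed

lemma rotationally_symmetricD:
  "rotationally_symmetric e f \<Longrightarrow> orthogonal_transformation U \<Longrightarrow> U e = e \<Longrightarrow> f (U x) = f x"
  by (metis comp_apply rotationally_symmetric_def)

text \<open>Interior points only: \<open>deriv\<close> is two-sided, the tower at 0 is
  one-sided.\<close>

lemma higher_deriv_tower:
  assumes "derivative_tower {0..} X" "x > 0"
  shows "(deriv ^^ j) (X 0) x = X j x"
  using assms(2)
proof (induction j arbitrary: x)
  case (Suc j)
  have "(X j has_real_derivative X (Suc j) x) (at x)"
    using derivative_towerD[OF assms(1), of x j] Suc.prems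
      at_within_interior[of x "{0..}"] by (simp add: interior_Ici[of "-1"])
  then have "((deriv ^^ j) (X 0) has_real_derivative X (Suc j) x) (at x)"
    by (rule has_field_derivative_transform_within_open[where S = "{0<..}"])
      (use Suc in auto)
  then show ?case by (simp add: DERIV_imp_deriv)
qed simp

section \<open>Continuity and symmetry of the cosine integral\<close>

lemma integrable_cosine_kernel:
  fixes g :: "'a::euclidean_space \<Rightarrow> real"
  assumes "continuous_on (sphere 0 1) g"
  shows "integrable sphere_measure (\<lambda>v. \<bar>u \<bullet> v\<bar> * g v)"
  by (intro integrable_sphere_continuous continuous_intros assms)

lemma cosine_kernel_scaleR:
  "(LINT v|sphere_measure. \<bar>(c *\<^sub>R u) \<bullet> v\<bar> * g v) = \<bar>c\<bar> * (LINT v|sphere_measure. \<bar>u \<bullet> v\<bar> * g v)"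
  by (simp add: abs_mult mult.assoc)

text \<open>Lipschitz, with the integral of \<open>\<bar>g v\<bar>\<close> as constant. Needed to
  reach the pole by a limit.\<close>

lemma continuous_on_cosine_kernel:
  fixes g :: "'a::euclidean_space \<Rightarrow> real"
  assumes g: "continuous_on (sphere 0 1) g"
  shows "continuous_on UNIV (\<lambda>u. LINT v|sphere_measure. \<bar>u \<bullet> v\<bar> * g v)"
proof -
  let ?L = "LINT v|sphere_measure. \<bar>g v\<bar>"
  have "dist (LINT v|sphere_measure. \<bar>u \<bullet> v\<bar> * g v) (LINT v|sphere_measure. \<bar>w \<bullet> v\<bar> * g v)
      \<le> ?L * dist u w" for u w
  proof -
    have "(LINT v|sphere_measure. \<bar>u \<bullet> v\<bar> * g v) - (LINT v|sphere_measure. \<bar>w \<bullet> v\<bar> * g v) =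
        (LINT v|sphere_measure. \<bar>u \<bullet> v\<bar> * g v - \<bar>w \<bullet> v\<bar> * g v)"
      by (rule Bochner_Integration.integral_diff[symmetric]) (rule integrable_cosine_kernel[OF g])+
    also have "\<bar>\<dots>\<bar> \<le> (LINT v|sphere_measure. dist u w * \<bar>g v\<bar>)"
    proof (rule integral_abs_bound[THEN order_trans], rule integral_mono)
      show "integrable sphere_measure (\<lambda>v. \<bar>\<bar>u \<bullet> v\<bar> * g v - \<bar>w \<bullet> v\<bar> * g v\<bar>)"
        "integrable sphere_measure (\<lambda>v. dist u w * \<bar>g v\<bar>)"
        by (intro integrable_sphere_continuous continuous_intros g)+
      fix v :: 'a assume "v \<in> space sphere_measure"
      then have "norm v = 1" by (simp add: space_sphere_measure)
      then have "\<bar>\<bar>u \<bullet> v\<bar> - \<bar>w \<bullet> v\<bar>\<bar> \<le> dist u w"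
        using Cauchy_Schwarz_ineq2[of "u - w" v] by (simp add: inner_diff_left dist_norm)
      then show "\<bar>\<bar>u \<bullet> v\<bar> * g v - \<bar>w \<bullet> v\<bar> * g v\<bar> \<le> dist u w * \<bar>g v\<bar>"
        by (simp add: abs_mult mult_right_mono flip: left_diff_distrib)
    qed
    finally show ?thesis by (simp add: dist_real_def mult.commute)
  qed
  then have "?L-lipschitz_on UNIV (\<lambda>u. LINT v|sphere_measure. \<bar>u \<bullet> v\<bar> * g v)"
    by (intro lipschitz_onI) auto
  then show ?thesis by (rule lipschitz_on_continuous_on)
qed

lemma cosine_kernel_orthogonal:
  fixes g :: "'a::euclidean_space \<Rightarrow> real" and U :: "'a \<Rightarrow> 'a"
  assumes U: "orthogonal_transformation U" and g: "continuous_on (sphere 0 1) g"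
  shows "(LINT v|sphere_measure. \<bar>u \<bullet> v\<bar> * g (U v)) = (LINT v|sphere_measure. \<bar>U u \<bullet> v\<bar> * g v)"
proof -
  have "(LINT v|sphere_measure. \<bar>u \<bullet> v\<bar> * g (U v)) = (LINT v|sphere_measure. \<bar>U u \<bullet> U v\<bar> * g (U v))"
    using U by (simp add: orthogonal_transformation_def)
  also have "\<dots> = (LINT v|sphere_measure. \<bar>U u \<bullet> v\<bar> * g v)"
    by (rule integral_sphere_orthogonal[OF U]) (intro continuous_intros g)
  finally show ?thesis .
qed

lemma inner_self_ge_inner_Basis_sq: "e \<in> Basis \<Longrightarrow> (x \<bullet> e)\<^sup>2 \<le> x \<bullet> x"
  using Cauchy_Schwarz_ineq[of x e] by simp

text \<open>Writing an odd negative power of \<open>\<bar>s\<bar>\<close> as a real power of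
  \<open>s\<^sup>2\<close> keeps it visibly smooth for nonzero \<open>s\<close>.\<close>

lemma square_powr_half_odd:
  assumes "(a::real) > 0"
  shows "(a\<^sup>2) powr (- (real k + 3/2)) = (1 / a) ^ (2 * k + 3)"
proof -
  have "a powr (- real N) = (1 / a) ^ N" for N
    using assms by (simp add: powr_minus_divide powr_realpow power_one_over)
  from this[of "2 * k + 3"] have "(1 / a) ^ (2 * k + 3) = a powr (- real (2 * k + 3))" ..
  also have "- real (2 * k + 3) = 2 * (- (real k + 3/2))" by simp
  also have "a powr \<dots> = (a powr 2) powr (- (real k + 3/2))"
    by (simp only: powr_powr)
  also have "a powr 2 = a\<^sup>2"
    using assms by simp
  finally show ?thesis by simp
qed

text \<open>Let \<open>s\<close> be \<open>\<bar>x \<bullet> e\<bar>\<close> and \<open>y\<close>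
  the distance from the axis. Where both are positive, \<open>X k (y\<^sup>2 / s\<^sup>2)\<close> is
  \<open>(s / y) ^ (2 * k + 3)\<close> times the profile at \<open>s / y\<close>. The singular power
  of \<open>s\<close> cancels, and what remains is smooth across the equator. The open sets
  \<open>A\<close> and \<open>B\<close> cover everything but the origin.\<close>

lemma zonal_extension_smooth:
  fixes e :: "'a::euclidean_space" and k :: nat
  assumes e: "e \<in> Basis" and X: "derivative_tower {0..} X"
    and p: "smooth_on UNIV p" "\<And>r. p (- r) = p r"
    and Xp: "\<And>x. x > 0 \<Longrightarrow> X 0 x = (1 / sqrt x) ^ 3 * p (1 / sqrt x)"
  defines "y2 \<equiv> \<lambda>x. x \<bullet> x - (x \<bullet> e)\<^sup>2" and "q \<equiv> - (real k + 3/2)"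
  defines "h \<equiv> \<lambda>x. if x \<bullet> e \<noteq> 0 then ((x \<bullet> e)\<^sup>2) powr q * X k (y2 x / (x \<bullet> e)\<^sup>2)
      else y2 x powr q * profile_at_infinity p k 0"
  shows "smooth_on (UNIV - {0}) h"
proof -
  let ?K = "profile_at_infinity p k"
  define A B where "A = {x. x \<bullet> e \<noteq> 0}" and "B = {x. y2 x > 0}"
  have y20: "y2 x \<ge> 0" for x using inner_self_ge_inner_Basis_sq[OF e] by (simp add: y2_def)
  have oA: "open A" unfolding A_def by (intro open_Collect_neq continuous_intros)
  have oB: "open B" unfolding B_def y2_def by (intro open_Collect_less continuous_intros)
  have AB: "UNIV - {0} = A \<union> B"
  proof -
    have "x = 0" if "x \<bullet> e = 0" "\<not> y2 x > 0" for x
      using that by (simp add: y2_def)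
    then show ?thesis by (auto simp: A_def B_def y2_def)
  qed
  have s: "smooth_on S (\<lambda>x. x \<bullet> e)" if "open S" for S
    by (rule smooth_on_bounded_linear[OF that bounded_linear_inner_left])
  have s2: "smooth_on S (\<lambda>x. (x \<bullet> e)\<^sup>2)" if "open S" for S
    unfolding power2_eq_square by (intro smooth_on_mult s that)
  have sy: "smooth_on S y2" if "open S" for S
  proof -
    have "smooth_on S (\<lambda>x. x \<bullet> x + (-1) * (x \<bullet> e)\<^sup>2)"
      by (intro smooth_on_add smooth_on_mult smooth_on_const smooth_on_inner_self s2 that)
    then show ?thesis by (simp add: y2_def)
  qed
  have "smooth_on A h"
  proof (rule smooth_on_cong[OF oA])
    have pos: "(x \<bullet> e)\<^sup>2 > 0" if "x \<in> A" for x using that by (simp add: A_def)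
    have "smooth_on A (\<lambda>x. y2 x * ((x \<bullet> e)\<^sup>2) powr (-1))"
      by (intro smooth_on_mult sy smooth_on_powr s2 oA pos)
    \<comment> \<open>On the axis the argument of \<open>X k\<close> is 0, the endpoint of its
      domain; this is where a tower on \<open>{0..}\<close> is essential.\<close>
    then have "smooth_on A (\<lambda>x. X k (y2 x * ((x \<bullet> e)\<^sup>2) powr (-1)))"
      using smooth_on_compose_tower[OF oA _ _ X, of "\<lambda>x. y2 x * ((x \<bullet> e)\<^sup>2) powr (-1)"] y20 by simp
    then show "smooth_on A (\<lambda>x. ((x \<bullet> e)\<^sup>2) powr q * X k (y2 x * ((x \<bullet> e)\<^sup>2) powr (-1)))"
      by (intro smooth_on_mult smooth_on_powr s2 oA pos)
    show "((x \<bullet> e)\<^sup>2) powr q * X k (y2 x * ((x \<bullet> e)\<^sup>2) powr (-1)) = h x" if "x \<in> A" for x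
      using pos[OF that] that by (simp add: h_def A_def powr_minus_divide)
  qed
  moreover have "smooth_on B h"
  proof (rule smooth_on_cong[OF oB])
    have pos: "y2 x > 0" if "x \<in> B" for x using that by (simp add: B_def)
    obtain F where F: "derivative_tower UNIV F" "F 0 = (\<lambda>t. ?K (0 + t *\<^sub>R 1))"
      using smooth_on_imp_derivative_tower_line[OF profile_at_infinity_smooth[OF p(1)], of UNIV 0 1 k] by auto
    have "smooth_on B (\<lambda>x. (x \<bullet> e) * y2 x powr (-1/2))"
      by (intro smooth_on_mult sy smooth_on_powr s oB pos)
    then have "smooth_on B (\<lambda>x. ?K ((x \<bullet> e) * y2 x powr (-1/2)))"
      using smooth_on_compose_tower[OF oB _ _ F(1), of "\<lambda>x. (x \<bullet> e) * y2 x powr (-1/2)" 0] F(2) by simp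
    then show "smooth_on B (\<lambda>x. y2 x powr q * ?K ((x \<bullet> e) * y2 x powr (-1/2)))"
      by (intro smooth_on_mult smooth_on_powr sy oB pos)
    show "y2 x powr q * ?K ((x \<bullet> e) * y2 x powr (-1/2)) = h x" if "x \<in> B" for x
    proof (cases "x \<bullet> e = 0")
      case True
      then show ?thesis by (simp add: h_def)
    next
      case False
      define s y where "s = \<bar>x \<bullet> e\<bar>" and "y = sqrt (y2 x)"
      have sy: "s > 0" "y > 0" using False pos[OF that] by (auto simp: s_def y_def)
      have eqs: "(x \<bullet> e)\<^sup>2 = s\<^sup>2" "y2 x = y\<^sup>2" using y20[of x] by (auto simp: s_def y_def)
      have r: "1 / sqrt (y\<^sup>2 / s\<^sup>2) = s / y"
        using sy by (simp add: real_sqrt_divide)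
      have pw: "(a\<^sup>2) powr q = (1 / a) ^ (3 + 2 * k)" if "a > 0" for a
        using square_powr_half_odd[OF that, of k] by (simp add: q_def add.commute)
      have "h x = (s\<^sup>2) powr q * X k (y\<^sup>2 / s\<^sup>2)"
        using False by (simp add: h_def eqs)
      also have "X k (y\<^sup>2 / s\<^sup>2) = (s / y) ^ (3 + 2 * k) * ?K (s / y)"
        using derivative_tower_profile[OF p(1) X Xp, of "y\<^sup>2 / s\<^sup>2" k] sy unfolding r by simp
      also have "(s\<^sup>2) powr q * ((s / y) ^ (3 + 2 * k) * ?K (s / y)) = (1 / y) ^ (3 + 2 * k) * ?K (s / y)"
        using sy unfolding pw[OF sy(1)] by (simp add: power_divide)
      \<comment> \<open>The profile is even, so \<open>s\<close> may be replaced by the signed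
        coordinate.\<close>
      also have "?K (s / y) = ?K ((x \<bullet> e) * y2 x powr (-1/2))"
      proof -
        have "y2 x powr (-1/2) = 1 / y"
          using pos[OF that] by (simp add: y_def powr_minus_divide powr_half_sqrt)
        then show ?thesis
          using profile_at_infinity_even[OF p, of k "(x \<bullet> e) / y"] by (simp add: s_def abs_if)
      qed
      finally show ?thesis using pw[OF sy(2)] eqs by simp
    qed
  qed
  ultimately show ?thesis unfolding AB by (rule smooth_on_Un[OF oA oB])
qed

text \<open>Transform and \<open>f\<close> agree on the line of directions
  \<open>e' + t *\<^sub>R e\<close>. Both are homogeneous and invariant under maps fixing
  \<open>e\<close>, which extends the equality to all directions off the axis; the axis follows by
  continuity.\<close>

lemma cosine_transform_zonal_surj:
  fixes e e' :: "'a::euclidean_space" and f :: "'a \<Rightarrow> real"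
  assumes e: "e \<in> Basis" "e' \<in> Basis" "e \<noteq> e'" and d: "DIM('a) = 2 * Suc k" "k \<ge> 1"
    and f: "smooth_on (UNIV - {0}) f" "rotationally_symmetric e f"
      "\<And>c x. f (c *\<^sub>R x) = \<bar>c\<bar> * f x"
  obtains g where "g \<in> even_smooth_sphere" "cosine_transform g = restrict f (sphere 0 1)"
    and "\<And>v. v \<in> sphere 0 1 \<Longrightarrow> 0 < v \<bullet> e \<Longrightarrow> v \<bullet> e < 1 \<Longrightarrow>
      g v = inversion_constant k * (1 / (v \<bullet> e)) ^ (2 * k + 3) *
        (deriv ^^ k) (\<lambda>t. deriv (deriv (\<lambda>t. f (e' + t *\<^sub>R e))) (sqrt t)) ((1 - (v \<bullet> e)\<^sup>2) / (v \<bullet> e)\<^sup>2)"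
proof -
  have ee: "e \<bullet> e = 1" "e' \<bullet> e' = 1" "e \<bullet> e' = 0" "e' \<bullet> e = 0"
    using e by (auto simp: inner_Basis)
  have nz: "e' + t *\<^sub>R e \<noteq> 0" "e + t *\<^sub>R e' \<noteq> 0" for t
  proof -
    have "(e' + t *\<^sub>R e) \<bullet> e' = 1" "(e + t *\<^sub>R e') \<bullet> e = 1"
      by (simp_all add: inner_add_left ee)
    then show "e' + t *\<^sub>R e \<noteq> 0" "e + t *\<^sub>R e' \<noteq> 0" by auto
  qed
  obtain P where P: "derivative_tower UNIV P" "P 0 = (\<lambda>t. f (e' + t *\<^sub>R e))"
    by (rule smooth_on_imp_derivative_tower_line[OF f(1), of UNIV e' e]) (use nz in auto)
  obtain Q where Q: "derivative_tower UNIV Q" "Q 0 = (\<lambda>t. f (e + t *\<^sub>R e'))"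
    by (rule smooth_on_imp_derivative_tower_line[OF f(1), of UNIV e e']) (use nz in auto)
  have refl: "f (reflection e' x) = f x" for x
    by (rule rotationally_symmetricD[OF f(2) orthogonal_transformation_reflection])
      (simp add: reflection_fixes ee)
  have f_neg: "f (- x) = f x" for x using f(3)[of "-1" x] by simp
  \<comment> \<open>Central symmetry followed by the reflection along \<open>e'\<close> reverses
    only the coordinate along \<open>e\<close>, and \<open>f\<close> is invariant under
    both.\<close>
  have Peven: "P 0 (- t) = P 0 t" for t
  proof -
    have "P 0 (- t) = f (- (e' - t *\<^sub>R e))"
      using f_neg[of "e' - t *\<^sub>R e"] by (simp add: P(2))
    also have "- (e' - t *\<^sub>R e) = e' + t *\<^sub>R e - 2 *\<^sub>R e'"
      by (simp add: scaleR_2)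
    also have "\<dots> = reflection e' (e' + t *\<^sub>R e)"
      by (simp add: reflection_def inner_add_left ee)
    finally show ?thesis by (simp add: refl P(2))
  qed
  have Qeven: "Q 0 (- t) = Q 0 t" for t
  proof -
    have "reflection e' (e + t *\<^sub>R e') = e + t *\<^sub>R e' - (2 * t) *\<^sub>R e'"
      by (simp add: reflection_def inner_add_left ee)
    also have "\<dots> = e + (t - 2 * t) *\<^sub>R e'"
      by (simp only: scaleR_left_diff_distrib add_diff_eq)
    finally have "e + (- t) *\<^sub>R e' = reflection e' (e + t *\<^sub>R e')" by simp
    then show ?thesis by (simp add: refl Q(2))
  qed
  have PQ: "P 0 a = a * Q 0 (1 / a)" if "a > 0" for a
    using f(3)[of a "e + (1 / a) *\<^sub>R e'"] that by (simp add: P(2) Q(2) scaleR_add_right add.commute)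
  \<comment> \<open>The tower is shifted by two so that the function rewritten in terms of the
    square is the second derivative.\<close>
  have "derivative_tower UNIV (\<lambda>j. P (j + 2))"
    using P(1) by (simp add: derivative_tower_def)
  then obtain X where X: "derivative_tower {0..} X" "\<And>x. X 0 x = P 2 (sqrt x)"
    using even_function_of_square[of "\<lambda>j. P (j + 2)"] derivative_tower_even(2)[OF P(1) Peven]
    by (auto simp: numeral_2_eq_2)
  have p: "smooth_on UNIV (Q 2)" "\<And>r. Q 2 (- r) = Q 2 r"
    using derivative_tower_imp_smooth_on[OF Q(1)] derivative_tower_even(2)[OF Q(1) Qeven] by auto
  have Xp: "X 0 x = (1 / sqrt x) ^ 3 * Q 2 (1 / sqrt x)" if "x > 0" for x
    using derivative_inversion(2)[OF P(1) Q(1) PQ, of "sqrt x"] that X(2) by simp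
  \<comment> \<open>By the profile formula \<open>x ^ j * X j x\<close> is
    \<open>(1 / sqrt x) ^ 3\<close> times a factor that converges as \<open>x\<close> grows.\<close>
  have lim: "((\<lambda>x. x ^ j * X j x) \<longlongrightarrow> 0) at_top" for j
  proof -
    let ?K = "profile_at_infinity (Q 2) j"
    have "((\<lambda>x. 1 / sqrt x) \<longlongrightarrow> 0) at_top"
      using tendsto_inverse_0_at_top[OF sqrt_at_top] by (simp add: inverse_eq_divide)
    moreover have "isCont ?K 0"
      using smooth_on_deriv(1)[OF profile_at_infinity_smooth[OF p(1)]] DERIV_isCont by blast
    ultimately have "((\<lambda>x. (1 / sqrt x) ^ 3 * ?K (1 / sqrt x)) \<longlongrightarrow> 0 ^ 3 * ?K 0) at_top"
      by (intro tendsto_intros isCont_tendsto_compose[of 0 ?K])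
    then have "((\<lambda>x. (1 / sqrt x) ^ 3 * ?K (1 / sqrt x)) \<longlongrightarrow> 0) at_top" by simp
    then show ?thesis
    proof (rule Lim_transform_eventually)
      show "\<forall>\<^sub>F x in at_top. (1 / sqrt x) ^ 3 * ?K (1 / sqrt x) = x ^ j * X j x"
        using eventually_gt_at_top[of 0]
      proof eventually_elim
        case (elim x)
        have one: "x ^ j * (1 / sqrt x) ^ (2 * j) = 1"
          using elim by (simp add: power_mult power_divide)
        have prof: "X j x = (1 / sqrt x) ^ (3 + 2 * j) * ?K (1 / sqrt x)"
          by (rule derivative_tower_profile[OF p(1) X(1) _ elim]) (rule Xp)
        have "x ^ j * X j x = (x ^ j * (1 / sqrt x) ^ (2 * j)) * ((1 / sqrt x) ^ 3 * ?K (1 / sqrt x))"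
          unfolding prof power_add by (simp only: mult_ac)
        then show ?case unfolding one by simp
      qed
    qed
  qed
  define c where "c = inversion_constant k"
  define q where "q = - (real k + 3/2)"
  \<comment> \<open>The extension of the candidate that is homogeneous of degree
    \<open>- (2 * k + 3)\<close>; the second branch holds its values on the equatorial hyperplane,
    read off from the profile at 0.\<close>
  define h where "h x = c * (if x \<bullet> e \<noteq> 0 then ((x \<bullet> e)\<^sup>2) powr q * X k ((x \<bullet> x - (x \<bullet> e)\<^sup>2) / (x \<bullet> e)\<^sup>2)
      else (x \<bullet> x - (x \<bullet> e)\<^sup>2) powr q * profile_at_infinity (Q 2) k 0)" for x
  have sm: "smooth_on (UNIV - {0}) h"
    unfolding h_def[abs_def] q_def
    by (intro smooth_on_mult smooth_on_const zonal_extension_smooth[OF e(1) X(1) p Xp]) auto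
  define g where "g = restrict h (sphere 0 1)"
  have gS: "g \<in> even_smooth_sphere"
    unfolding even_smooth_sphere_def
  proof (intro CollectI conjI ballI exI)
    show "g (- v) = g v" if "v \<in> sphere 0 1" for v
      using that by (simp add: g_def h_def)
    show "open (UNIV - {0::'a})" "sphere 0 1 \<subseteq> UNIV - {0::'a}" "smooth_on (UNIV - {0}) h"
      using sm by auto
  qed (auto simp: g_def)
  have gc: "continuous_on (sphere 0 1) g"
  proof -
    have "continuous_on (sphere 0 1) h"
      by (rule continuous_on_subset[OF smooth_on_imp_continuous_on[OF sm]]) auto
    then show ?thesis by (rule continuous_on_eq) (simp add: g_def)
  qed
  have gX: "g v = c * (1 / \<bar>v \<bullet> e\<bar>) ^ (2 * k + 3) * X k ((1 - (v \<bullet> e)\<^sup>2) / (v \<bullet> e)\<^sup>2)"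
    if v: "v \<in> sphere 0 1" "v \<bullet> e \<noteq> 0" for v
  proof -
    have "((v \<bullet> e)\<^sup>2) powr q = (1 / \<bar>v \<bullet> e\<bar>) ^ (2 * k + 3)"
      using square_powr_half_odd[of "\<bar>v \<bullet> e\<bar>" k] v by (simp add: q_def)
    moreover have "v \<bullet> v = 1" using v by (simp add: norm_eq_1)
    ultimately show ?thesis using v by (simp add: g_def h_def)
  qed
  define T where "T u = (LINT v|sphere_measure. \<bar>u \<bullet> v\<bar> * g v)" for u
  have T0: "T (e' + t *\<^sub>R e) = f (e' + t *\<^sub>R e)" for t
    using cosine_transform_of_tower[OF e d gc gX[unfolded c_def] X lim P(1) Peven Q(1) Qeven PQ]
    by (simp add: T_def P(2))
  have Tscale: "T (a *\<^sub>R u) = \<bar>a\<bar> * T u" for a u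
    unfolding T_def by (rule cosine_kernel_scaleR)
  have T_orth: "T (U u) = T u" if U: "orthogonal_transformation U" "U e = e" for U u
  proof -
    have Uip: "U v \<bullet> U w = v \<bullet> w" for v w using U by (simp add: orthogonal_transformation_def)
    have "g (U v) = g v" if "v \<in> sphere 0 1" for v
    proof -
      have "U v \<bullet> e = v \<bullet> e" using Uip[of v e] U(2) by simp
      moreover have "U v \<in> sphere 0 1" using that U by (simp add: orthogonal_transformation)
      ultimately show ?thesis using that by (simp add: g_def h_def Uip)
    qed
    then have "T u = (LINT v|sphere_measure. \<bar>u \<bullet> v\<bar> * g (U v))"
      unfolding T_def by (intro Bochner_Integration.integral_cong) (auto simp: space_sphere_measure)
    then show ?thesis
      unfolding T_def using cosine_kernel_orthogonal[OF U(1) gc] by simp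
  qed
  \<comment> \<open>Off the axis, \<open>u\<close> is a positive multiple of
    \<open>w + t *\<^sub>R e\<close> with \<open>w\<close> a unit vector orthogonal to
    \<open>e\<close>. The reflection exchanging \<open>w\<close> and \<open>e'\<close> fixes
    \<open>e\<close> and leads back to \<open>T0\<close>.\<close>
  have Tf1: "T u = f u" if "u \<noteq> (u \<bullet> e) *\<^sub>R e" for u
  proof -
    define y where "y = u - (u \<bullet> e) *\<^sub>R e"
    define w where "w = (1 / norm y) *\<^sub>R y"
    define t where "t = (u \<bullet> e) / norm y"
    have y: "norm y > 0" using that by (simp add: y_def)
    have u: "u = norm y *\<^sub>R (w + t *\<^sub>R e)"
      using y by (simp add: w_def t_def scaleR_add_right y_def)
    have we: "w \<bullet> e = 0" by (simp add: w_def y_def inner_diff_left ee)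
    have nw: "norm w = norm e'" using y e by (simp add: w_def)
    let ?U = "reflection (w - e')"
    have U: "orthogonal_transformation ?U" by (rule orthogonal_transformation_reflection)
    have Ue: "?U e = e"
      by (rule reflection_fixes) (simp add: inner_diff_right ee inner_commute[of e w] we)
    have "?U (w + t *\<^sub>R e) = ?U w + t *\<^sub>R ?U e"
      using orthogonal_transformation_linear[OF U] by (simp add: linear_add linear_cmul)
    also have "\<dots> = e' + t *\<^sub>R e" by (simp add: Ue reflection_swaps[OF nw])
    finally have Uw: "?U (w + t *\<^sub>R e) = e' + t *\<^sub>R e" .
    have "f (w + t *\<^sub>R e) = f (e' + t *\<^sub>R e)"
      using rotationally_symmetricD[OF f(2) U Ue] Uw by metis
    moreover have "T (w + t *\<^sub>R e) = T (e' + t *\<^sub>R e)"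
      using T_orth[OF U Ue] Uw by metis
    ultimately show ?thesis
      by (subst (1 2) u) (simp only: Tscale f(3) T0)
  qed
  \<comment> \<open>The pole is not on any of these lines; it is approached along
    \<open>e + r *\<^sub>R e'\<close>.\<close>
  have Te: "T e = f e"
  proof (rule tendsto_unique[of "at_right (0::real)"])
    have L: "((\<lambda>r. e + r *\<^sub>R e') \<longlongrightarrow> e + 0 *\<^sub>R e') (at_right 0)"
      by (intro tendsto_intros)
    have "isCont T e"
      using continuous_on_cosine_kernel[OF gc] by (simp add: T_def[abs_def] continuous_on_eq_continuous_at)
    then show "((\<lambda>r. T (e + r *\<^sub>R e')) \<longlongrightarrow> T e) (at_right 0)"
      using isCont_tendsto_compose[of e T] L by simp
    have "isCont f e"
      using smooth_on_imp_continuous_on[OF f(1)] nonzero_Basis[OF e(1)]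
        continuous_on_eq_continuous_at[OF open_delete[OF open_UNIV], of 0 f] by simp
    then have "((\<lambda>r. f (e + r *\<^sub>R e')) \<longlongrightarrow> f e) (at_right 0)"
      using isCont_tendsto_compose[of e f] L by simp
    then show "((\<lambda>r. T (e + r *\<^sub>R e')) \<longlongrightarrow> f e) (at_right 0)"
    proof (rule Lim_transform_eventually)
      show "\<forall>\<^sub>F r in at_right 0. f (e + r *\<^sub>R e') = T (e + r *\<^sub>R e')"
        using eventually_at_right_less[of 0]
      proof eventually_elim
        case (elim r)
        have "(e + r *\<^sub>R e') \<bullet> e' \<noteq> (((e + r *\<^sub>R e') \<bullet> e) *\<^sub>R e) \<bullet> e'"
          using elim by (simp add: inner_add_left ee)
        then show ?case using Tf1 by metis
      qed
    qed
  qed simp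
  have "cosine_transform g = restrict f (sphere 0 1)"
  proof
    fix u :: 'a
    show "cosine_transform g u = restrict f (sphere 0 1) u"
    proof (cases "u \<in> sphere 0 1")
      case True
      have "T u = f u"
      proof (cases "u = (u \<bullet> e) *\<^sub>R e")
        case True
        then show ?thesis using Tscale[of "u \<bullet> e" e] f(3)[of "u \<bullet> e" e] Te by metis
      qed (rule Tf1)
      then show ?thesis using True by (simp add: cosine_transform_def T_def)
    qed (simp add: cosine_transform_def)
  qed
  moreover have "g v = inversion_constant k * (1 / (v \<bullet> e)) ^ (2 * k + 3) *
        (deriv ^^ k) (\<lambda>t. deriv (deriv (\<lambda>t. f (e' + t *\<^sub>R e))) (sqrt t)) ((1 - (v \<bullet> e)\<^sup>2) / (v \<bullet> e)\<^sup>2)"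
    if v: "v \<in> sphere 0 1" "0 < v \<bullet> e" "v \<bullet> e < 1" for v
  proof -
    have D: "deriv (P j) = P (Suc j)" for j
      using derivative_towerD[OF P(1)] by (auto simp: fun_eq_iff intro!: DERIV_imp_deriv)
    \<comment> \<open>An equality of functions on the whole line, negative arguments included, so
      that iterated \<open>deriv\<close> can be applied to both sides.\<close>
    have "(\<lambda>t. deriv (deriv (\<lambda>t. f (e' + t *\<^sub>R e))) (sqrt t)) = X 0"
      using X(2) by (simp add: fun_eq_iff D numeral_2_eq_2 flip: P(2))
    moreover have "(1 - (v \<bullet> e)\<^sup>2) / (v \<bullet> e)\<^sup>2 > 0"
      using v by (simp add: power_less_one_iff abs_square_less_1)
    ultimately show ?thesis
      using gX[of v] v higher_deriv_tower[OF X(1)] by (simp add: c_def)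
  qed
  ultimately show thesis using that gS by blast
qed

section \<open>Injectivity\<close>

lemma measurable_sphere_ident [measurable]: "(\<lambda>v::'a::euclidean_space. v) \<in> sphere_measure \<rightarrow>\<^sub>M borel"
  by (simp add: measurable_restrict_space1 sets_sphere_measure cong: measurable_cong_sets)

text \<open>Fubini for a symmetric kernel; the integrand is bounded and the measure finite.\<close>

lemma cosine_kernel_self_adjoint:
  fixes g h :: "'a::euclidean_space \<Rightarrow> real"
  assumes g: "continuous_on (sphere 0 1) g" and h: "continuous_on (sphere 0 1) h"
  shows "(LINT v|sphere_measure. g v * (LINT u|sphere_measure. \<bar>v \<bullet> u\<bar> * h u)) =
    (LINT u|sphere_measure. (LINT v|sphere_measure. \<bar>u \<bullet> v\<bar> * g v) * h u)"
proof -
  let ?S = "sphere_measure :: 'a measure"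
  interpret S: finite_measure ?S by (rule finite_measure_sphere)
  interpret SS: pair_sigma_finite ?S ?S ..
  have bdd: "\<exists>B. \<forall>v\<in>sphere 0 1. \<bar>F v\<bar> \<le> B" if "continuous_on (sphere 0 1) F" for F :: "'a \<Rightarrow> real"
    using compact_imp_bounded[OF compact_continuous_image[OF that compact_sphere]]
    by (auto simp: bounded_iff)
  obtain A B where A: "\<And>v. v \<in> sphere 0 1 \<Longrightarrow> \<bar>g v\<bar> \<le> A" and B: "\<And>v. v \<in> sphere 0 1 \<Longrightarrow> \<bar>h v\<bar> \<le> B"
    using bdd[OF g] bdd[OF h] by blast
  have [measurable]: "g \<in> borel_measurable ?S" "h \<in> borel_measurable ?S"
    by (rule borel_measurable_sphere_continuous; fact)+
  have fin: "finite_measure (?S \<Otimes>\<^sub>M ?S)"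
    by (rule finite_measure_pair_measure) (rule finite_measure_sphere)+
  have "integrable (?S \<Otimes>\<^sub>M ?S) (\<lambda>(v, u). g v * (\<bar>v \<bullet> u\<bar> * h u))"
  proof (rule finite_measure.integrable_const_bound[OF fin, of _ "A * B"])
    show "(\<lambda>(v, u). g v * (\<bar>v \<bullet> u\<bar> * h u)) \<in> borel_measurable (?S \<Otimes>\<^sub>M ?S)"
      by measurable
    show "AE p in ?S \<Otimes>\<^sub>M ?S. norm (case p of (v, u) \<Rightarrow> g v * (\<bar>v \<bullet> u\<bar> * h u)) \<le> A * B"
    proof (rule AE_I2)
      fix p assume "p \<in> space (?S \<Otimes>\<^sub>M ?S)"
      then obtain v u where p: "p = (v, u)" "v \<in> sphere 0 1" "u \<in> sphere 0 1"
        by (auto simp: space_pair_measure space_sphere_measure)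
      have "\<bar>v \<bullet> u\<bar> \<le> 1" using Cauchy_Schwarz_ineq2[of v u] p by simp
      then have "\<bar>v \<bullet> u\<bar> * \<bar>h u\<bar> \<le> 1 * B"
        using B[OF p(3)] by (intro mult_mono) auto
      then have "\<bar>g v\<bar> * (\<bar>v \<bullet> u\<bar> * \<bar>h u\<bar>) \<le> A * (1 * B)"
        using A[OF p(2)] by (intro mult_mono[of "\<bar>g v\<bar>" A]) auto
      then show "norm (case p of (v, u) \<Rightarrow> g v * (\<bar>v \<bullet> u\<bar> * h u)) \<le> A * B"
        by (simp add: p abs_mult)
    qed
  qed
  then have "(LINT u|?S. LINT v|?S. g v * (\<bar>v \<bullet> u\<bar> * h u)) = (LINT v|?S. LINT u|?S. g v * (\<bar>v \<bullet> u\<bar> * h u))"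
    by (rule SS.Fubini_integral)
  moreover have "(LINT v|?S. g v * (\<bar>v \<bullet> u\<bar> * h u)) = (LINT v|?S. \<bar>u \<bullet> v\<bar> * g v) * h u" for u
    by (subst integral_mult_left_zero[symmetric]) (simp add: inner_commute mult_ac)
  ultimately show ?thesis by simp
qed

text \<open>The cone over the double cap contains the open set \<open>O'\<close>, which is nonempty
  because it contains half of \<open>p\<close>.\<close>

lemma measure_sphere_cap_pos:
  fixes p :: "'a::euclidean_space"
  assumes "norm p = 1" "0 < r" "r < 1"
  shows "measure sphere_measure {v \<in> sphere 0 1. r < \<bar>v \<bullet> p\<bar>} > 0"
proof -
  interpret finite_measure "sphere_measure :: 'a measure" by (rule finite_measure_sphere)
  let ?C = "{v \<in> sphere 0 1. r < \<bar>v \<bullet> p\<bar>}"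
  define O' where "O' = {x::'a. 0 < norm x \<and> norm x < 1 \<and> r * norm x < \<bar>x \<bullet> p\<bar>}"
  have O: "open O'"
    unfolding O'_def by (intro open_Collect_conj open_Collect_less continuous_intros)
  have "p \<bullet> p = 1" using assms(1) by (simp add: norm_eq_1)
  then have "p /\<^sub>R 2 \<in> O'" using assms by (auto simp: O'_def)
  then have "\<not> negligible O'" using open_not_negligible[OF O] by blast
  then have O_pos: "emeasure lborel O' \<noteq> 0"
    using O by (auto simp: negligible_iff_null_sets null_sets_def)
  have "?C = sphere 0 1 \<inter> {v. r < \<bar>v \<bullet> p\<bar>}" by auto
  moreover have "{v. r < \<bar>v \<bullet> p\<bar>} \<in> sets borel"
    by (intro borel_open open_Collect_less continuous_intros)
  ultimately have C: "?C \<in> sets sphere_measure"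
    by (auto simp: sets_sphere_measure sets_restrict_space)
  have "emeasure lborel O' = (\<integral>\<^sup>+x. indicator O' x \<partial>lborel)"
    using O by simp
  also have "\<dots> \<le> (\<integral>\<^sup>+x. indicator ?C (x /\<^sub>R norm x) * indicator (cball 0 1 - {0}) x \<partial>lborel)"
    by (intro nn_integral_mono) (auto simp: O'_def indicator_def field_simps abs_mult)
  also have "\<dots> = 1 * (\<integral>\<^sup>+x. indicator ?C (x /\<^sub>R norm x) * indicator (cball 0 1 - {0}) x \<partial>lborel)"
    by simp
  also have "\<dots> \<le> of_nat DIM('a) * (\<integral>\<^sup>+x. indicator ?C (x /\<^sub>R norm x) * indicator (cball 0 1 - {0}) x \<partial>lborel)"
    by (intro mult_right_mono) (use DIM_positive[where 'a = 'a] in \<open>simp_all add: Suc_le_eq\<close>)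
  also have "\<dots> = (\<integral>\<^sup>+v. indicator ?C v \<partial>sphere_measure)"
    by (rule nn_integral_sphere_measure[symmetric]) (use C in simp)
  also have "\<dots> = emeasure sphere_measure ?C" using C by simp
  finally have "emeasure lborel O' \<le> ennreal (measure sphere_measure ?C)"
    by (simp only: emeasure_eq_measure)
  then show ?thesis
    using O_pos by (metis ennreal_eq_0_iff le_zero_eq not_le)
qed

text \<open>As \<open>j\<close> grows, \<open>(v \<bullet> p) ^ (2 * j)\<close> concentrates at \<open>\<plusminus>p\<close>.\<close>

lemma even_moments_zero_imp_nonpos:
  fixes D :: "'a::euclidean_space \<Rightarrow> real"
  assumes D: "continuous_on (sphere 0 1) D" "\<And>v. v \<in> sphere 0 1 \<Longrightarrow> D (- v) = D v"
    and p: "norm p = 1"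
    and zero: "\<And>j. j \<ge> 1 \<Longrightarrow> (LINT v|sphere_measure. D v * (v \<bullet> p) ^ (2 * j)) = 0"
  shows "D p \<le> 0"
proof (rule ccontr)
  assume "\<not> D p \<le> 0"
  define c where "c = D p / 2"
  have c: "c > 0" "c < D p" using \<open>\<not> D p \<le> 0\<close> by (auto simp: c_def)
  interpret finite_measure "sphere_measure :: 'a measure" by (rule finite_measure_sphere)
  have "\<exists>d>0. \<forall>v\<in>sphere 0 1. dist v p < d \<longrightarrow> dist (D v) (D p) < D p - c"
    using D(1) c p unfolding continuous_on_iff by auto
  then obtain d0 where d0: "d0 > 0" "\<And>v. v \<in> sphere 0 1 \<Longrightarrow> dist v p < d0 \<Longrightarrow> dist (D v) (D p) < D p - c"
    by blast
  \<comment> \<open>The bound 1 keeps the threshold \<open>q\<close> below positive.\<close>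
  define d where "d = min d0 1"
  have d: "0 < d" "d \<le> 1" using d0 by (auto simp: d_def)
  have near: "c < D v" if "v \<in> sphere 0 1" "dist v p < d" for v
    using d0(2)[of v] that by (auto simp: d_def dist_real_def)
  \<comment> \<open>For unit vectors the squared distance is \<open>2 - 2 * (v \<bullet> p)\<close>,
    so \<open>v \<bullet> p > q\<close> means that \<open>v\<close> is within \<open>d\<close> of
    \<open>p\<close>.\<close>
  define q where "q = 1 - d\<^sup>2 / 2"
  have "d\<^sup>2 \<le> 1" "d\<^sup>2 > 0" using d by (auto simp: power_le_one)
  then have q: "0 < q" "q < 1" by (auto simp: q_def)
  have near1: "c < D v" if v: "v \<in> sphere 0 1" "q < v \<bullet> p" for v
  proof (rule near[OF v(1)])
    have "(dist v p)\<^sup>2 = 2 - 2 * (v \<bullet> p)"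
      using v(1) p by (simp add: dist_norm power2_norm_eq_inner norm_eq_1 inner_diff_left inner_diff_right inner_commute)
    also have "\<dots> < d\<^sup>2" using v(2) by (simp add: q_def)
    finally show "dist v p < d" using d(1) by (simp add: power2_less_imp_less)
  qed
  have near2: "c < D v" if v: "v \<in> sphere 0 1" "q < \<bar>v \<bullet> p\<bar>" for v
  proof (cases "v \<bullet> p \<ge> 0")
    case True
    then show ?thesis using near1 v by simp
  next
    case False
    then have "c < D (- v)" using v by (intro near1) auto
    then show ?thesis using D(2) v by simp
  qed
  \<comment> \<open>A second threshold above \<open>q\<close>: the inner cap has positive measure,
    and powers of \<open>q / r\<close> tend to 0.\<close>
  define r where "r = (1 + q) / 2"
  have r: "q < r" "0 < r" "r < 1" using q by (auto simp: r_def)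
  define C where "C = {v \<in> sphere 0 1. r < \<bar>v \<bullet> p\<bar>}"
  have mC: "measure sphere_measure C > 0"
    unfolding C_def by (rule measure_sphere_cap_pos[OF p r(2,3)])
  have C: "C \<in> sets sphere_measure"
    using mC by (metis less_irrefl measure_notin_sets)
  have "bounded (D ` sphere 0 1)"
    by (intro compact_imp_bounded compact_continuous_image D compact_sphere)
  then obtain M0 where "\<forall>x\<in>D ` sphere 0 1. \<bar>x\<bar> \<le> M0" unfolding bounded_iff by auto
  then obtain M where M: "M \<ge> 0" "\<And>v. v \<in> sphere 0 1 \<Longrightarrow> \<bar>D v\<bar> \<le> M"
    by (metis abs_ge_zero dual_order.trans image_eqI p mem_sphere_0)
  let ?m = "measure sphere_measure (space (sphere_measure :: 'a measure))"
  \<comment> \<open>The integrand is at least \<open>c * r ^ (2 * j)\<close> on the inner double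
    cap, nonnegative between the thresholds, and at least \<open>- M * q ^ (2 * j)\<close>
    elsewhere; its integral is zero.\<close>
  have main: "c * r ^ (2 * j) * measure sphere_measure C \<le> M * q ^ (2 * j) * ?m" if "j \<ge> 1" for j
  proof -
    have "(LINT v|sphere_measure. c * r ^ (2 * j) * indicator C v - M * q ^ (2 * j)) \<le>
        (LINT v|sphere_measure. D v * (v \<bullet> p) ^ (2 * j))"
    proof (rule integral_mono)
      show "integrable sphere_measure (\<lambda>v. c * r ^ (2 * j) * indicator C v - M * q ^ (2 * j))"
        using C by (intro Bochner_Integration.integrable_diff integrable_mult_right)
          (auto simp: integrable_indicator_iff less_top[symmetric])
      show "integrable sphere_measure (\<lambda>v. D v * (v \<bullet> p) ^ (2 * j))"
        by (intro integrable_sphere_continuous continuous_intros D)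
      fix v :: 'a assume "v \<in> space sphere_measure"
      then have v: "v \<in> sphere 0 1" by (simp add: space_sphere_measure)
      have ev: "(v \<bullet> p) ^ (2 * j) = \<bar>v \<bullet> p\<bar> ^ (2 * j)" by (simp add: power_even_abs)
      have ind: "c * r ^ (2 * j) * indicator C v \<le> c * \<bar>v \<bullet> p\<bar> ^ (2 * j)"
        using c r by (auto simp: C_def indicator_def power_mono)
      have Mq: "0 \<le> M * q ^ (2 * j)" using M q by simp
      show "c * r ^ (2 * j) * indicator C v - M * q ^ (2 * j) \<le> D v * (v \<bullet> p) ^ (2 * j)"
      proof (cases "q < \<bar>v \<bullet> p\<bar>")
        case True
        have "c * \<bar>v \<bullet> p\<bar> ^ (2 * j) \<le> D v * \<bar>v \<bullet> p\<bar> ^ (2 * j)"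
          using near2[OF v True] by (intro mult_right_mono) auto
        moreover have "x - m \<le> z" if "x \<le> y" "y \<le> z" "0 \<le> m" for x y z m :: real
          using that by linarith
        ultimately show ?thesis unfolding ev using ind Mq by blast
      next
        case False
        then have "indicator C v = (0::real)" using r by (auto simp: C_def)
        moreover have "\<bar>D v\<bar> * \<bar>v \<bullet> p\<bar> ^ (2 * j) \<le> M * q ^ (2 * j)"
          using M(2)[OF v] False M(1) by (intro mult_mono power_mono) auto
        then have "- (M * q ^ (2 * j)) \<le> D v * \<bar>v \<bullet> p\<bar> ^ (2 * j)"
          by (smt (verit) abs_mult_pos minus_mult_left mult_right_mono zero_le_power abs_ge_zero)
        ultimately show ?thesis unfolding ev by simp
      qed
    qed
    moreover have "(LINT v|sphere_measure. c * r ^ (2 * j) * indicator C v - M * q ^ (2 * j)) =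
        c * r ^ (2 * j) * measure sphere_measure C - M * q ^ (2 * j) * ?m"
    proof -
      have "integrable sphere_measure (\<lambda>v. c * r ^ (2 * j) * indicator C v :: real)"
        using C by (intro integrable_mult_right) (auto simp: integrable_indicator_iff less_top[symmetric])
      then have "(LINT v|sphere_measure. c * r ^ (2 * j) * indicator C v - M * q ^ (2 * j)) =
         (LINT v|sphere_measure. c * r ^ (2 * j) * indicator C v) - (LINT v|(sphere_measure :: 'a measure). M * q ^ (2 * j))"
        by (intro Bochner_Integration.integral_diff) auto
      then show ?thesis using C by (simp add: mult.commute)
    qed
    ultimately show ?thesis using zero[OF that] by simp
  qed
  have ineq: "c * measure sphere_measure C \<le> M * ?m * ((q / r)\<^sup>2) ^ j" if "j \<ge> 1" for j
  proof -
    have "r ^ (2 * j) > 0" using r by simp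
    then have "c * measure sphere_measure C \<le> M * q ^ (2 * j) * ?m / r ^ (2 * j)"
      using main[OF that] by (simp add: pos_le_divide_eq mult.commute mult.left_commute)
    moreover have "((q / r)\<^sup>2) ^ j = q ^ (2 * j) / r ^ (2 * j)"
      by (simp only: power_mult power_divide)
    ultimately show ?thesis by (simp add: mult_ac)
  qed
  have "(\<lambda>j. M * ?m * ((q / r)\<^sup>2) ^ j) \<longlonglongrightarrow> M * ?m * 0"
    using q r by (intro tendsto_intros LIMSEQ_realpow_zero) (auto simp: power_less_one_iff abs_square_less_1)
  then have "c * measure sphere_measure C \<le> M * ?m * 0"
    using ineq by (intro LIMSEQ_le_const) auto
  then show False using c mC by (simp add: mult_le_0_iff)
qed

lemma even_smooth_sphereD:
  assumes "g \<in> even_smooth_sphere"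
  shows "continuous_on (sphere 0 1) g" "v \<in> sphere 0 1 \<Longrightarrow> g (- v) = g v"
    "g \<in> extensional (sphere 0 1)"
proof -
  obtain W h where h: "sphere 0 1 \<subseteq> W" "smooth_on W h" "\<And>v. v \<in> sphere 0 1 \<Longrightarrow> h v = g v"
    using assms unfolding even_smooth_sphere_def by blast
  show "continuous_on (sphere 0 1) g"
    by (rule continuous_on_eq[OF continuous_on_subset[OF smooth_on_imp_continuous_on[OF h(2)] h(1)]])
      (use h(3) in auto)
qed (use assms in \<open>auto simp: even_smooth_sphere_def\<close>)

text \<open>If the difference \<open>D\<close> is annihilated by the transform, self-adjointness
  makes it orthogonal to everything in the range. Powers of \<open>v \<bullet> p\<close> in that
  range suffice to force \<open>D p = 0\<close>.\<close>

lemma inj_on_cosine_transform: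
  fixes e e' :: "'a::euclidean_space"
  assumes e: "e \<in> Basis" "e' \<in> Basis" "e \<noteq> e'" and d: "DIM('a) = 2 * Suc k" "k \<ge> 1"
  shows "inj_on cosine_transform (even_smooth_sphere :: ('a \<Rightarrow> real) set)"
proof (rule inj_onI)
  fix g1 g2 :: "'a \<Rightarrow> real"
  assume g: "g1 \<in> even_smooth_sphere" "g2 \<in> even_smooth_sphere"
    and eq: "cosine_transform g1 = cosine_transform g2"
  define D where "D v = g1 v - g2 v" for v
  have cD: "continuous_on (sphere 0 1) D"
    unfolding D_def by (intro continuous_intros even_smooth_sphereD g)
  have TD: "(LINT v|sphere_measure. \<bar>u \<bullet> v\<bar> * D v) = 0" if "u \<in> sphere 0 1" for u
  proof -
    have "(LINT v|sphere_measure. \<bar>u \<bullet> v\<bar> * D v) =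
        (LINT v|sphere_measure. \<bar>u \<bullet> v\<bar> * g1 v) - (LINT v|sphere_measure. \<bar>u \<bullet> v\<bar> * g2 v)"
      unfolding D_def right_diff_distrib
      by (intro Bochner_Integration.integral_diff integrable_cosine_kernel even_smooth_sphereD g)
    also have "\<dots> = 0"
      using fun_cong[OF eq, of u] that by (simp add: cosine_transform_def)
    finally show ?thesis .
  qed
  have moment: "(LINT v|sphere_measure. D v * (v \<bullet> p) ^ (2 * j)) = 0" if p: "norm p = 1" and j: "j \<ge> 1" for p j
  proof -
    \<comment> \<open>Preimages are constructed for coordinate axes only; exchanging
      \<open>e\<close> and \<open>p\<close> moves the general axis onto \<open>e\<close>.\<close>
    let ?U = "reflection (e - p)"
    have U: "orthogonal_transformation ?U" by (rule orthogonal_transformation_reflection)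
    have Ue: "?U e = p" using e(1) p by (intro reflection_swaps) simp
    \<comment> \<open>The extension of \<open>(v \<bullet> e) ^ (2 * j)\<close> from the sphere that
      is homogeneous of degree 1: the second factor is the norm to the power
      \<open>1 - 2 * j\<close>.\<close>
    define f where "f x = (x \<bullet> e) ^ (2 * j) * (x \<bullet> x) powr (1 / 2 - real j)" for x :: 'a
    have pow: "smooth_on (UNIV - {0}) (\<lambda>x::'a. (x \<bullet> e) ^ i)" for i
      by (induction i) (auto intro!: smooth_on_mult smooth_on_const
          smooth_on_bounded_linear[OF _ bounded_linear_inner_left])
    have "smooth_on (UNIV - {0}) f"
      unfolding f_def
      by (intro smooth_on_mult pow smooth_on_powr smooth_on_inner_self) auto
    moreover have "rotationally_symmetric e f"
      unfolding rotationally_symmetric_def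
    proof (intro allI impI, elim conjE)
      fix V :: "'a \<Rightarrow> 'a" assume V: "orthogonal_transformation V" "V e = e"
      then have "V x \<bullet> e = x \<bullet> e" "V x \<bullet> V x = x \<bullet> x" for x
        by (metis orthogonal_transformation_def)+
      then show "f \<circ> V = f" by (auto simp: f_def)
    qed
    moreover have "f (c *\<^sub>R x) = \<bar>c\<bar> * f x" for c x
    proof (cases "c = 0")
      case False
      have "(c\<^sup>2) powr (1 / 2 - real j) = \<bar>c\<bar> powr (1 - 2 * real j)"
      proof -
        have "c\<^sup>2 = \<bar>c\<bar> powr 2" using False by simp
        then show ?thesis by (simp only: powr_powr) (simp add: algebra_simps)
      qed
      also have "\<dots> = \<bar>c\<bar> / \<bar>c\<bar> powr real (2 * j)"
        using False by (simp add: powr_diff)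
      also have "\<bar>c\<bar> powr real (2 * j) = \<bar>c\<bar> ^ (2 * j)"
        using False by (subst powr_realpow) auto
      finally have "c ^ (2 * j) * (c\<^sup>2) powr (1 / 2 - real j) = \<bar>c\<bar>"
        using False by (simp add: power_even_abs)
      moreover have "f (c *\<^sub>R x) = (c ^ (2 * j) * (c\<^sup>2) powr (1 / 2 - real j)) * f x"
        by (simp add: f_def power_mult_distrib powr_mult power2_eq_square[symmetric] mult_ac flip: mult.assoc[of c c])
      ultimately show ?thesis by simp
    qed (use j in \<open>simp add: f_def power_0_left\<close>)
    ultimately obtain h where h: "h \<in> even_smooth_sphere" "cosine_transform h = restrict f (sphere 0 1)"
      using cosine_transform_zonal_surj[OF e d] by metis
    have Th: "(LINT u|sphere_measure. \<bar>v \<bullet> u\<bar> * h u) = (v \<bullet> e) ^ (2 * j)" if "v \<in> sphere 0 1" for v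
      using fun_cong[OF h(2), of v] that by (simp add: cosine_transform_def f_def norm_eq_1)
    have ch: "continuous_on (sphere 0 1) h" using even_smooth_sphereD h by blast
    have cDU: "continuous_on (sphere 0 1) (\<lambda>v. D (?U v))"
      by (rule continuous_on_compose2[OF cD orthogonal_transformation_continuous_on[OF U]])
        (use U in \<open>auto simp: orthogonal_transformation\<close>)
    have "(LINT v|sphere_measure. D v * (v \<bullet> p) ^ (2 * j)) =
        (LINT v|sphere_measure. D (?U v) * (?U v \<bullet> p) ^ (2 * j))"
      by (rule integral_sphere_orthogonal[OF U, symmetric]) (intro continuous_intros cD)
    also have "\<dots> = (LINT v|sphere_measure. D (?U v) * (v \<bullet> e) ^ (2 * j))"
    proof -
      have "?U v \<bullet> p = v \<bullet> e" for v
        using U Ue by (metis orthogonal_transformation_def)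
      then show ?thesis by simp
    qed
    also have "\<dots> = (LINT v|sphere_measure. D (?U v) * (LINT u|sphere_measure. \<bar>v \<bullet> u\<bar> * h u))"
      by (intro Bochner_Integration.integral_cong) (auto simp: space_sphere_measure Th)
    also have "\<dots> = (LINT u|sphere_measure. (LINT v|sphere_measure. \<bar>u \<bullet> v\<bar> * D (?U v)) * h u)"
      by (rule cosine_kernel_self_adjoint[OF cDU ch])
    also have "\<dots> = (LINT u|(sphere_measure :: 'a measure). 0)"
    proof (intro Bochner_Integration.integral_cong refl)
      fix u :: 'a assume "u \<in> space sphere_measure"
      then have "?U u \<in> sphere 0 1" using U by (simp add: space_sphere_measure orthogonal_transformation)
      then show "(LINT v|sphere_measure. \<bar>u \<bullet> v\<bar> * D (?U v)) * h u = 0"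
        using cosine_kernel_orthogonal[OF U cD, of u] TD by simp
    qed
    finally show ?thesis by simp
  qed
  have "D p = 0" if "p \<in> sphere 0 1" for p
  proof (rule antisym)
    have p: "norm p = 1" using that by simp
    have even: "D (- v) = D v" if "v \<in> sphere 0 1" for v
      using even_smooth_sphereD(2)[OF g(1) that] even_smooth_sphereD(2)[OF g(2) that]
      by (simp add: D_def)
    show "D p \<le> 0"
      by (rule even_moments_zero_imp_nonpos[OF cD even p moment[OF p]])
    \<comment> \<open>The concentration argument is one-sided, so it is repeated for
      \<open>- D\<close>.\<close>
    have "- D p \<le> 0"
      by (rule even_moments_zero_imp_nonpos[where D = "\<lambda>v. - D v"])
        (use even p moment[OF p] in \<open>auto intro!: continuous_intros cD\<close>)
    then show "0 \<le> D p" by simp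
  qed
  then show "g1 = g2"
    using even_smooth_sphereD(3)[OF g(1)] even_smooth_sphereD(3)[OF g(2)]
    by (intro extensionalityI) (auto simp: D_def)
qed

theorem theorem3p1:
  fixes n :: nat
  assumes "n \<ge> 2" and "CARD('m::finite) = 2 * n"
  shows "\<exists>\<alpha>::real. \<alpha> \<noteq> 0 \<and>
    (\<forall>(b :: nat \<Rightarrow> 'm) (e :: nat \<Rightarrow> real ^ 'm) (f :: real ^ 'm \<Rightarrow> real) (\<phi> :: real \<Rightarrow> real).
       bij_betw b {1..2 * n} UNIV \<longrightarrow>
       e = (\<lambda>k. axis (b k) 1) \<longrightarrow>
       continuous_on UNIV f \<longrightarrow>
       smooth_on (UNIV - {0}) f \<longrightarrow>
       rotationally_symmetric (e (2 * n)) f \<longrightarrow>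
       (\<forall>c x. f (c *\<^sub>R x) = \<bar>c\<bar> * f x) \<longrightarrow>
       \<phi> = (\<lambda>t. f (e (2 * n - 1) + t *\<^sub>R e (2 * n))) \<longrightarrow>
       (\<forall>x\<in>{0<..<1}. \<forall>u\<in>sphere 0 1. u \<bullet> e (2 * n) = x \<longrightarrow>
          inverse \<alpha> * inverse_cosine_transform (restrict f (sphere 0 1)) u =
          (-2) ^ (n - 1) / x ^ (2 * n + 1) *
            (deriv ^^ (n - 1)) (\<lambda>t. deriv (deriv \<phi>) (sqrt t)) ((1 - x\<^sup>2) / x\<^sup>2)))"
proof -
  define k where "k = n - 1"
  have n: "n = Suc k" and k: "k \<ge> 1" using assms(1) by (auto simp: k_def)
  have dim: "DIM(real ^ 'm) = 2 * Suc k" using assms(2) by (simp add: n)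
  \<comment> \<open>Dividing by \<open>(-2) ^ k\<close> produces the factor displayed in the
    theorem; the signs cancel and \<open>\<alpha>\<close> is positive. It depends on
    \<open>n\<close> alone, being fixed before \<open>f\<close> and the axes.\<close>
  define \<alpha> where "\<alpha> = inversion_constant k / (-2) ^ k"
  have c0: "inversion_constant k \<noteq> 0"
    using unit_ball_vol_pos[of "2 * real k"] unfolding inversion_constant_def
    by (simp del: unit_ball_vol_pos)
  then have "\<alpha> \<noteq> 0" by (simp add: \<alpha>_def)
  moreover have "inverse \<alpha> * inverse_cosine_transform (restrict f (sphere 0 1)) u =
          (-2) ^ (n - 1) / x ^ (2 * n + 1) *
            (deriv ^^ (n - 1)) (\<lambda>t. deriv (deriv (\<lambda>t. f (axis (b (2 * n - 1)) 1 + t *\<^sub>R axis (b (2 * n)) 1))) (sqrt t))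
              ((1 - x\<^sup>2) / x\<^sup>2)"
    if b: "bij_betw b {1..2 * n} UNIV" and f: "smooth_on (UNIV - {0}) f"
      "rotationally_symmetric (axis (b (2 * n)) 1) f" "\<And>c x. f (c *\<^sub>R x) = \<bar>c\<bar> * f x"
      and x: "x \<in> {0<..<1}" and u: "u \<in> sphere 0 1" "u \<bullet> axis (b (2 * n)) 1 = x"
    for b :: "nat \<Rightarrow> 'm" and f :: "real ^ 'm \<Rightarrow> real" and x u
  proof -
    let ?e = "axis (b (2 * n)) 1 :: real ^ 'm" and ?e' = "axis (b (2 * n - 1)) 1 :: real ^ 'm"
    have "b (2 * n) \<noteq> b (2 * n - 1)"
      using b assms(1) unfolding bij_betw_def by (auto dest!: inj_onD[of b _ "2 * n" "2 * n - 1"])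
    then have e: "?e \<in> Basis" "?e' \<in> Basis" "?e \<noteq> ?e'"
      by (auto simp: axis_eq_axis)
    obtain g where g: "g \<in> even_smooth_sphere" "cosine_transform g = restrict f (sphere 0 1)"
      and gv: "\<And>v. v \<in> sphere 0 1 \<Longrightarrow> 0 < v \<bullet> ?e \<Longrightarrow> v \<bullet> ?e < 1 \<Longrightarrow>
      g v = inversion_constant k * (1 / (v \<bullet> ?e)) ^ (2 * k + 3) *
        (deriv ^^ k) (\<lambda>t. deriv (deriv (\<lambda>t. f (?e' + t *\<^sub>R ?e))) (sqrt t)) ((1 - (v \<bullet> ?e)\<^sup>2) / (v \<bullet> ?e)\<^sup>2)"
      by (rule cosine_transform_zonal_surj[OF e dim k f]) blast
    \<comment> \<open>Injectivity makes the choice in \<open>inv_into\<close> return the explicit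
      preimage.\<close>
    have "inverse_cosine_transform (restrict f (sphere 0 1)) = g"
      using inv_into_f_f[OF inj_on_cosine_transform[OF e dim k] g(1)]
      by (simp add: inverse_cosine_transform_def g(2))
    \<comment> \<open>With \<open>n = Suc k\<close> the exponent \<open>2 * k + 3\<close> is
      \<open>2 * n + 1\<close>.\<close>
    moreover have "inverse \<alpha> * (inversion_constant k * (1 / x) ^ (2 * k + 3) * y) =
        (-2) ^ (n - 1) / x ^ (2 * n + 1) * y" for y
      using c0 by (simp add: \<alpha>_def n power_one_over field_simps numeral_3_eq_3)
    ultimately show ?thesis
      using gv[of u] u x by (simp add: n)
  qed
  ultimately show ?thesis
    by (intro exI[of _ \<alpha>]) blast
qed

end
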